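(* Let $s > 0$, $m \in \mathbf{R}$ and $0 \leq \rho \leq 1$. If $u \in \mathscr{S}'(\mathbf{R}^d)$ and $a \in G_\rho^m$, then $$\mathrm{WF}_{\mathrm g}^{s}( a^w(x,D) u) \subseteq \mathrm{WF}_{\mathrm g}^{s}( u).$$
   Context: Write $\langle z\rangle = (1+|z|^2)^{1/2}$ and identify $T^*\mathbf{R}^d$ with $\mathbf{R}^{2d}$. Isotropic Shubin symbols: for $m\in\mathbf{R}$, $0\leq\rho\leq 1$, $G_\rho^m$ is the space of $a \in C^\infty(\mathbf{R}^{2d})$ such that for all $\alpha,\beta\in\mathbf{N}^d$ there is $C_{\alpha,\beta}>0$ with $|\partial_x^\alpha\partial_\xi^\beta a(x,\xi)| \leq C_{\alpha,\beta}\langle (x,\xi)\rangle^{m-\rho|\alpha+\beta|}$ for all $x,\xi\in\mathbf{R}^d$. Weyl quantization: $a^w(x,D)f(x) = (2\pi)^{-d}\int_{\mathbf{R}^{2d}} e^{i\langle x-y,\xi\rangle} a\left(\frac{x+y}{2},\xi\right) f(y)\,dy\,d\xi$ for $f\in\mathscr{S}(\mathbf{R}^d)$ (oscillatory integral). It acts continuously on $\mathscr{S}(\mathbf{R}^d)$ and extends by duality to $\mathscr{S}'(\mathbf{R}^d)$: $(a^w(x,D)u,f) = (u,\overline{a}^w(x,D)f)$ for $f \in \mathscr{S}(\mathbf{R}^d)$. Here $(u,f)$ is the action of $u\in\mathscr{S}'$ on $f\in\mathscr{S}$ that is conjugate linear in $f$ and consistent with the $L^2$ inner product. Short-time Fourier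 transform: for $u \in \mathscr{S}'(\mathbf{R}^d)$ and $\varphi\in\mathscr{S}(\mathbf{R}^d)\setminus\{0\}$, $V_\varphi u(x,\xi) = (2\pi)^{-d/2}(u, M_\xi T_x\varphi)$, where $T_x f(y)=f(y-x)$ and $M_\xi f(y)=e^{i\langle y,\xi\rangle}f(y)$. Anisotropic $s$-Gabor wave front set: for $s>0$ and $u\in\mathscr{S}'(\mathbf{R}^d)$, $\mathrm{WF}_{\mathrm g}^s(u)\subseteq T^*\mathbf{R}^d\setminus 0$ is defined by: a point $z_0\in T^*\mathbf{R}^d\setminus 0$ satisfies $z_0\notin \mathrm{WF}_{\mathrm g}^s(u)$ if there is an open set $U\subseteq T^*\mathbf{R}^d$ with $z_0\in U$ and $\sup_{(x,\xi)\in U,\ \lambda>0}\lambda^N|V_\varphi u(\lambda x,\lambda^s\xi)|<\infty$ for all $N\geq 0$. Here $\varphi\in\mathscr{S}(\mathbf{R}^d)\setminus\{0\}$ is a fixed window; the set does not depend on the choice of $\varphi$. *)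

theory Defs
  imports "HOL-Analysis.Analysis"
begin

text \<open>
  Phase space over \<open>'a\<close> is \<open>'a \<times> 'a\<close>, with points \<open>(x, \<xi>)\<close>; for \<open>'a = real ^ 'n\<close> it is
  the cotangent bundle of Euclidean space, and its norm is the Euclidean norm of
  \<open>2 * CARD('n)\<close>-space.
\<close>

definition jap :: "'a::real_normed_vector \<Rightarrow> real"
  where "jap z = sqrt (1 + (norm z)\<^sup>2)"


subsection \<open>Partial derivatives and smooth functions\<close>

text \<open>
  A multi-index is represented by a list of coordinate directions, its order being the length
  of the list.  For smooth functions the mixed partials commute, so the lists with entries in
  \<^const>\<open>Basis\<close> give exactly the classical derivatives, each one listed possibly several times.
\<close>

primrec partials :: "'a::euclidean_space list \<Rightarrow> ('a \<Rightarrow> complex) \<Rightarrow> 'a \<Rightarrow> complex"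
  where
    "partials [] f = f"
  | "partials (b # bs) f = (\<lambda>x. frechet_derivative (partials bs f) (at x) b)"

text \<open>
  Smoothness: all iterated partial derivatives exist and are differentiable (hence continuous)
  everywhere.
\<close>

definition smooth :: "('a::euclidean_space \<Rightarrow> complex) \<Rightarrow> bool"
  where "smooth f \<longleftrightarrow>
    (\<forall>bs. set bs \<subseteq> Basis \<longrightarrow> (\<forall>x. partials bs f differentiable (at x)))"


subsection \<open>Isotropic Shubin symbols\<close>

definition shubin :: "real \<Rightarrow> real \<Rightarrow> ('a::euclidean_space \<times> 'a \<Rightarrow> complex) set"
  where "shubin \<rho> m = {a. smooth a \<and>
    (\<forall>bs. set bs \<subseteq> Basis \<longrightarrow>
      (\<exists>C>0. \<forall>x \<xi>. norm (partials bs a (x, \<xi>))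
                     \<le> C * jap (x, \<xi>) powr (m - \<rho> * real (length bs))))}"


subsection \<open>Schwartz functions and tempered distributions\<close>

definition schwartz :: "('a::euclidean_space \<Rightarrow> complex) set"
  where "schwartz = {f. smooth f \<and>
    (\<forall>k bs. set bs \<subseteq> Basis \<longrightarrow>
      bdd_above (range (\<lambda>x. jap x ^ k * norm (partials bs f x))))}"

definition schwartz_seminorm :: "nat \<Rightarrow> ('a::euclidean_space \<Rightarrow> complex) \<Rightarrow> real"
  where "schwartz_seminorm k f =
    (SUP (x, bs) \<in> UNIV \<times> {bs. set bs \<subseteq> Basis \<and> length bs \<le> k}.
       jap x ^ k * norm (partials bs f x))"

text \<open>
  Tempered distributions are the linear functionals on \<^const>\<open>schwartz\<close> that are continuous, i.e.
  bounded by one of the increasing seminorms defining the Frechet topology.  They are represented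
  by functionals on all functions; values outside \<^const>\<open>schwartz\<close> are irrelevant.
\<close>

definition tempered :: "(('a::euclidean_space \<Rightarrow> complex) \<Rightarrow> complex) set"
  where "tempered = {u.
    (\<forall>f\<in>schwartz. \<forall>g\<in>schwartz. u (\<lambda>x. f x + g x) = u f + u g) \<and>
    (\<forall>c. \<forall>f\<in>schwartz. u (\<lambda>x. c * f x) = c * u f) \<and>
    (\<exists>C k. \<forall>f\<in>schwartz. norm (u f) \<le> C * schwartz_seminorm k f)}"

text \<open>
  The action that is conjugate linear in the test function.  If \<open>u\<close> is given by a function \<open>h\<close>,
  that is \<open>u f = \<integral> h f\<close>, then \<open>sesq u f = \<integral> h (cnj f)\<close>, the inner product in \<open>L\<^sup>2\<close>.
\<close>

definition sesq :: "(('a \<Rightarrow> complex) \<Rightarrow> complex) \<Rightarrow> ('a \<Rightarrow> complex) \<Rightarrow> complex"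
  where "sesq u f = u (\<lambda>x. cnj (f x))"


subsection \<open>Weyl quantization\<close>

text \<open>
  The oscillatory integral of \<open>F\<close> over \<open>(y, \<xi>)\<close>: the limit of absolutely convergent
  integrals with a Schwartz cut-off \<open>\<theta> (\<epsilon> \<xi>)\<close>, \<open>\<theta> 0 = 1\<close>, as \<open>\<epsilon>\<close> decreases to \<open>0\<close>; the
  limit is required to be the same for all cut-offs.
\<close>

definition osc_integral :: "('a::euclidean_space \<times> 'a \<Rightarrow> complex) \<Rightarrow> complex"
  where "osc_integral F = (THE L. \<forall>\<theta>\<in>schwartz. \<theta> 0 = 1 \<longrightarrow>
    ((\<lambda>\<epsilon>. LINT z|lborel. \<theta> (\<epsilon> *\<^sub>R snd z) * F z) \<longlongrightarrow> L) (at_right 0))"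

definition weyl :: "('a::euclidean_space \<times> 'a \<Rightarrow> complex) \<Rightarrow> ('a \<Rightarrow> complex) \<Rightarrow> 'a \<Rightarrow> complex"
  where "weyl a f x = complex_of_real ((2 * pi) powr (- real DIM('a))) *
    osc_integral (\<lambda>(y, \<xi>). cis ((x - y) \<bullet> \<xi>) * a ((1 / 2) *\<^sub>R (x + y), \<xi>) * f y)"

text \<open>
  The extension to tempered distributions.  The conjugation of the test function \<open>g\<close> turns the
  defining sesquilinear duality \<open>weyl_dist_sesq\<close> below into a formula for the linear functional.
\<close>

definition weyl_dist ::
  "('a::euclidean_space \<times> 'a \<Rightarrow> complex) \<Rightarrow> (('a \<Rightarrow> complex) \<Rightarrow> complex)
     \<Rightarrow> ('a \<Rightarrow> complex) \<Rightarrow> complex"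
  where "weyl_dist a u = (\<lambda>g. sesq u (weyl (\<lambda>z. cnj (a z)) (\<lambda>x. cnj (g x))))"

lemma weyl_dist_sesq: "sesq (weyl_dist a u) f = sesq u (weyl (\<lambda>z. cnj (a z)) f)"
  by (simp add: sesq_def weyl_dist_def)


subsection \<open>Short-time Fourier transform and anisotropic Gabor wave front set\<close>

definition translation :: "'a::euclidean_space \<Rightarrow> ('a \<Rightarrow> complex) \<Rightarrow> 'a \<Rightarrow> complex"
  where "translation x f = (\<lambda>y. f (y - x))"

definition modulation :: "'a::euclidean_space \<Rightarrow> ('a \<Rightarrow> complex) \<Rightarrow> 'a \<Rightarrow> complex"
  where "modulation \<xi> f = (\<lambda>y. cis (y \<bullet> \<xi>) * f y)"

definition stft ::
  "('a::euclidean_space \<Rightarrow> complex) \<Rightarrow> (('a \<Rightarrow> complex) \<Rightarrow> complex) \<Rightarrow> 'a \<times> 'a \<Rightarrow> complex"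
  where "stft \<phi> u = (\<lambda>(x, \<xi>). complex_of_real ((2 * pi) powr (- real DIM('a) / 2)) *
    sesq u (modulation \<xi> (translation x \<phi>)))"

definition gabor_WF ::
  "real \<Rightarrow> ('a::euclidean_space \<Rightarrow> complex) \<Rightarrow> (('a \<Rightarrow> complex) \<Rightarrow> complex) \<Rightarrow> ('a \<times> 'a) set"
  where "gabor_WF s \<phi> u = {z\<^sub>0. z\<^sub>0 \<noteq> 0 \<and>
    \<not> (\<exists>U. open U \<and> z\<^sub>0 \<in> U \<and>
        (\<forall>N::real. N \<ge> 0 \<longrightarrow>
          bdd_above {l powr N * norm (stft \<phi> u (l *\<^sub>R x, l powr s *\<^sub>R \<xi>)) | x \<xi> l.
                       (x, \<xi>) \<in> U \<and> l > 0}))}"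

end

theory Submission
  imports Defs
begin

text \<open>
  Write \<open>\<Pi>(z) \<phi>\<close> for the time-frequency shift of the window by \<open>z\<close> and \<open>b\<close> for the conjugate of the
  symbol \<open>a\<close>.  Up to a constant, the short-time Fourier transform of \<open>a\<^sup>w u\<close> at \<open>z\<close> is the pairing of
  \<open>u\<close> with \<open>b\<^sup>w \<Pi>(z) \<phi>\<close>.  The proof expands this function in time-frequency shifts of the same window,
  \<open>b\<^sup>w \<Pi>(z) \<phi> = \<kappa> \<integral> K(z, w) \<Pi>(w) \<phi> dw\<close>, with a kernel that decays rapidly off the diagonal:
  \<open>\<bar>K(z, w)\<bar> \<le> C \<langle>z\<rangle>\<^sup>M \<langle>z - w\<rangle>\<^sup>-\<^sup>N\<close> for every \<open>N\<close>.  Letting \<open>u\<close> act under the integral shows that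
  the transform of \<open>a\<^sup>w u\<close> is bounded by an integral operator with kernel \<open>\<bar>K\<bar>\<close> applied to the
  modulus of the transform of \<open>u\<close>.  Such an operator preserves rapid decay along the curves
  \<open>(\<lambda> x, \<lambda>\<^sup>s \<xi>)\<close>, locally uniformly in \<open>(x, \<xi>)\<close>, because the curves through a small ball and those
  through the complement of a larger ball with the same centre separate at least like a power of
  \<open>\<lambda>\<close> (\<open>anisotropic_kernel_estimate\<close>).

  The kernel \<open>K(z, w)\<close> is the integral of \<open>b\<close> against the Wigner transform of \<open>\<Pi>(z) \<phi>\<close> and \<open>\<Pi>(w) \<phi>\<close>.
  By covariance the latter is one fixed Schwartz function translated to the midpoint of \<open>z\<close> and \<open>w\<close>,
  times an exponential whose frequency has length \<open>\<bar>z - w\<bar>\<close>, and integration by parts gives the decay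
  (\<open>weyl_kernel_decay\<close>).  The expansion is proved first for symbols with a cut-off in the frequency,
  where all integrals converge absolutely (\<open>weyl_op_reproducing\<close>): for fixed \<open>p\<close>, the function
  \<open>q \<mapsto> K(z, (p, q))\<close> is the Fourier transform of \<open>b\<^sup>w \<Pi>(z) \<phi>\<close> times a translate of the conjugate window,
  so that Fourier inversion applies.  As the kernel bounds are uniform in the cut-off, the limit may
  be taken under the integral; this proves at the same time that the oscillatory integral defining
  \<open>b\<^sup>w \<Pi>(z) \<phi>\<close> exists (\<open>weyl_tf_shift\<close>), and that the result is a Schwartz function.  The action of
  \<open>u\<close> under the integral is justified by approximation with finite sums (\<open>tempered_superposition\<close>).
\<close>


section \<open>The weight and its integrability\<close>

lemma jap_ge_1: "1 \<le> jap z"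
  by (simp add: jap_def)

lemma jap_pos [simp]: "0 < jap z"
  using jap_ge_1[of z] by linarith

lemma jap_nonneg [simp]: "0 \<le> jap z"
  using jap_pos[of z] by linarith

lemma jap_nz [simp]: "jap z \<noteq> 0"
  using jap_pos[of z] by linarith

lemma jap_minus [simp]: "jap (- z) = jap z"
  by (simp add: jap_def)

lemma jap_sq: "(jap z)\<^sup>2 = 1 + (norm z)\<^sup>2"
  by (simp add: jap_def)

lemma norm_le_jap: "norm z \<le> jap z"
  unfolding jap_def by (rule real_le_rsqrt) simp

lemma jap_le_norm: "jap z \<le> 1 + norm z"
  unfolding jap_def by (rule real_le_lsqrt) (auto simp: power2_eq_square algebra_simps)

lemma jap_mono: "norm x \<le> norm y \<Longrightarrow> jap x \<le> jap y"
  unfolding jap_def by (simp add: power_mono)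

lemma jap_commute: "jap (x - y) = jap (y - x)"
  by (simp add: jap_def norm_minus_commute)

text \<open>
  A form of Peetre's inequality: it moves a weight from one point to another, at the cost of the
  weight of their difference.
\<close>

lemma jap_add: "jap (x + y) \<le> 2 * jap x * jap y"
proof -
  have "jap (x + y) \<le> 1 + (norm x + norm y)"
    using jap_le_norm[of "x + y"] norm_triangle_ineq[of x y] by linarith
  also have "\<dots> \<le> jap x * jap y + jap x * jap y"
  proof -
    have "1 * norm y \<le> jap x * jap y" and "norm x * 1 \<le> jap x * jap y"
      by (intro mult_mono jap_ge_1 norm_le_jap; simp)+
    moreover have "(1 + norm x)\<^sup>2 \<le> 2 * (jap x)\<^sup>2 " for x :: 'a
      using zero_le_power2[of "1 - norm x"] unfolding jap_sq
      by (simp add: power2_eq_square algebra_simps)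
    have "1 + (norm x + norm y) \<le> 2 * (jap x * jap y)"
    proof (rule power2_le_imp_le)
      have "(1 + (norm x + norm y))\<^sup>2 \<le> ((1 + norm x) * (1 + norm y))\<^sup>2"
        by (intro power_mono) (auto simp: algebra_simps)
      also have "\<dots> \<le> (2 * (jap x)\<^sup>2) * (2 * (jap y)\<^sup>2)"
        unfolding power_mult_distrib
        by (intro mult_mono \<open>\<And>x. (1 + norm x)\<^sup>2 \<le> 2 * (jap x)\<^sup>2\<close>) auto
      finally show "(1 + (norm x + norm y))\<^sup>2 \<le> (2 * (jap x * jap y))\<^sup>2"
        by (simp add: power_mult_distrib)
    qed simp
    ultimately show ?thesis by linarith
  qed
  finally show ?thesis by simp
qed

lemma jap_add_power: "jap (x + y) ^ k \<le> 2 ^ k * jap x ^ k * jap y ^ k"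
  using power_mono[OF jap_add[of x y], of k] by (simp add: power_mult_distrib)

lemma jap_le_diff_power: "jap x ^ k \<le> 2 ^ k * jap (x - y) ^ k * jap y ^ k"
  using jap_add_power[of "x - y" y k] by simp

lemma jap_scaleR_le: "\<bar>c\<bar> \<le> 1 \<Longrightarrow> jap (c *\<^sub>R x) \<le> jap x"
  by (intro jap_mono) (simp add: mult_left_le_one_le)

lemma jap_fst_le: "jap (fst z) \<le> jap z" and jap_snd_le: "jap (snd z) \<le> jap z"
  by (cases z; simp add: jap_mono norm_fst_le norm_snd_le)+

lemma jap_Pair_le: "jap (x, y) \<le> jap x * jap y"
proof (rule power2_le_imp_le)
  have "(norm (x, y))\<^sup>2 = (norm x)\<^sup>2 + (norm y)\<^sup>2"
    by (simp add: norm_Pair)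
  then show "(jap (x, y))\<^sup>2 \<le> (jap x * jap y)\<^sup>2"
    by (simp add: power_mult_distrib jap_sq algebra_simps)
qed simp

lemma jap_power_mono: "k \<le> l \<Longrightarrow> jap x ^ k \<le> jap x ^ l"
  by (intro power_increasing jap_ge_1)

lemma jap_power_ge_1: "1 \<le> jap x ^ k"
  by (intro one_le_power jap_ge_1)

lemma inverse_jap_power_le_1: "1 / jap x ^ k \<le> 1"
  using jap_power_ge_1[of x k] by simp

lemma continuous_jap [continuous_intros]:
  "continuous_on S f \<Longrightarrow> continuous_on S (\<lambda>x. jap (f x))"
  unfolding jap_def by (intro continuous_intros)

lemma measurable_jap [measurable]:
  fixes f :: "'b \<Rightarrow> 'a::euclidean_space"
  assumes [measurable]: "f \<in> borel_measurable M"
  shows "(\<lambda>x. jap (f x)) \<in> borel_measurable M"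
  unfolding jap_def by measurable

lemma integrable_inverse_1_plus_square: "integrable lborel (\<lambda>x::real. 1 / (1 + x\<^sup>2))"
proof -
  let ?f = "\<lambda>x::real. 1 / (1 + x\<^sup>2)"
  let ?h = "\<lambda>x::real. indicator {0..} x *\<^sub>R ?f x"
  have nn: "(\<integral>\<^sup>+x. ennreal (?f x) * indicator {0..} x \<partial>lborel) = ennreal (pi / 2 - arctan 0)"
    by (rule nn_integral_FTC_atLeast)
      (auto intro!: derivative_eq_intros tendsto_arctan_at_top simp: field_simps power2_eq_square)
  have h: "integrable lborel ?h"
  proof (rule integrableI_nonneg)
    show "(\<integral>\<^sup>+x. ennreal (?h x) \<partial>lborel) < \<infinity>"
    proof -
      have "(\<integral>\<^sup>+x. ennreal (?h x) \<partial>lborel)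
          = (\<integral>\<^sup>+x. ennreal (?f x) * indicator {0..} x \<partial>lborel)"
        by (intro nn_integral_cong) (auto simp: indicator_def)
      then show ?thesis
        using nn by simp
    qed
  qed auto
  have "integrable lborel (\<lambda>x. ?h x + ?h (0 + (-1) * x))"
    by (intro Bochner_Integration.integrable_add h lborel_integrable_real_affine) auto
  then show ?thesis
    by (rule Bochner_Integration.integrable_bound) (auto simp: indicator_def)
qed

text \<open>
  Since \<open>(1 + \<bar>x\<bar>\<^sup>2)\<^sup>n\<close> dominates the product of the \<open>1 + x\<^sub>b\<^sup>2\<close> over the \<open>n\<close> coordinates,
  integrability reduces to the one-dimensional case.
\<close>

lemma integrable_jap:
  assumes "2 * DIM('a::euclidean_space) \<le> k"
  shows "integrable lborel (\<lambda>x::'a. 1 / jap x ^ k)"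
proof -
  interpret product_sigma_finite "\<lambda>_::'a. lborel :: real measure" ..
  let ?p = "\<lambda>x::'a. \<Prod>b\<in>Basis. 1 / (1 + (x \<bullet> b)\<^sup>2)"
  have "integrable (\<Pi>\<^sub>M b\<in>(Basis::'a set). lborel) (\<lambda>f. \<Prod>b\<in>Basis. 1 / (1 + (f b)\<^sup>2) :: real)"
    by (intro product_integrable_prod integrable_inverse_1_plus_square) auto
  moreover have "?p (\<Sum>b\<in>Basis. f b *\<^sub>R b) = (\<Prod>b\<in>Basis. 1 / (1 + (f b)\<^sup>2))" for f
    by (intro prod.cong) (auto simp: inner_sum_left inner_Basis if_distrib cong: if_cong)
  ultimately have "integrable lborel ?p"
    by (subst lborel_eq) (simp add: integrable_distr_eq)
  then show ?thesis
  proof (rule Bochner_Integration.integrable_bound)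
    show "AE x in lborel. norm (1 / jap x ^ k) \<le> norm (?p x)"
    proof (rule AE_I2)
      fix x :: 'a
      have "(\<Prod>b\<in>Basis. 1 + (x \<bullet> b)\<^sup>2) \<le> (\<Prod>b\<in>(Basis::'a set). (jap x)\<^sup>2)"
        using Basis_le_norm[of _ x] by (intro prod_mono) (auto simp: jap_sq abs_le_square_iff[symmetric])
      also have "\<dots> = jap x ^ (2 * DIM('a))"
        by (simp add: power_mult)
      also have "\<dots> \<le> jap x ^ k"
        by (intro jap_power_mono assms)
      finally have *: "(\<Prod>b\<in>Basis. 1 + (x \<bullet> b)\<^sup>2) \<le> jap x ^ k" .
      have "0 < (\<Prod>b\<in>Basis. 1 + (x \<bullet> b)\<^sup>2)"
        by (intro prod_pos) (auto simp: add_pos_nonneg)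
      with * have "1 / jap x ^ k \<le> 1 / (\<Prod>b\<in>Basis. 1 + (x \<bullet> b)\<^sup>2)"
        by (intro divide_left_mono mult_pos_pos) auto
      then show "norm (1 / jap x ^ k) \<le> norm (?p x)"
        by (simp add: prod_dividef prod_nonneg)
    qed
  qed auto
qed

lemma integrable_jap_shift:
  assumes "2 * DIM('a::euclidean_space) \<le> k"
  shows "integrable lborel (\<lambda>x::'a. 1 / jap (x - e) ^ k)"
    and "(LINT x|lborel. 1 / jap (x - e) ^ k) = (LINT x|lborel. 1 / jap (x::'a) ^ k)"
proof -
  have l: "lborel = distr lborel borel (\<lambda>x::'a. - e + x)"
    using lborel_distr_plus[of "- e"] by (rule sym)
  have "integrable (distr lborel borel (\<lambda>x::'a. - e + x)) (\<lambda>x::'a. 1 / jap x ^ k)"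
    using integrable_jap[OF assms] l by simp
  then show "integrable lborel (\<lambda>x::'a. 1 / jap (x - e) ^ k)"
    by (simp add: integrable_distr_eq)
  show "(LINT x|lborel. 1 / jap (x - e) ^ k) = (LINT x|lborel. 1 / jap (x::'a) ^ k)"
    by (subst (2) l) (simp add: integral_distr)
qed


section \<open>Calculus of smooth functions with weighted bounds\<close>

definition pdiff :: "'a::euclidean_space \<Rightarrow> ('a \<Rightarrow> complex) \<Rightarrow> 'a \<Rightarrow> complex"
  where "pdiff b f x = frechet_derivative f (at x) b"

lemma partials_Cons: "partials (b # bs) f = pdiff b (partials bs f)"
  by (simp add: pdiff_def fun_eq_iff)

declare partials.simps(2) [simp del]

lemma partials_snoc: "partials (bs @ [b]) f = partials bs (pdiff b f)"
  by (induction bs) (auto simp: partials_Cons)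

lemma pdiff_eqI: "(f has_derivative f') (at x) \<Longrightarrow> pdiff b f x = f' b"
  unfolding pdiff_def by (metis frechet_derivative_at)

lemma frechet_derivative_worksI:
  "f differentiable (at x) \<Longrightarrow> (f has_derivative frechet_derivative f (at x)) (at x)"
  by (simp add: frechet_derivative_works)

lemma has_derivative_pdiff:
  assumes "f differentiable (at x)"
  shows "(f has_derivative (\<lambda>v. \<Sum>b\<in>Basis. of_real (v \<bullet> b) * pdiff b f x)) (at x)"
proof -
  let ?D = "frechet_derivative f (at x)"
  have D: "(f has_derivative ?D) (at x)"
    using assms by (rule frechet_derivative_worksI)
  then have l: "linear ?D"
    by (rule has_derivative_linear)
  have "?D v = (\<Sum>b\<in>Basis. of_real (v \<bullet> b) * pdiff b f x)" for v
  proof -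
    have "?D v = ?D (\<Sum>b\<in>Basis. (v \<bullet> b) *\<^sub>R b)"
      by (simp add: euclidean_representation)
    also have "\<dots> = (\<Sum>b\<in>Basis. of_real (v \<bullet> b) * pdiff b f x)"
      by (simp add: linear_sum[OF l] linear_scale[OF l] pdiff_def scaleR_conv_of_real)
    finally show ?thesis .
  qed
  then have "?D = (\<lambda>v. \<Sum>b\<in>Basis. of_real (v \<bullet> b) * pdiff b f x)"
    by blast
  with D show ?thesis by metis
qed

lemma smooth_differentiable: "smooth f \<Longrightarrow> f differentiable (at x)"
  unfolding smooth_def by (drule spec[of _ "[]"]) simp

lemma smooth_pdiff: "smooth f \<Longrightarrow> b \<in> Basis \<Longrightarrow> smooth (pdiff b f)"
  unfolding smooth_def partials_snoc[symmetric] by auto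

lemma smooth_partials: "smooth f \<Longrightarrow> set bs \<subseteq> Basis \<Longrightarrow> smooth (partials bs f)"
  by (induction bs) (auto simp: partials_Cons smooth_pdiff)

lemma smooth_continuous: "smooth f \<Longrightarrow> continuous_on UNIV f"
  by (intro continuous_at_imp_continuous_on ballI differentiable_imp_continuous_within
      smooth_differentiable)

lemma smooth_measurable: "smooth f \<Longrightarrow> f \<in> borel_measurable borel"
  by (intro borel_measurable_continuous_onI smooth_continuous)

text \<open>
  A property of families of functions that implies differentiability and is inherited by the
  first order partial derivatives is inherited by all partial derivatives.  Smoothness of a
  function built from smooth functions is always proved by exhibiting such a property.
\<close>

lemma partials_invariant:
  assumes "Q F"
    and "\<And>F b. Q F \<Longrightarrow> b \<in> Basis \<Longrightarrow> Q (\<lambda>i. pdiff b (F i))"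
    and "set bs \<subseteq> Basis"
  shows "Q (\<lambda>i. partials bs (F i))"
  using assms(3) by (induction bs) (auto simp: partials_Cons assms(1,2))

lemma smooth_invariant:
  assumes "Q F"
    and "\<And>F b. Q F \<Longrightarrow> b \<in> Basis \<Longrightarrow> Q (\<lambda>i. pdiff b (F i))"
    and "\<And>F i x. Q F \<Longrightarrow> F i differentiable (at x)"
  shows "smooth (F i)"
  unfolding smooth_def using assms(3)[OF partials_invariant[of Q, OF assms(1,2)]] by blast

text \<open>
  The bounds in use say that a function and its derivatives are dominated by each weight of a
  family \<open>W k\<close>.  The index \<open>i\<close> is a parameter in which the bounds are uniform.
\<close>

definition dbounded ::
    "('k \<Rightarrow> 'i \<Rightarrow> 'a::euclidean_space \<Rightarrow> real) \<Rightarrow> ('i \<Rightarrow> 'a \<Rightarrow> complex) \<Rightarrow> bool"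
  where "dbounded W f \<longleftrightarrow> (\<forall>i. smooth (f i)) \<and>
    (\<forall>bs k. set bs \<subseteq> Basis \<longrightarrow> (\<exists>C\<ge>0. \<forall>i x. norm (partials bs (f i) x) \<le> C * W k i x))"

lemma dbounded_smooth: "dbounded W f \<Longrightarrow> smooth (f i)"
  by (simp add: dbounded_def)

lemma dbounded_bound:
  assumes "dbounded W f" "set bs \<subseteq> Basis"
  obtains C where "C \<ge> 0" "\<And>i x. norm (partials bs (f i) x) \<le> C * W k i x"
  using assms unfolding dbounded_def by meson

lemma dbounded_bound0:
  assumes "dbounded W f"
  obtains C where "C \<ge> 0" "\<And>i x. norm (f i x) \<le> C * W k i x"
  using dbounded_bound[OF assms, of "[]" k] by auto

lemma dbounded_pdiff: "dbounded W f \<Longrightarrow> b \<in> Basis \<Longrightarrow> dbounded W (\<lambda>i. pdiff b (f i))"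
  unfolding dbounded_def partials_snoc[symmetric] by (auto intro: smooth_pdiff)

lemma dbounded_reindex: "dbounded W f \<Longrightarrow> dbounded (\<lambda>k i. W k (h i)) (\<lambda>i. f (h i))"
  unfolding dbounded_def by meson

inductive sum_closure :: "(('i \<Rightarrow> 'a \<Rightarrow> complex) \<Rightarrow> bool) \<Rightarrow> ('i \<Rightarrow> 'a \<Rightarrow> complex) \<Rightarrow> bool"
  for Q where
    base: "Q F \<Longrightarrow> sum_closure Q F"
  | add: "sum_closure Q F \<Longrightarrow> sum_closure Q G \<Longrightarrow> sum_closure Q (\<lambda>i x. F i x + G i x)"

lemma sum_closure_sum:
  assumes "finite A" "A \<noteq> {}" "\<And>a. a \<in> A \<Longrightarrow> sum_closure Q (F a)"
  shows "sum_closure Q (\<lambda>i x. \<Sum>a\<in>A. F a i x)"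
  using assms by (induction A rule: finite_ne_induct) (auto intro: sum_closure.add)

lemma pdiff_add:
  assumes "f differentiable (at x)" "g differentiable (at x)"
  shows "pdiff b (\<lambda>x. f x + g x) x = pdiff b f x + pdiff b g x"
  by (subst pdiff_eqI[OF has_derivative_add[OF assms[THEN frechet_derivative_worksI]]])
    (simp add: pdiff_def)

text \<open>
  Differentiating a product gives a sum of products; it therefore suffices that the
  derivatives of the generators are sums of generators.
\<close>

lemma dbounded_sum_closure:
  assumes Q: "Q F"
    and diff: "\<And>F i x. Q F \<Longrightarrow> F i differentiable (at x)"
    and deriv: "\<And>F b. Q F \<Longrightarrow> b \<in> Basis \<Longrightarrow> sum_closure Q (\<lambda>i. pdiff b (F i))"
    and bound: "\<And>F k. Q F \<Longrightarrow> \<exists>C\<ge>0. \<forall>i x. norm (F i x) \<le> C * W k i x"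
  shows "dbounded W F"
proof -
  have diff': "F i differentiable (at x)" if "sum_closure Q F" for F i x
    using that by induction (auto intro: diff)
  have deriv': "sum_closure Q (\<lambda>i. pdiff b (F i))" if "sum_closure Q F" "b \<in> Basis" for F b
    using that
  proof induction
    case (add F G)
    have "(\<lambda>i. pdiff b (\<lambda>x. F i x + G i x)) = (\<lambda>i x. pdiff b (F i) x + pdiff b (G i) x)"
      using add.hyps by (intro ext pdiff_add diff') auto
    then show ?case
      using add by (auto intro: sum_closure.add)
  qed (use deriv in auto)
  have bound': "\<exists>C\<ge>0. \<forall>i x. norm (F i x) \<le> C * W k i x" if "sum_closure Q F" for F k
    using that
  proof induction
    case (add F G)
    then obtain C D where "C \<ge> 0" "D \<ge> 0" "\<forall>i x. norm (F i x) \<le> C * W k i x"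
        "\<forall>i x. norm (G i x) \<le> D * W k i x"
      by blast
    then show ?case
      by (intro exI[of _ "C + D"]) (auto simp: distrib_right intro!: norm_triangle_mono)
  qed (use bound in auto)
  have F: "sum_closure Q F"
    using Q by (rule sum_closure.base)
  show ?thesis
    unfolding dbounded_def
  proof safe
    fix i show "smooth (F i)"
      by (rule smooth_invariant[of "sum_closure Q"]) (auto intro: F deriv' diff')
  next
    fix bs :: "'b list" and k assume "set bs \<subseteq> Basis"
    then show "\<exists>C\<ge>0. \<forall>i x. norm (partials bs (F i) x) \<le> C * W k i x"
      by (intro bound' partials_invariant[of "sum_closure Q"]) (auto intro: F deriv' diff')
  qed
qed

lemma pdiff_mult:
  assumes "f differentiable (at x)" "g differentiable (at x)"
  shows "pdiff b (\<lambda>x. f x * g x) x = f x * pdiff b g x + pdiff b f x * g x"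
  by (subst pdiff_eqI[OF has_derivative_mult[OF assms[THEN frechet_derivative_worksI]]])
    (simp add: pdiff_def)

lemma dbounded_mult:
  fixes f g :: "'i \<Rightarrow> 'a::euclidean_space \<Rightarrow> complex"
  assumes "dbounded W1 f" "dbounded W2 g"
    and W: "\<And>k. \<exists>k1 k2. \<exists>C\<ge>0. \<forall>i x. W1 k1 i x * W2 k2 i x \<le> C * W3 k i x"
  shows "dbounded W3 (\<lambda>i x. f i x * g i x)"
proof (rule dbounded_sum_closure[where
      Q = "\<lambda>F. \<exists>f g. dbounded W1 f \<and> dbounded W2 g \<and> F = (\<lambda>i x. f i x * g i x)"])
  show "\<exists>f' g'. dbounded W1 f' \<and> dbounded W2 g' \<and>
      (\<lambda>i x. f i x * g i x) = (\<lambda>i x. f' i x * g' i x)"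
    using assms by blast
next
  fix F i x assume "\<exists>f g. dbounded W1 f \<and> dbounded W2 g \<and> F = (\<lambda>i x. f i x * g i x)"
  then show "F i differentiable (at x)"
    by (auto intro: differentiable_mult smooth_differentiable dbounded_smooth[of W1]
        dbounded_smooth[of W2])
next
  fix F and b :: 'a assume b: "b \<in> Basis"
  assume "\<exists>f g. dbounded W1 f \<and> dbounded W2 g \<and> F = (\<lambda>i x. f i x * g i x)"
  then obtain f g where fg: "dbounded W1 f" "dbounded W2 g" and F: "F = (\<lambda>i x. f i x * g i x)"
    by blast
  have "(\<lambda>i. pdiff b (F i)) = (\<lambda>i x. f i x * pdiff b (g i) x + pdiff b (f i) x * g i x)"
    unfolding F using fg by (intro ext pdiff_mult smooth_differentiable dbounded_smooth)
  then show "sum_closure (\<lambda>F. \<exists>f g. dbounded W1 f \<and> dbounded W2 g \<and> F = (\<lambda>i x. f i x * g i x))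
      (\<lambda>i. pdiff b (F i))"
    using fg dbounded_pdiff[OF fg(1) b] dbounded_pdiff[OF fg(2) b]
    by (simp only:) (rule sum_closure.add; rule sum_closure.base; blast)
next
  fix F k assume "\<exists>f g. dbounded W1 f \<and> dbounded W2 g \<and> F = (\<lambda>i x. f i x * g i x)"
  then obtain f g where fg: "dbounded W1 f" "dbounded W2 g" and F: "F = (\<lambda>i x. f i x * g i x)"
    by blast
  obtain k1 k2 C where C: "C \<ge> 0" "\<And>i x. W1 k1 i x * W2 k2 i x \<le> C * W3 k i x"
    using W by blast
  obtain C1 where C1: "C1 \<ge> 0" "\<And>i x. norm (f i x) \<le> C1 * W1 k1 i x"
    using dbounded_bound0[OF fg(1)] by blast
  obtain C2 where C2: "C2 \<ge> 0" "\<And>i x. norm (g i x) \<le> C2 * W2 k2 i x"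
    using dbounded_bound0[OF fg(2)] by blast
  have "norm (F i x) \<le> C1 * C2 * C * W3 k i x" for i x
  proof -
    have "norm (F i x) \<le> (C1 * W1 k1 i x) * (C2 * W2 k2 i x)"
      unfolding F norm_mult by (intro mult_mono C1 C2 order.trans[OF norm_ge_zero C1(2)]) auto
    also have "\<dots> \<le> C1 * C2 * (C * W3 k i x)"
      using mult_left_mono[OF C(2)[of i x], of "C1 * C2"] C1(1) C2(1) by (simp add: algebra_simps)
    finally show ?thesis by (simp add: algebra_simps)
  qed
  then show "\<exists>C\<ge>0. \<forall>i x. norm (F i x) \<le> C * W3 k i x"
    using C C1 C2 by (intro exI[of _ "C1 * C2 * C"]) auto
qed

text \<open>
  By the chain rule a derivative of \<open>f i \<circ> (A i + e i)\<close> is a combination of the compositions of the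
  derivatives of \<open>f i\<close>, with coefficients that are bounded uniformly in \<open>i\<close>.
\<close>

lemma dbounded_affine:
  fixes f :: "'i \<Rightarrow> 'b::euclidean_space \<Rightarrow> complex"
    and A :: "'i \<Rightarrow> 'a::euclidean_space \<Rightarrow> 'b"
  assumes f: "dbounded W f"
    and A: "\<And>i. linear (A i)" "\<And>i b. b \<in> Basis \<Longrightarrow> norm (A i b) \<le> D"
    and W: "\<And>k. \<exists>k1. \<exists>C\<ge>0. \<forall>i x. W k1 i (A i x + e i) \<le> C * W' k i x"
  shows "dbounded W' (\<lambda>i x. f i (A i x + e i))"
proof -
  define Q where "Q = (\<lambda>F. \<exists>f c D. dbounded W f \<and> (\<forall>i::'i. \<bar>c i\<bar> \<le> D) \<and>
    F = (\<lambda>i x. complex_of_real (c i) * f i (A i x + e i)))"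
  have deriv: "((\<lambda>x. of_real c * f i (A i x + e i)) has_derivative
      (\<lambda>v. of_real c * (\<Sum>b\<in>Basis. of_real (A i v \<bullet> b) * pdiff b (f i) (A i x + e i)))) (at x)"
    if "dbounded W f" for f i c x
  proof -
    have 1: "((\<lambda>x. A i x + e i) has_derivative A i) (at x)"
      by (rule has_derivative_eq_rhs)
        (auto intro!: derivative_eq_intros linear_imp_has_derivative A)
    have 2: "(f i has_derivative (\<lambda>v. \<Sum>b\<in>Basis. of_real (v \<bullet> b) * pdiff b (f i) (A i x + e i)))
        (at (A i x + e i))"
      using that by (intro has_derivative_pdiff smooth_differentiable dbounded_smooth)
    show ?thesis
      using has_derivative_mult_right[OF has_derivative_compose[OF 1 2]] .
  qed
  have "dbounded W' (\<lambda>i x. of_real 1 * f i (A i x + e i))"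
  proof (rule dbounded_sum_closure[where Q = Q])
    show "Q (\<lambda>i x. of_real 1 * f i (A i x + e i))"
      unfolding Q_def using f by (intro exI[of _ f] exI[of _ "\<lambda>_. 1"] exI[of _ 1]) auto
  next
    fix F i x assume "Q F"
    then show "F i differentiable (at x)"
      using deriv unfolding Q_def differentiable_def by blast
  next
    fix F and b :: 'a assume b: "b \<in> Basis" and "Q F"
    then obtain f c E where f: "dbounded W f" and c: "\<And>i. \<bar>c i\<bar> \<le> E"
      and F: "F = (\<lambda>i x. of_real (c i) * f i (A i x + e i))"
      unfolding Q_def by blast
    have "(\<lambda>i. pdiff b (F i)) = (\<lambda>i x. \<Sum>b'\<in>Basis.
        of_real (c i * (A i b \<bullet> b')) * pdiff b' (f i) (A i x + e i))"
      unfolding F pdiff_eqI[OF deriv[OF f]] by (simp add: sum_distrib_left mult.assoc)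
    moreover have "sum_closure Q (\<lambda>i x. \<Sum>b'\<in>Basis.
        of_real (c i * (A i b \<bullet> b')) * pdiff b' (f i) (A i x + e i))"
    proof (intro sum_closure_sum sum_closure.base)
      fix b' :: 'b assume b': "b' \<in> Basis"
      have "\<bar>c i * (A i b \<bullet> b')\<bar> \<le> E * D" for i
        unfolding abs_mult using c[of i] A(2)[OF b, of i] Basis_le_norm[OF b', of "A i b"]
        by (intro mult_mono) auto
      then show "Q (\<lambda>i x. of_real (c i * (A i b \<bullet> b')) * pdiff b' (f i) (A i x + e i))"
        unfolding Q_def using dbounded_pdiff[OF f b']
        by (intro exI[of _ "\<lambda>i. pdiff b' (f i)"] exI[of _ "\<lambda>i. c i * (A i b \<bullet> b')"]
            exI[of _ "E * D"]) auto
    qed auto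
    ultimately show "sum_closure Q (\<lambda>i. pdiff b (F i))" by simp
  next
    fix F k assume "Q F"
    then obtain f c E where f: "dbounded W f" and c: "\<And>i. \<bar>c i\<bar> \<le> E"
      and F: "F = (\<lambda>i x. of_real (c i) * f i (A i x + e i))"
      unfolding Q_def by blast
    have E: "E \<ge> 0" using c[of undefined] by linarith
    obtain k1 C where C: "C \<ge> 0" "\<And>i x. W k1 i (A i x + e i) \<le> C * W' k i x"
      using W by blast
    obtain C1 where C1: "C1 \<ge> 0" "\<And>i x. norm (f i x) \<le> C1 * W k1 i x"
      using dbounded_bound0[OF f] by blast
    have "norm (F i x) \<le> E * (C1 * (C * W' k i x))" for i x
    proof -
      have "norm (f i (A i x + e i)) \<le> C1 * (C * W' k i x)"
        using mult_left_mono[OF C(2)[of i x] C1(1)] C1(2)[of i "A i x + e i"] by simp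
      then show ?thesis
        unfolding F norm_mult using c[of i] E by (intro mult_mono) auto
    qed
    then show "\<exists>C\<ge>0. \<forall>i x. norm (F i x) \<le> C * W' k i x"
      using E C C1 by (intro exI[of _ "E * C1 * C"]) (auto simp: mult.assoc)
  qed
  then show ?thesis by simp
qed

lemma pdiff_cnj:
  assumes "f differentiable (at x)"
  shows "pdiff b (\<lambda>x. cnj (f x)) x = cnj (pdiff b f x)"
  by (subst pdiff_eqI[OF has_derivative_cnj[OF frechet_derivative_worksI[OF assms]]])
    (simp add: pdiff_def)

lemma differentiable_cnj:
  assumes "f differentiable (at x)"
  shows "(\<lambda>x. cnj (f x)) differentiable (at x)"
  using has_derivative_cnj[OF frechet_derivative_worksI[OF assms]] by (rule differentiableI)

lemma partials_cnj:
  assumes "smooth f" "set bs \<subseteq> Basis"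
  shows "partials bs (\<lambda>x. cnj (f x)) = (\<lambda>x. cnj (partials bs f x))"
  using assms(2)
proof (induction bs)
  case (Cons b bs)
  then show ?case
    using smooth_differentiable[OF smooth_partials[OF assms(1), of bs]]
    by (intro ext) (simp add: partials_Cons pdiff_cnj)
qed simp

lemma smooth_cnj: "smooth f \<Longrightarrow> smooth (\<lambda>x. cnj (f x))"
  unfolding smooth_def[of "\<lambda>x. cnj (f x)"]
  by (simp add: partials_cnj differentiable_cnj smooth_differentiable smooth_partials)

lemma dbounded_cnj: "dbounded W f \<Longrightarrow> dbounded W (\<lambda>i x. cnj (f i x))"
  by (auto simp: dbounded_def smooth_cnj partials_cnj)

lemma pdiff_const_mult:
  assumes "f differentiable (at x)"
  shows "pdiff b (\<lambda>x. c * f x) x = c * pdiff b f x"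
  by (subst pdiff_eqI[OF has_derivative_mult_right[OF frechet_derivative_worksI[OF assms]]])
    (simp add: pdiff_def)

lemma partials_const_mult:
  assumes "smooth f" "set bs \<subseteq> Basis"
  shows "partials bs (\<lambda>x. c * f x) = (\<lambda>x. c * partials bs f x)"
  using assms(2)
proof (induction bs)
  case (Cons b bs)
  then show ?case
    using smooth_differentiable[OF smooth_partials[OF assms(1), of bs]]
    by (intro ext) (simp add: partials_Cons pdiff_const_mult)
qed simp

lemma smooth_const_mult: "smooth f \<Longrightarrow> smooth (\<lambda>x. c * f x)"
  unfolding smooth_def[of "\<lambda>x. c * f x"]
  by (simp add: partials_const_mult smooth_differentiable smooth_partials)

lemma partials_add:
  assumes "smooth f" "smooth g" "set bs \<subseteq> Basis"
  shows "partials bs (\<lambda>x. f x + g x) = (\<lambda>x. partials bs f x + partials bs g x)"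
  using assms(3)
proof (induction bs)
  case (Cons b bs)
  then show ?case
    using smooth_differentiable[OF smooth_partials[OF assms(1), of bs]]
      and smooth_differentiable[OF smooth_partials[OF assms(2), of bs]]
    by (intro ext) (simp add: partials_Cons pdiff_add)
qed simp

lemma smooth_add: "smooth f \<Longrightarrow> smooth g \<Longrightarrow> smooth (\<lambda>x. f x + g x)"
  unfolding smooth_def[of "\<lambda>x. f x + g x"]
  by (simp add: partials_add differentiable_add smooth_differentiable smooth_partials)


subsection \<open>Schwartz functions\<close>

abbreviation schwartz_weight :: "nat \<Rightarrow> unit \<Rightarrow> 'a::euclidean_space \<Rightarrow> real"
  where "schwartz_weight \<equiv> \<lambda>k _ x. 1 / jap x ^ k"

lemma schwartz_iff_dbounded: "f \<in> schwartz \<longleftrightarrow> dbounded schwartz_weight (\<lambda>_. f)"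
proof -
  have "bdd_above (range (\<lambda>x. jap x ^ k * norm (g x))) \<longleftrightarrow>
      (\<exists>C\<ge>0. \<forall>x. norm (g x) \<le> C * (1 / jap x ^ k))"
    for k and g :: "'a \<Rightarrow> complex"
  proof
    assume "bdd_above (range (\<lambda>x. jap x ^ k * norm (g x)))"
    then obtain C where C: "\<And>x. jap x ^ k * norm (g x) \<le> C"
      by (auto simp: bdd_above_def)
    moreover have "C \<ge> 0"
      using C[of 0] by (meson jap_nonneg mult_nonneg_nonneg norm_ge_zero order_trans zero_le_power)
    ultimately show "\<exists>C\<ge>0. \<forall>x. norm (g x) \<le> C * (1 / jap x ^ k)"
      by (intro exI[of _ C]) (auto simp: field_simps)
  next
    assume "\<exists>C\<ge>0. \<forall>x. norm (g x) \<le> C * (1 / jap x ^ k)"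
    then show "bdd_above (range (\<lambda>x. jap x ^ k * norm (g x)))"
      by (auto simp: bdd_above_def field_simps)
  qed
  then show ?thesis
    by (auto simp: schwartz_def dbounded_def)
qed

lemma schwartz_smooth: "f \<in> schwartz \<Longrightarrow> smooth f"
  by (simp add: schwartz_def)

lemma schwartz_bound:
  assumes "f \<in> schwartz"
  obtains C where "C \<ge> 0" "\<And>x. norm (f x) \<le> C / jap x ^ k"
  using dbounded_bound0[OF assms[unfolded schwartz_iff_dbounded], of k] by auto

lemma schwartz_partials_bound:
  assumes "f \<in> schwartz" "set bs \<subseteq> Basis"
  obtains C where "C \<ge> 0" "\<And>x. norm (partials bs f x) \<le> C / jap x ^ k"
  using dbounded_bound[OF assms(1)[unfolded schwartz_iff_dbounded] assms(2), of k] by auto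

lemma schwartz_pdiff: "f \<in> schwartz \<Longrightarrow> b \<in> Basis \<Longrightarrow> pdiff b f \<in> schwartz"
  unfolding schwartz_iff_dbounded by (rule dbounded_pdiff)

lemma schwartz_cnj: "f \<in> schwartz \<Longrightarrow> (\<lambda>x. cnj (f x)) \<in> schwartz"
  unfolding schwartz_iff_dbounded by (rule dbounded_cnj)

lemma schwartz_continuous: "f \<in> schwartz \<Longrightarrow> continuous_on UNIV f"
  by (intro smooth_continuous schwartz_smooth)

lemma schwartz_measurable: "f \<in> schwartz \<Longrightarrow> f \<in> borel_measurable borel"
  by (intro smooth_measurable schwartz_smooth)

lemma schwartz_bounded:
  assumes "f \<in> schwartz"
  obtains C where "C \<ge> 0" "\<And>x. norm (f x) \<le> C"
  using schwartz_bound[OF assms, of 0] by auto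

lemma schwartz_integrable: "f \<in> schwartz \<Longrightarrow> integrable lborel (f :: 'a::euclidean_space \<Rightarrow> complex)"
proof -
  assume f: "f \<in> schwartz"
  obtain C where C: "C \<ge> 0" "\<And>x. norm (f x) \<le> C / jap x ^ (2 * DIM('a))"
    using schwartz_bound[OF f] by blast
  have "integrable lborel (\<lambda>x::'a. C * (1 / jap x ^ (2 * DIM('a))))"
    by (intro integrable_mult_right integrable_jap) auto
  then show "integrable lborel f"
    by (rule Bochner_Integration.integrable_bound) (use C schwartz_measurable[OF f] in auto)
qed

lemma schwartz_add:
  assumes "f \<in> schwartz" "g \<in> schwartz"
  shows "(\<lambda>x. f x + g x) \<in> schwartz"
  unfolding schwartz_iff_dbounded dbounded_def
proof safe
  show "smooth (\<lambda>x. f x + g x)"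
    using assms by (intro smooth_add schwartz_smooth)
next
  fix bs :: "'a list" and k assume bs: "set bs \<subseteq> Basis"
  obtain C where C: "C \<ge> 0" "\<And>x. norm (partials bs f x) \<le> C / jap x ^ k"
    using schwartz_partials_bound[OF assms(1) bs] by blast
  obtain D where D: "D \<ge> 0" "\<And>x. norm (partials bs g x) \<le> D / jap x ^ k"
    using schwartz_partials_bound[OF assms(2) bs] by blast
  show "\<exists>C\<ge>0. \<forall>i x. norm (partials bs (\<lambda>x. f x + g x) x) \<le> C * (1 / jap x ^ k)"
    using C D assms bs
    by (intro exI[of _ "C + D"])
      (auto simp: partials_add schwartz_smooth add_divide_distrib intro!: norm_triangle_mono)
qed

lemma schwartz_const_mult:
  assumes "f \<in> schwartz"
  shows "(\<lambda>x. c * f x) \<in> schwartz"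
  unfolding schwartz_iff_dbounded dbounded_def
proof safe
  show "smooth (\<lambda>x. c * f x)"
    using assms by (intro smooth_const_mult schwartz_smooth)
next
  fix bs :: "'a list" and k assume bs: "set bs \<subseteq> Basis"
  obtain C where C: "C \<ge> 0" "\<And>x. norm (partials bs f x) \<le> C / jap x ^ k"
    using schwartz_partials_bound[OF assms(1) bs] by blast
  show "\<exists>C\<ge>0. \<forall>i x. norm (partials bs (\<lambda>x. c * f x) x) \<le> C * (1 / jap x ^ k)"
    using mult_left_mono[OF C(2), of "norm c"] C(1) assms bs
    by (intro exI[of _ "norm c * C"]) (auto simp: partials_const_mult schwartz_smooth norm_mult)
qed

lemma schwartz_zero: "(\<lambda>_. 0) \<in> schwartz"
proof -
  have "partials bs (\<lambda>_::'a. 0) = (\<lambda>_. 0)" for bs :: "'a list"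
  proof (induction bs)
    case (Cons b bs)
    then show ?case
      by (intro ext) (simp add: partials_Cons pdiff_eqI[OF has_derivative_const])
  qed simp
  then show ?thesis
    by (auto simp: schwartz_def smooth_def)
qed

lemma schwartz_sum: "(\<And>i. i \<in> A \<Longrightarrow> f i \<in> schwartz) \<Longrightarrow> (\<lambda>x. \<Sum>i\<in>A. f i x) \<in> schwartz"
  by (induction A rule: infinite_finite_induct) (auto simp: schwartz_zero intro: schwartz_add)

lemma schwartz_translation: "f \<in> schwartz \<Longrightarrow> (\<lambda>x. f (x + e)) \<in> schwartz"
  unfolding schwartz_iff_dbounded
proof (rule dbounded_affine[where A = "\<lambda>_ x. x" and e = "\<lambda>_. e" and D = 1])
  fix k
  have "1 / jap (x + e) ^ k \<le> (2 ^ k * jap e ^ k) * (1 / jap x ^ k)" for x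
    using jap_add_power[of "x + e" "- e" k] by (simp add: field_simps)
  then show "\<exists>k1. \<exists>C\<ge>0. \<forall>i x. 1 / jap (x + e) ^ k1 \<le> C * (1 / jap x ^ k)"
    by (intro exI[of _ k] exI[of _ "2 ^ k * jap e ^ k"]) auto
qed (auto simp: linear_iff)


section \<open>Integration\<close>

lemma integrable_dominated:
  fixes f :: "'a \<Rightarrow> 'b::{banach, second_countable_topology}" and g :: "'a \<Rightarrow> real"
  assumes "integrable M g" "f \<in> borel_measurable M" "\<And>x. x \<in> space M \<Longrightarrow> norm (f x) \<le> g x"
  shows "integrable M f"
proof (rule Bochner_Integration.integrable_bound[OF assms(1,2)], rule AE_I2)
  fix x assume "x \<in> space M"
  from assms(3)[OF this] show "norm (f x) \<le> norm (g x)"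
    by simp
qed

lemma lborel_shift:
  fixes f :: "'a::euclidean_space \<Rightarrow> 'b::{banach, second_countable_topology}"
  assumes [measurable]: "f \<in> borel_measurable borel"
  shows lborel_integral_shift: "(LINT x|lborel. f (x + e)) = (LINT x|lborel. f x)"
    and lborel_integrable_shift: "integrable lborel (\<lambda>x. f (x + e)) \<longleftrightarrow> integrable lborel f"
proof -
  have l: "lborel = distr lborel borel (\<lambda>x::'a. e + x)"
    using lborel_distr_plus[of e] by (rule sym)
  show "(LINT x|lborel. f (x + e)) = (LINT x|lborel. f x)"
    by (subst (2) l) (simp add: integral_distr add.commute)
  show "integrable lborel (\<lambda>x. f (x + e)) \<longleftrightarrow> integrable lborel f"
    by (subst (2) l) (simp add: integrable_distr_eq add.commute)
qed

lemma integrable_pair_bound: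
  fixes f :: "'a::euclidean_space \<times> 'b::euclidean_space \<Rightarrow> 'c::{banach, second_countable_topology}"
  assumes [measurable]: "f \<in> borel_measurable borel"
    and g: "integrable lborel g" and h: "integrable lborel h"
    and bound: "\<And>x y. norm (f (x, y)) \<le> g x * h y"
  shows "integrable lborel f"
proof -
  have [measurable]: "g \<in> borel_measurable borel" "h \<in> borel_measurable borel"
    using g h by auto
  have "integrable (lborel \<Otimes>\<^sub>M lborel) (\<lambda>z. g (fst z) * h (snd z))"
  proof (rule lborel_pair.Fubini_integrable)
    have "integrable lborel (\<lambda>x. \<bar>g x\<bar> * (LINT y|lborel. \<bar>h y\<bar>))"
      using g by (intro integrable_mult_left integrable_abs) auto
    then show "integrable lborel (\<lambda>x. LINT y|lborel. norm (g (fst (x, y)) * h (snd (x, y))))"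
      by (simp add: abs_mult)
  qed (use h in auto)
  then show ?thesis
    unfolding lborel_prod
    by (rule integrable_dominated) (auto intro: bound)
qed

text \<open>
  The linear substitution \<open>x = v + r / 2\<close>, \<open>y = v - r / 2\<close> is a product of two shears, each of
  which preserves Lebesgue measure by translation invariance in one of the variables.
\<close>

lemma lborel_distr_shear:
  fixes T :: "'a::euclidean_space \<Rightarrow> 'a"
  assumes [measurable]: "T \<in> borel_measurable borel"
  shows "distr lborel borel (\<lambda>(x, y). (x + T y, y)) = (lborel :: ('a \<times> 'a) measure)"
proof (rule measure_eqI)
  fix A :: "('a \<times> 'a) set" assume "A \<in> sets (distr lborel borel (\<lambda>(x, y). (x + T y, y)))"
  then have [measurable]: "A \<in> sets borel" by simp
  have 1: "emeasure lborel B = (\<integral>\<^sup>+y. \<integral>\<^sup>+x. indicator B (x, y) \<partial>lborel \<partial>lborel)"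
    if [measurable]: "B \<in> sets borel" for B :: "('a \<times> 'a) set"
  proof -
    have "indicator B \<in> borel_measurable (lborel \<Otimes>\<^sub>M lborel)"
      unfolding lborel_prod by measurable
    then have "(\<integral>\<^sup>+y. \<integral>\<^sup>+x. indicator B (x, y) \<partial>lborel \<partial>lborel)
        = integral\<^sup>N (lborel \<Otimes>\<^sub>M lborel) (indicator B)"
      by (rule lborel_pair.nn_integral_snd)
    then show ?thesis
      by (simp add: lborel_prod nn_integral_indicator)
  qed
  have [measurable]: "(\<lambda>(x, y). (x + T y, y)) \<in> borel \<rightarrow>\<^sub>M (borel :: ('a \<times> 'a) measure)"
    unfolding borel_prod[symmetric] by measurable
  let ?B = "(\<lambda>(x, y). (x + T y, y)) -` A"
  have B: "?B \<in> sets borel"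
    using measurable_sets[of "\<lambda>(x, y). (x + T y, y)" borel borel A] by simp
  have "emeasure (distr lborel borel (\<lambda>(x, y). (x + T y, y))) A = emeasure lborel ?B"
    by (subst emeasure_distr) auto
  also have "\<dots> = (\<integral>\<^sup>+y. \<integral>\<^sup>+x. indicator A (T y + x, y) \<partial>lborel \<partial>lborel)"
    unfolding 1[OF B]
    by (intro nn_integral_cong) (auto simp: indicator_def add.commute)
  also have "\<dots> = (\<integral>\<^sup>+y. \<integral>\<^sup>+x. indicator A (x, y) \<partial>lborel \<partial>lborel)"
  proof (rule nn_integral_cong)
    fix y :: 'a
    have [measurable]: "(\<lambda>x. indicator A (x, y) :: ennreal) \<in> borel_measurable borel"
    proof -
      have "(\<lambda>x. (x, y)) \<in> borel \<rightarrow>\<^sub>M (borel :: ('a \<times> 'a) measure)"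
        unfolding borel_prod[symmetric] by measurable
      then show ?thesis
        using measurable_compose[of "\<lambda>x. (x, y)" borel borel "indicator A"] by simp
    qed
    show "(\<integral>\<^sup>+x. indicator A (T y + x, y) \<partial>lborel) = (\<integral>\<^sup>+x. indicator A (x, y) \<partial>lborel)"
    proof -
      have "(\<integral>\<^sup>+x. indicator A (x, y) \<partial>distr lborel borel ((+) (T y)))
          = (\<integral>\<^sup>+x. indicator A (T y + x, y) \<partial>lborel)"
        by (rule nn_integral_distr) measurable
      then show ?thesis
        by (simp only: lborel_distr_plus)
    qed
  qed
  also have "\<dots> = emeasure lborel A"
    by (simp add: 1)
  finally show "emeasure (distr lborel borel (\<lambda>(x, y). (x + T y, y))) A = emeasure lborel A" .
qed simp

lemma lborel_midpoint_substitution: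
  fixes f :: "'a::euclidean_space \<times> 'a \<Rightarrow> 'c::{banach, second_countable_topology}"
  assumes f: "integrable lborel f"
  shows "integrable lborel (\<lambda>(v, r). f (v + (1/2) *\<^sub>R r, v - (1/2) *\<^sub>R r))"
    and "(LINT z|lborel. f z) = (LINT (v, r)|lborel. f (v + (1/2) *\<^sub>R r, v - (1/2) *\<^sub>R r))"
proof -
  let ?S1 = "\<lambda>(x, y). (x + y, y) :: 'a \<times> 'a" and ?S2 = "\<lambda>(x, y). (x + (- (1/2)) *\<^sub>R y, y) :: 'a \<times> 'a"
  let ?f1 = "\<lambda>z. f (?S1 z)" and ?sw = "\<lambda>(x, y). (y, x) :: 'a \<times> 'a"
  have ms: "?S1 \<in> borel \<rightarrow>\<^sub>M borel" "?S2 \<in> borel \<rightarrow>\<^sub>M borel" "?sw \<in> borel \<rightarrow>\<^sub>M borel"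
    unfolding borel_prod[symmetric] by measurable
  have d1: "distr lborel borel ?S1 = lborel" and d2: "distr lborel borel ?S2 = lborel"
    by (intro lborel_distr_shear; simp)+
  have m[measurable]: "f \<in> borel_measurable borel"
    using f by auto
  have dsw: "distr lborel borel ?sw = lborel"
  proof -
    have "distr lborel borel ?sw = distr (lborel \<Otimes>\<^sub>M lborel) (lborel \<Otimes>\<^sub>M lborel) ?sw"
      by (rule distr_cong) (simp_all only: lborel_prod sets_lborel)
    also have "\<dots> = lborel \<Otimes>\<^sub>M lborel"
      by (rule lborel_pair.distr_pair_swap[symmetric])
    finally show ?thesis
      by (simp only: lborel_prod)
  qed
  have comp: "f (v + (1/2) *\<^sub>R r, v - (1/2) *\<^sub>R r) = f (?S1 (?sw (?S2 (v, r))))" for v r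
  proof -
    have "(1/2) *\<^sub>R r + (1/2) *\<^sub>R r = r"
      by (simp flip: scaleR_left_distrib)
    moreover have "r + (v - h) = v + h" if "h + h = r" for h :: 'a
      by (simp flip: that)
    ultimately have "r + (v - (1/2) *\<^sub>R r) = v + (1/2) *\<^sub>R r"
      by blast
    moreover have "?S1 (?sw (?S2 (v, r))) = (r + (v - (1/2) *\<^sub>R r), v - (1/2) *\<^sub>R r)"
      by (simp add: add.commute)
    ultimately show ?thesis by (simp only:)
  qed
  have m1: "(\<lambda>z. f (?S1 z)) \<in> borel_measurable borel"
    by (rule measurable_compose[OF ms(1) m])
  have m2: "(\<lambda>z. f (?S1 (?sw z))) \<in> borel_measurable borel"
    by (rule measurable_compose[OF ms(3) m1])
  have ms': "?S1 \<in> lborel \<rightarrow>\<^sub>M borel" "?S2 \<in> lborel \<rightarrow>\<^sub>M borel" "?sw \<in> lborel \<rightarrow>\<^sub>M borel"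
    using ms by (simp_all only: measurable_lborel2)
  have "integrable (distr lborel borel ?S1) f" using f d1 by (simp only:)
  then have "integrable lborel (\<lambda>z. f (?S1 z))"
    by (rule integrable_distr[OF ms'(1)])
  then have "integrable (distr lborel borel ?sw) (\<lambda>z. f (?S1 z))" using dsw by (simp only:)
  then have "integrable lborel (\<lambda>z. f (?S1 (?sw z)))"
    by (rule integrable_distr[OF ms'(3)])
  then have "integrable (distr lborel borel ?S2) (\<lambda>z. f (?S1 (?sw z)))" using d2 by (simp only:)
  then have "integrable lborel (\<lambda>z. f (?S1 (?sw (?S2 z))))"
    by (rule integrable_distr[OF ms'(2)])
  moreover have eq: "(\<lambda>z. f (?S1 (?sw (?S2 z)))) = (\<lambda>(v, r). f (v + (1/2) *\<^sub>R r, v - (1/2) *\<^sub>R r))"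
  proof (rule ext)
    fix z :: "'a \<times> 'a"
    obtain v r where z: "z = (v, r)" by (rule prod.exhaust)
    show "f (?S1 (?sw (?S2 z))) = (case z of (v, r) \<Rightarrow> f (v + (1/2) *\<^sub>R r, v - (1/2) *\<^sub>R r))"
      unfolding z using comp[of v r] by (simp only: prod.case)
  qed
  ultimately show "integrable lborel (\<lambda>(v, r). f (v + (1/2) *\<^sub>R r, v - (1/2) *\<^sub>R r))"
    by (simp only:)
  have "(LINT z|lborel. f z) = (LINT z|distr lborel borel ?S1. f z)" using d1 by (simp only:)
  also have "\<dots> = (LINT z|lborel. f (?S1 z))"
    by (rule integral_distr[OF ms'(1) m])
  also have "\<dots> = (LINT z|distr lborel borel ?sw. f (?S1 z))" using dsw by (simp only:)
  also have "\<dots> = (LINT z|lborel. f (?S1 (?sw z)))"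
    by (rule integral_distr[OF ms'(3) m1])
  also have "\<dots> = (LINT z|distr lborel borel ?S2. f (?S1 (?sw z)))" using d2 by (simp only:)
  also have "\<dots> = (LINT z|lborel. f (?S1 (?sw (?S2 z))))"
    by (rule integral_distr[OF ms'(2) m2])
  finally show "(LINT z|lborel. f z) = (LINT (v, r)|lborel. f (v + (1/2) *\<^sub>R r, v - (1/2) *\<^sub>R r))"
    unfolding eq .
qed


subsection \<open>Differentiation under the integral\<close>

text \<open>
  The difference quotients are bounded by \<open>2 g\<close> by the mean value theorem, so that dominated
  convergence applies.
\<close>

lemma has_derivative_integral:
  fixes H :: "'a::euclidean_space \<Rightarrow> 'b \<Rightarrow> 'c::{banach, second_countable_topology}"
  assumes int: "\<And>x. integrable M (H x)"
    and der: "\<And>x r. ((\<lambda>x. H x r) has_derivative H' x r) (at x)"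
    and bound: "\<And>x r v. norm (H' x r v) \<le> g r * norm v"
    and g: "integrable M g"
    and meas: "\<And>x v. (\<lambda>r. H' x r v) \<in> borel_measurable M"
  shows "((\<lambda>x. LINT r|M. H x r) has_derivative (\<lambda>v. LINT r|M. H' x r v)) (at x)"
proof -
  have int': "integrable M (\<lambda>r. H' x r v)" for x v
  proof (rule integrable_dominated)
    show "integrable M (\<lambda>r. g r * norm v)"
      using g by simp
    show "(\<lambda>r. H' x r v) \<in> borel_measurable M"
      by (rule meas)
    show "norm (H' x r v) \<le> g r * norm v" for r
      by (rule bound)
  qed
  have lin: "linear (H' x r)" for x r
    using der by (rule has_derivative_linear)
  have "linear (\<lambda>v. LINT r|M. H' x r v)"
    by (intro linearI) (simp_all add: linear_add[OF lin] linear_scale[OF lin] int')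
  then have bl: "bounded_linear (\<lambda>v. LINT r|M. H' x r v)"
    by (rule linear_conv_bounded_linear[THEN iffD1])
  define q where "q y r = (1 / norm (y - x)) *\<^sub>R ((H y r - H x r) - H' x r (y - x))" for y r
  have q_lim: "((\<lambda>y. q y r) \<longlongrightarrow> 0) (at x)" for r
  proof (rule tendsto_norm_zero_cancel)
    show "((\<lambda>y. norm (q y r)) \<longlongrightarrow> 0) (at x)"
      using der[of r x] unfolding q_def has_derivative_iff_norm by simp
  qed
  have g0: "0 \<le> g r" for r
  proof -
    obtain v :: 'a where "norm v = 1" by (metis norm_Basis SOME_Basis)
    then show ?thesis
      using order.trans[OF norm_ge_zero bound[of x r v]] by simp
  qed
  have q_bound: "norm (q y r) \<le> 2 * g r" for y r
  proof (cases "y = x")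
    case False
    have on: "onorm (H' z r) \<le> g r" for z
      by (rule onorm_le) (rule bound)
    have "norm (H y r - H x r) \<le> g r * norm (y - x)"
      by (rule differentiable_bound[of UNIV "\<lambda>x. H x r" "\<lambda>x. H' x r"]) (auto intro: der on)
    then have "norm ((H y r - H x r) - H' x r (y - x)) \<le> 2 * g r * norm (y - x)"
      using bound[of x r "y - x"] norm_triangle_ineq4[of "H y r - H x r" "H' x r (y - x)"] by linarith
    then show ?thesis
      using False unfolding q_def norm_scaleR by (simp add: pos_divide_le_eq)
  qed (simp add: q_def g0)
  have q_int: "(LINT r|M. q y r)
      = (1 / norm (y - x)) *\<^sub>R (((LINT r|M. H y r) - (LINT r|M. H x r)) - (LINT r|M. H' x r (y - x)))" for y
    unfolding q_def integral_scaleR_right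
    by (subst Bochner_Integration.integral_diff, intro Bochner_Integration.integrable_diff int, rule int',
        subst Bochner_Integration.integral_diff, rule int, rule int, rule refl)
  have [measurable]: "q y \<in> borel_measurable M" for y
    unfolding q_def
    by (intro borel_measurable_integrable integrable_scaleR_right Bochner_Integration.integrable_diff
        int int')
  have "((\<lambda>y. LINT r|M. q y r) \<longlongrightarrow> 0) (at x)"
    unfolding tendsto_at_iff_sequentially
  proof (intro allI impI)
    fix X assume X: "\<forall>i. X i \<in> UNIV - {x}" "X \<longlonglongrightarrow> x"
    have "(\<lambda>n. LINT r|M. q (X n) r) \<longlonglongrightarrow> (LINT r|M. 0)"
    proof (rule integral_dominated_convergence[where w = "\<lambda>r. 2 * g r"])
      show "AE r in M. (\<lambda>n. q (X n) r) \<longlonglongrightarrow> 0"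
      proof (rule AE_I2)
        fix r
        have "((\<lambda>y. q y r) \<circ> X) \<longlonglongrightarrow> 0"
          using q_lim[of r, unfolded tendsto_at_iff_sequentially] X by blast
        then show "(\<lambda>n. q (X n) r) \<longlonglongrightarrow> 0"
          by (simp only: comp_def)
      qed
    qed (use g q_bound in auto)
    then show "((\<lambda>y. LINT r|M. q y r) \<circ> X) \<longlonglongrightarrow> 0"
      by (simp add: comp_def)
  qed
  then have "((\<lambda>y. norm (LINT r|M. q y r)) \<longlongrightarrow> 0) (at x)"
    by (rule tendsto_norm_zero)
  moreover have "norm (LINT r|M. q y r) = norm (((LINT r|M. H y r) - (LINT r|M. H x r))
      - (LINT r|M. H' x r (y - x))) / norm (y - x)" for y
    unfolding q_int norm_scaleR by simp
  ultimately show ?thesis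
    unfolding has_derivative_iff_norm using bl by simp
qed

lemma pdiff_integral:
  fixes H :: "'b \<Rightarrow> 'a::euclidean_space \<Rightarrow> complex"
  assumes int: "\<And>x. integrable M (\<lambda>r. H r x)"
    and diff: "\<And>x r. H r differentiable (at x)"
    and bound: "\<And>x r b. b \<in> Basis \<Longrightarrow> norm (pdiff b (H r) x) \<le> g b r"
    and g: "\<And>b. b \<in> Basis \<Longrightarrow> integrable M (g b)"
    and meas: "\<And>x b. b \<in> Basis \<Longrightarrow> (\<lambda>r. pdiff b (H r) x) \<in> borel_measurable M"
  shows "(\<lambda>x. LINT r|M. H r x) differentiable (at x)"
    and "b \<in> Basis \<Longrightarrow> pdiff b (\<lambda>x. LINT r|M. H r x) x = (LINT r|M. pdiff b (H r) x)"
proof -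
  let ?D = "\<lambda>x r v. \<Sum>b\<in>Basis. of_real (v \<bullet> b) * pdiff b (H r) x"
  have D: "((\<lambda>x. LINT r|M. H r x) has_derivative (\<lambda>v. LINT r|M. ?D x r v)) (at x)"
  proof (rule has_derivative_integral[where g = "\<lambda>r. \<Sum>b\<in>Basis. g b r"])
    show "(H r has_derivative ?D x r) (at x)" for x r
      by (rule has_derivative_pdiff[OF diff])
    show "norm (?D x r v) \<le> (\<Sum>b\<in>Basis. g b r) * norm v" for x r v
      unfolding sum_distrib_right
    proof (intro sum_norm_le)
      fix b :: 'a assume b: "b \<in> Basis"
      have "norm (pdiff b (H r) x) * \<bar>v \<bullet> b\<bar> \<le> g b r * norm v"
        using bound[OF b, of r x] Basis_le_norm[OF b, of v] order.trans[OF norm_ge_zero bound[OF b, of r x]]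
        by (intro mult_mono) auto
      then show "norm (of_real (v \<bullet> b) * pdiff b (H r) x) \<le> g b r * norm v"
        by (simp add: norm_mult mult.commute)
    qed
    show "(\<lambda>r. ?D x r v) \<in> borel_measurable M" for x v
      using meas by (intro borel_measurable_sum borel_measurable_times) auto
  qed (use int g in auto)
  then show "(\<lambda>x. LINT r|M. H r x) differentiable (at x)"
    by (rule differentiableI)
  assume b: "b \<in> Basis"
  have "?D x r b = pdiff b (H r) x" for r
    using b by (simp add: inner_Basis if_distrib[of of_real] if_distrib[of "\<lambda>c. c * _"] sum.delta cong: if_cong)
  then show "pdiff b (\<lambda>x. LINT r|M. H r x) x = (LINT r|M. pdiff b (H r) x)"
    using pdiff_eqI[OF D, of b] by simp
qed

lemma partials_integral:
  fixes H :: "'b \<Rightarrow> 'a::euclidean_space \<Rightarrow> complex"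
  assumes smooth: "\<And>r. smooth (H r)"
    and bound: "\<And>x r bs. set bs \<subseteq> Basis \<Longrightarrow> norm (partials bs (H r) x) \<le> g bs r"
    and g: "\<And>bs. set bs \<subseteq> Basis \<Longrightarrow> integrable M (g bs)"
    and meas: "\<And>x bs. set bs \<subseteq> Basis \<Longrightarrow> (\<lambda>r. partials bs (H r) x) \<in> borel_measurable M"
    and bs: "set bs \<subseteq> Basis"
  shows "partials bs (\<lambda>x. LINT r|M. H r x) = (\<lambda>x. LINT r|M. partials bs (H r) x)"
    and "smooth (\<lambda>x. LINT r|M. H r x)"
proof -
  have int: "integrable M (\<lambda>r. partials bs (H r) x)" if "set bs \<subseteq> Basis" for bs x
    by (rule integrable_dominated[OF g[OF that] meas[OF that]]) (rule bound[OF that])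
  have D: "(\<lambda>x. LINT r|M. partials bs (H r) x) differentiable (at x)"
    "b \<in> Basis \<Longrightarrow> pdiff b (\<lambda>x. LINT r|M. partials bs (H r) x) x
      = (LINT r|M. pdiff b (partials bs (H r)) x)" if bs: "set bs \<subseteq> Basis" for bs b x
  proof -
    have i: "integrable M (\<lambda>r. partials bs (H r) x)"
      and d: "partials bs (H r) differentiable (at x)" for x r
      using int[OF bs] smooth_differentiable[OF smooth_partials[OF smooth bs]] by blast+
    have Cons: "set (b # bs) \<subseteq> Basis" if "b \<in> Basis" for b
      using that bs by simp
    have b: "norm (pdiff b (partials bs (H r)) x) \<le> g (b # bs) r" if "b \<in> Basis" for b x r
      using bound[OF Cons[OF that], of r x] by (simp add: partials_Cons)
    have m: "(\<lambda>r. pdiff b (partials bs (H r)) x) \<in> borel_measurable M" if "b \<in> Basis" for b x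
      using meas[OF Cons[OF that], of x] by (simp add: partials_Cons)
    have gi: "integrable M (g (b # bs))" if "b \<in> Basis" for b
      by (rule g[OF Cons[OF that]])
    show "(\<lambda>x. LINT r|M. partials bs (H r) x) differentiable (at x)"
      by (rule pdiff_integral(1)[where g = "\<lambda>b. g (b # bs)"]; fact i d b m gi)
    show "pdiff b (\<lambda>x. LINT r|M. partials bs (H r) x) x
      = (LINT r|M. pdiff b (partials bs (H r)) x)" if "b \<in> Basis"
      by (rule pdiff_integral(2)[where g = "\<lambda>b. g (b # bs)"]; fact i d b m gi that)
  qed
  have *: "partials bs (\<lambda>x. LINT r|M. H r x) = (\<lambda>x. LINT r|M. partials bs (H r) x)"
    if "set bs \<subseteq> Basis" for bs
    using that
  proof (induction bs)
    case (Cons b bs)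
    then show ?case
      by (intro ext) (simp add: partials_Cons D)
  qed simp
  show "partials bs (\<lambda>x. LINT r|M. H r x) = (\<lambda>x. LINT r|M. partials bs (H r) x)"
    by (rule *[OF bs])
  show "smooth (\<lambda>x. LINT r|M. H r x)"
    unfolding smooth_def by (auto simp: * D)
qed


subsection \<open>Integration by parts\<close>

text \<open>
  By translation invariance \<open>f (x + b) - f x\<close> has integral zero; it is the integral of the
  derivative over a unit segment, and Fubini's theorem turns its integral into that of the
  derivative.
\<close>

lemma integral_pdiff:
  fixes f :: "'a::euclidean_space \<Rightarrow> complex"
  assumes diff: "\<And>x. f differentiable (at x)"
    and cont: "continuous_on UNIV (pdiff b f)"
    and int: "integrable lborel f" "integrable lborel (pdiff b f)"
  shows "(LINT x|lborel. pdiff b f x) = 0"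
proof -
  let ?I = "LINT x|lborel. pdiff b f x"
  define h where "h s x = indicator {0..1::real} s *\<^sub>R pdiff b f (x + s *\<^sub>R b)" for s x
  have m[measurable]: "pdiff b f \<in> borel_measurable borel" "f \<in> borel_measurable borel"
    using int by auto
  have [measurable]: "case_prod h \<in> borel_measurable (lborel \<Otimes>\<^sub>M lborel)"
    unfolding h_def case_prod_beta by measurable
  have inth: "integrable lborel (h s)" for s
    unfolding h_def using int m by (simp add: lborel_integrable_shift)
  have "integrable (lborel \<Otimes>\<^sub>M lborel) (case_prod h)"
  proof (rule lborel_pair.Fubini_integrable)
    have "(LINT x|lborel. norm (h s x)) = indicator {0..1} s * (LINT x|lborel. norm (pdiff b f x))" for s
      using lborel_integral_shift[of "\<lambda>x. norm (pdiff b f x)" "s *\<^sub>R b"] by (simp add: h_def)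
    then show "integrable lborel (\<lambda>s. LINT x|lborel. norm (case_prod h (s, x)))"
      by (simp add: integrable_mult_left)
  qed (use inth in auto)
  then have "(LINT x|lborel. LINT s|lborel. h s x) = (LINT s|lborel. LINT x|lborel. h s x)"
    by (rule lborel_pair.Fubini_integral)
  moreover have "(LINT x|lborel. h s x) = indicator {0..1} s *\<^sub>R ?I" for s
    unfolding h_def by (simp add: lborel_integral_shift)
  moreover have "(LINT s|lborel. h s x) = f (x + b) - f x" for x
  proof -
    have "((\<lambda>s. f (x + s *\<^sub>R b)) has_vector_derivative pdiff b f (x + s *\<^sub>R b)) (at s within {0..1})" for s
    proof -
      have "((\<lambda>s. x + s *\<^sub>R b) has_derivative (\<lambda>t. t *\<^sub>R b)) (at s)"
        by (auto intro!: derivative_eq_intros)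
      from has_derivative_compose[OF this frechet_derivative_worksI[OF diff]]
      have "((\<lambda>s. f (x + s *\<^sub>R b)) has_derivative (\<lambda>t. frechet_derivative f (at (x + s *\<^sub>R b)) (t *\<^sub>R b))) (at s)" .
      moreover have "linear (frechet_derivative f (at (x + s *\<^sub>R b)))"
        by (rule linear_frechet_derivative[OF diff])
      ultimately show ?thesis
        by (simp add: has_vector_derivative_def linear_scale pdiff_def has_derivative_at_withinI)
    qed
    moreover have "continuous_on {0..1} (\<lambda>s. pdiff b f (x + s *\<^sub>R b))"
      by (rule continuous_on_compose2[OF cont]) (auto intro!: continuous_intros)
    ultimately show ?thesis
      unfolding h_def by (subst integral_FTC_atLeastAtMost[where F = "\<lambda>s. f (x + s *\<^sub>R b)"]) auto
  qed
  moreover have "(LINT x|lborel. f (x + b) - f x) = 0"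
    using int m by (simp add: lborel_integrable_shift lborel_integral_shift)
  ultimately show ?thesis by simp
qed

lemma norm_cis_mult [simp]: "norm (cis t * z) = norm z"
  by (simp add: norm_mult)

lemma continuous_cis_inner [continuous_intros]:
  "continuous_on S f \<Longrightarrow> continuous_on S (\<lambda>x. cis (f x))"
  unfolding cis_conv_exp by (intro continuous_intros)

lemma measurable_cis [measurable]: "cis \<in> borel_measurable borel"
  by (intro borel_measurable_continuous_onI continuous_intros)

lemma has_derivative_cis:
  assumes "(f has_derivative f') (at x)"
  shows "((\<lambda>x. cis (f x)) has_derivative (\<lambda>v. \<i> * of_real (f' v) * cis (f x))) (at x)"
proof -
  have "((\<lambda>x. \<i> * complex_of_real (f x)) has_derivative (\<lambda>v. \<i> * of_real (f' v))) (at x)"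
    by (intro has_derivative_mult_right has_derivative_of_real assms)
  from has_derivative_compose[OF this DERIV_exp[unfolded has_field_derivative_def]]
  show ?thesis
    by (simp add: cis_conv_exp mult.commute)
qed

lemma pdiff_cis_mult:
  fixes f :: "'a::euclidean_space \<Rightarrow> complex"
  assumes "f differentiable (at x)"
  shows "(\<lambda>x. cis (\<zeta> \<bullet> x) * f x) differentiable (at x)"
    and "pdiff b (\<lambda>x. cis (\<zeta> \<bullet> x) * f x) x = \<i> * of_real (\<zeta> \<bullet> b) * (cis (\<zeta> \<bullet> x) * f x) + cis (\<zeta> \<bullet> x) * pdiff b f x"
proof -
  have "((\<lambda>x. cis (\<zeta> \<bullet> x)) has_derivative (\<lambda>v. \<i> * of_real (\<zeta> \<bullet> v) * cis (\<zeta> \<bullet> x))) (at x)"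
    by (intro has_derivative_cis) (auto intro!: derivative_eq_intros)
  note D = has_derivative_mult[OF this frechet_derivative_worksI[OF assms]]
  show "(\<lambda>x. cis (\<zeta> \<bullet> x) * f x) differentiable (at x)"
    using D by (rule differentiableI)
  show "pdiff b (\<lambda>x. cis (\<zeta> \<bullet> x) * f x) x = \<i> * of_real (\<zeta> \<bullet> b) * (cis (\<zeta> \<bullet> x) * f x) + cis (\<zeta> \<bullet> x) * pdiff b f x"
    by (subst pdiff_eqI[OF D]) (simp add: pdiff_def)
qed

lemma integrable_cis_mult:
  fixes f :: "'a::euclidean_space \<Rightarrow> complex"
  assumes "integrable lborel f"
  shows "integrable lborel (\<lambda>x. cis (\<zeta> \<bullet> x) * f x)"
  by (rule Bochner_Integration.integrable_bound[OF assms]) (use assms in auto)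

lemma fourier_pdiff:
  fixes f :: "'a::euclidean_space \<Rightarrow> complex"
  assumes f: "\<And>x. f differentiable (at x)" "continuous_on UNIV (pdiff b f)"
    and int: "integrable lborel f" "integrable lborel (pdiff b f)"
  shows "(LINT x|lborel. cis (\<zeta> \<bullet> x) * pdiff b f x) = - \<i> * of_real (\<zeta> \<bullet> b) * (LINT x|lborel. cis (\<zeta> \<bullet> x) * f x)"
proof -
  let ?g = "\<lambda>x. cis (\<zeta> \<bullet> x) * f x"
  have pd: "pdiff b ?g = (\<lambda>x. \<i> * of_real (\<zeta> \<bullet> b) * (cis (\<zeta> \<bullet> x) * f x) + cis (\<zeta> \<bullet> x) * pdiff b f x)"
    using pdiff_cis_mult(2)[OF f(1)] by blast
  have "continuous_on UNIV f"
    using f(1) by (intro continuous_at_imp_continuous_on ballI differentiable_imp_continuous_within)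
  then have "(LINT x|lborel. pdiff b ?g x) = 0"
    using f int
    by (intro integral_pdiff pdiff_cis_mult(1)) (auto simp: pd intro!: continuous_intros integrable_cis_mult)
  then have "\<i> * of_real (\<zeta> \<bullet> b) * (LINT x|lborel. cis (\<zeta> \<bullet> x) * f x) + (LINT x|lborel. cis (\<zeta> \<bullet> x) * pdiff b f x) = 0"
    using int by (simp add: pd integrable_cis_mult)
  then show ?thesis by (simp add: eq_neg_iff_add_eq_0 add.commute)
qed

lemma fourier_power:
  fixes f :: "'a::euclidean_space \<Rightarrow> complex"
  assumes "smooth f" "b \<in> Basis" "\<And>j. j \<le> N \<Longrightarrow> integrable lborel (partials (replicate j b) f)"
  shows "\<bar>\<zeta> \<bullet> b\<bar> ^ N * norm (LINT x|lborel. cis (\<zeta> \<bullet> x) * f x)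
    \<le> (LINT x|lborel. norm (partials (replicate N b) f x))"
proof -
  let ?I = "\<lambda>j. LINT x|lborel. cis (\<zeta> \<bullet> x) * partials (replicate j b) f x"
  have "norm (?I N) = \<bar>\<zeta> \<bullet> b\<bar> ^ N * norm (LINT x|lborel. cis (\<zeta> \<bullet> x) * f x)"
    using assms(3)
  proof (induction N)
    case (Suc N)
    have s: "smooth (partials (replicate j b) f)" for j
      using assms by (intro smooth_partials) (auto simp: set_replicate_conv_if)
    have "?I (Suc N) = - \<i> * of_real (\<zeta> \<bullet> b) * ?I N"
      unfolding replicate_Suc partials_Cons
    proof (rule fourier_pdiff)
      show "partials (replicate N b) f differentiable (at x)" for x
        by (rule smooth_differentiable[OF s])
      show "continuous_on UNIV (pdiff b (partials (replicate N b) f))"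
        using smooth_continuous[OF s[of "Suc N"]] by (simp add: partials_Cons)
      show "integrable lborel (partials (replicate N b) f)"
        by (rule Suc.prems) simp
      show "integrable lborel (pdiff b (partials (replicate N b) f))"
        using Suc.prems[of "Suc N"] by (simp add: partials_Cons)
    qed
    then have "norm (?I (Suc N)) = \<bar>\<zeta> \<bullet> b\<bar> * norm (?I N)"
      by (simp add: norm_mult)
    also have "norm (?I N) = \<bar>\<zeta> \<bullet> b\<bar> ^ N * norm (LINT x|lborel. cis (\<zeta> \<bullet> x) * f x)"
      by (rule Suc.IH) (simp add: Suc.prems)
    finally show ?case
      by (simp only: power_Suc mult.assoc)
  qed simp
  moreover have "norm (?I N) \<le> (LINT x|lborel. norm (cis (\<zeta> \<bullet> x) * partials (replicate N b) f x))"
    by (rule integral_norm_bound)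
  ultimately show ?thesis by simp
qed

text \<open>
  Only pure powers of the components of \<open>\<zeta>\<close> occur: the largest component alone controls
  the power of the weight.
\<close>

lemma jap_power_le_sum:
  "jap (\<zeta>::'a::euclidean_space) ^ N \<le> (1 + real DIM('a)) ^ N * (1 + (\<Sum>b\<in>Basis. \<bar>\<zeta> \<bullet> b\<bar> ^ N))"
proof -
  define g where "g = (\<lambda>b. \<bar>\<zeta> \<bullet> b\<bar>)"
  have "Max (g ` Basis) \<in> g ` Basis"
    by (intro Max_in) auto
  then obtain b where "b \<in> Basis" "Max (g ` Basis) = g b"
    by (rule imageE)
  moreover have "g c \<le> Max (g ` Basis)" if "c \<in> Basis" for c
    using that by (intro Max_ge) auto
  ultimately have b: "b \<in> Basis" "\<And>c. c \<in> Basis \<Longrightarrow> \<bar>\<zeta> \<bullet> c\<bar> \<le> \<bar>\<zeta> \<bullet> b\<bar>"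
    by (simp_all add: g_def)
  let ?m = "max 1 \<bar>\<zeta> \<bullet> b\<bar>"
  have "jap \<zeta> \<le> 1 + (\<Sum>b\<in>Basis. \<bar>\<zeta> \<bullet> b\<bar>)"
    using jap_le_norm[of \<zeta>] norm_le_l1[of \<zeta>] by linarith
  also have "\<dots> \<le> ?m + (\<Sum>b\<in>(Basis :: 'a set). ?m)"
  proof (intro add_mono sum_mono)
    fix c :: 'a assume "c \<in> Basis"
    from b(2)[OF this] show "\<bar>\<zeta> \<bullet> c\<bar> \<le> ?m"
      by simp
  qed simp
  also have "\<dots> = (1 + real DIM('a)) * ?m"
    by (simp add: algebra_simps)
  finally have "jap \<zeta> ^ N \<le> ((1 + real DIM('a)) * ?m) ^ N"
    by (rule power_mono) simp
  then have 1: "jap \<zeta> ^ N \<le> (1 + real DIM('a)) ^ N * ?m ^ N"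
    by (simp only: power_mult_distrib)
  have "?m ^ N \<le> 1 + \<bar>\<zeta> \<bullet> b\<bar> ^ N"
    by (cases "1 \<le> \<bar>\<zeta> \<bullet> b\<bar>") (simp_all add: max_def)
  also have "\<dots> \<le> 1 + (\<Sum>b\<in>Basis. \<bar>\<zeta> \<bullet> b\<bar> ^ N)"
    using member_le_sum[of b Basis "\<lambda>b. \<bar>\<zeta> \<bullet> b\<bar> ^ N"] b(1) by auto
  finally have "(1 + real DIM('a)) ^ N * ?m ^ N \<le> (1 + real DIM('a)) ^ N * (1 + (\<Sum>b\<in>Basis. \<bar>\<zeta> \<bullet> b\<bar> ^ N))"
    by (intro mult_left_mono) simp_all
  with 1 show ?thesis
    by (rule order.trans)
qed

text \<open>
  Smoothness turns into decay of the Fourier transform.  The constant does not depend on the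
  parameter of the family.
\<close>

lemma dbounded_fourier_decay:
  fixes f :: "'i \<Rightarrow> 'a::euclidean_space \<Rightarrow> complex"
  assumes f: "dbounded W f"
    and W: "\<And>i. integrable lborel (W k i)" "\<And>i. (LINT x|lborel. W k i x) \<le> A i"
  obtains C where "C \<ge> 0"
    "\<And>i \<zeta>. norm (LINT x|lborel. cis (\<zeta> \<bullet> x) * f i x) \<le> C * A i / jap \<zeta> ^ N"
proof -
  have "\<forall>bs. \<exists>C. set bs \<subseteq> Basis \<longrightarrow> C \<ge> 0 \<and> (\<forall>i x. norm (partials bs (f i) x) \<le> C * W k i x)"
    using f unfolding dbounded_def by meson
  then obtain C where C: "\<And>bs. set bs \<subseteq> Basis \<Longrightarrow> C bs \<ge> 0"
    "\<And>bs i x. set bs \<subseteq> Basis \<Longrightarrow> norm (partials bs (f i) x) \<le> C bs * W k i x"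
    by metis
  have int: "integrable lborel (partials bs (f i))"
    and le: "(LINT x|lborel. norm (partials bs (f i) x)) \<le> C bs * A i"
    if bs: "set bs \<subseteq> Basis" for bs i
  proof -
    have m: "partials bs (f i) \<in> borel_measurable lborel"
      using smooth_measurable[OF smooth_partials[OF dbounded_smooth[OF f] bs]] by simp
    show int: "integrable lborel (partials bs (f i))"
      by (rule integrable_dominated[OF integrable_mult_right[OF W(1), of "C bs" i] m])
        (rule C(2)[OF bs])
    have "(LINT x|lborel. norm (partials bs (f i) x)) \<le> (LINT x|lborel. C bs * W k i x)"
      using C(2)[OF bs] W(1) int by (intro integral_mono) auto
    also have "\<dots> \<le> C bs * A i"
      using W(2)[of i] C(1)[OF bs] by (simp add: mult_left_mono)
    finally show "(LINT x|lborel. norm (partials bs (f i) x)) \<le> C bs * A i" .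
  qed
  define D where "D = (1 + real DIM('a)) ^ N * (C [] + (\<Sum>b\<in>Basis. C (replicate N b)))"
  have rep: "set (replicate j b) \<subseteq> Basis" if "b \<in> Basis" for j and b :: 'a
    using that by (simp add: set_replicate_conv_if)
  show ?thesis
  proof (rule that[of D])
    show "D \<ge> 0"
      unfolding D_def using rep by (intro mult_nonneg_nonneg add_nonneg_nonneg sum_nonneg C(1)) auto
    fix i \<zeta>
    let ?J = "norm (LINT x|lborel. cis (\<zeta> \<bullet> x) * f i x)"
    have "?J \<le> (LINT x|lborel. norm (cis (\<zeta> \<bullet> x) * f i x))"
      by (rule integral_norm_bound)
    then have 0: "?J \<le> C [] * A i"
      using le[of "[]" i] by simp
    have b: "\<bar>\<zeta> \<bullet> b\<bar> ^ N * ?J \<le> C (replicate N b) * A i" if "b \<in> Basis" for b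
      using fourier_power[OF dbounded_smooth[OF f, of i] that int[OF rep[OF that]], where N = N and \<zeta> = \<zeta>]
        le[OF rep[OF that], of N i] by linarith
    have "jap \<zeta> ^ N * ?J \<le> (1 + real DIM('a)) ^ N * (1 + (\<Sum>b\<in>Basis. \<bar>\<zeta> \<bullet> b\<bar> ^ N)) * ?J"
      by (intro mult_right_mono jap_power_le_sum) auto
    also have "\<dots> = (1 + real DIM('a)) ^ N * (?J + (\<Sum>b\<in>Basis. \<bar>\<zeta> \<bullet> b\<bar> ^ N * ?J))"
      by (simp only: distrib_right sum_distrib_right mult.assoc mult_1_left)
    also have "\<dots> \<le> (1 + real DIM('a)) ^ N * (C [] * A i + (\<Sum>b\<in>Basis. C (replicate N b) * A i))"
      by (intro mult_left_mono add_mono sum_mono 0 b) auto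
    also have "\<dots> = D * A i"
      by (simp only: D_def distrib_right sum_distrib_right mult.assoc)
    finally show "?J \<le> D * A i / jap \<zeta> ^ N"
      by (simp add: pos_le_divide_eq mult.commute)
  qed
qed


section \<open>The Fourier inversion formula\<close>

definition gauss :: "'a::euclidean_space \<Rightarrow> complex"
  where "gauss x = of_real (exp (- ((norm x)\<^sup>2 / 2)))"

definition gauss_mass :: "'a::euclidean_space itself \<Rightarrow> real"
  where "gauss_mass _ = (LINT x|lborel. exp (- ((norm (x::'a))\<^sup>2 / 2)))"

lemma norm_gauss: "norm (gauss x) = exp (- ((norm x)\<^sup>2 / 2))"
  by (simp add: gauss_def)

lemma gauss_minus [simp]: "gauss (- x) = gauss x"
  by (simp add: gauss_def)

lemma gauss_has_derivative:
  "(gauss has_derivative (\<lambda>v. - of_real (x \<bullet> v) * gauss x)) (at x)"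
proof -
  have "((\<lambda>x. exp (- ((x \<bullet> x) / 2))) has_derivative (\<lambda>v. - (x \<bullet> v) * exp (- ((x \<bullet> x) / 2)))) (at x)"
    by (rule has_derivative_eq_rhs, (rule derivative_eq_intros refl)+)
      (auto simp: fun_eq_iff inner_commute algebra_simps)
  from has_derivative_of_real[OF this, where 'a = complex]
  show ?thesis
    by (simp add: gauss_def[abs_def] power2_norm_eq_inner)
qed

lemma gauss_differentiable: "gauss differentiable (at x)"
  using gauss_has_derivative by (rule differentiableI)

lemma pdiff_gauss: "pdiff b gauss x = - of_real (x \<bullet> b) * gauss x"
  by (rule pdiff_eqI[OF gauss_has_derivative])

lemma continuous_gauss [continuous_intros]:
  "continuous_on S f \<Longrightarrow> continuous_on S (\<lambda>x. gauss (f x))"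
  unfolding gauss_def by (intro continuous_intros ballI) auto

lemma measurable_gauss [measurable]: "gauss \<in> borel_measurable borel"
  by (intro borel_measurable_continuous_onI continuous_intros)

lemma power_div_fact_le_exp:
  assumes "0 \<le> (t::real)"
  shows "t ^ k / fact k \<le> exp t"
proof -
  have "(\<Sum>n\<in>{k}. t ^ n /\<^sub>R fact n) \<le> (\<Sum>n. t ^ n /\<^sub>R fact n)"
    using assms by (intro sum_le_suminf summable_exp_generic) auto
  then show ?thesis
    by (simp add: exp_def divide_inverse mult.commute)
qed

lemma gauss_decay:
  obtains C where "C \<ge> 0" "\<And>x::'a::euclidean_space. norm (gauss x) \<le> C / jap x ^ (2 * k)"
proof
  let ?C = "2 ^ k * fact k * exp (1 / 2) :: real"
  show "?C \<ge> 0" by simp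
  fix x :: 'a
  let ?t = "(jap x)\<^sup>2 / 2"
  have t: "0 \<le> ?t" by simp
  have "?t ^ k / fact k \<le> exp ?t"
    using t by (rule power_div_fact_le_exp)
  then have "?t ^ k \<le> fact k * exp ?t"
    by (simp add: field_simps)
  then have "jap x ^ (2 * k) \<le> 2 ^ k * (fact k * exp ?t)"
    unfolding power_mult by (simp add: power_divide field_simps)
  also have "exp ?t = exp (1 / 2) * exp ((norm x)\<^sup>2 / 2)"
    by (simp add: jap_sq add_divide_distrib exp_add)
  finally show "norm (gauss x) \<le> ?C / jap x ^ (2 * k)"
    by (simp add: norm_gauss exp_minus field_simps)
qed

lemma integrable_gauss: "integrable lborel (gauss :: 'a::euclidean_space \<Rightarrow> complex)"
proof -
  obtain C where "C \<ge> 0" and C: "\<And>x::'a. norm (gauss x) \<le> C / jap x ^ (2 * DIM('a))"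
    using gauss_decay by blast
  have "integrable lborel (\<lambda>x::'a. C * (1 / jap x ^ (2 * DIM('a))))"
    by (intro integrable_mult_right integrable_jap) auto
  then show ?thesis
    by (rule integrable_dominated) (use C in auto)
qed

lemma integrable_inner_gauss:
  "integrable lborel (\<lambda>x::'a::euclidean_space. of_real (x \<bullet> b) * gauss x)"
proof -
  obtain C where C0: "C \<ge> 0" and C: "\<And>x::'a. norm (gauss x) \<le> C / jap x ^ (2 * (DIM('a) + 1))"
    using gauss_decay by blast
  have "integrable lborel (\<lambda>x::'a. norm b * C * (1 / jap x ^ (2 * DIM('a))))"
    by (intro integrable_mult_right integrable_jap) auto
  then show ?thesis
  proof (rule integrable_dominated)
    fix x :: 'a
    have "norm (of_real (x \<bullet> b) * gauss x) \<le> (norm x * norm b) * (C / jap x ^ (2 * (DIM('a) + 1)))"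
      unfolding norm_mult using C[of x] Cauchy_Schwarz_ineq2[of x b] by (intro mult_mono) auto
    also have "\<dots> \<le> (jap x ^ 2 * norm b) * (C / jap x ^ (2 * (DIM('a) + 1)))"
    proof (intro mult_right_mono)
      have "norm x \<le> jap x ^ 1" using norm_le_jap[of x] by simp
      also have "\<dots> \<le> jap x ^ 2" by (rule jap_power_mono) simp
      finally show "norm x \<le> jap x ^ 2" .
    qed (use C0 in auto)
    also have "\<dots> = norm b * C * (1 / jap x ^ (2 * DIM('a)))"
      by (simp add: power_add power2_eq_square field_simps)
    finally show "norm (of_real (x \<bullet> b) * gauss x) \<le> norm b * C * (1 / jap x ^ (2 * DIM('a)))" .
  qed auto
qed

lemma gauss_mass_eq: "of_real (gauss_mass TYPE('a::euclidean_space)) = (LINT x|lborel. gauss (x::'a))"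
  by (simp add: gauss_mass_def gauss_def)

lemma gauss_mass_pos: "0 < gauss_mass TYPE('a::euclidean_space)"
proof -
  have int: "integrable lborel (\<lambda>x::'a. exp (- ((norm x)\<^sup>2 / 2)))"
    using integrable_norm[OF integrable_gauss] by (simp add: norm_gauss)
  have "gauss_mass TYPE('a) \<noteq> 0"
  proof
    assume "gauss_mass TYPE('a) = 0"
    then have "AE x::'a in lborel. exp (- ((norm x)\<^sup>2 / 2)) = 0"
      unfolding gauss_mass_def using int by (subst (asm) integral_nonneg_eq_0_iff_AE) auto
    then have "AE x::'a in lborel. False" by simp
    then have "emeasure lborel (UNIV :: 'a set) = 0"
      by (subst (asm) AE_iff_measurable[of UNIV]) auto
    then show False by simp
  qed
  moreover have "0 \<le> gauss_mass TYPE('a)"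
    unfolding gauss_mass_def by (intro integral_nonneg_AE) auto
  ultimately show ?thesis by simp
qed

text \<open>
  Integration by parts shows that the Fourier transform of the Gaussian satisfies the
  differential equation \<open>\<partial>\<^sub>b F = - \<xi>\<^sub>b F\<close> that characterises multiples of the Gaussian.
\<close>

lemma fourier_gauss:
  "(LINT x|lborel. cis (\<xi> \<bullet> x) * gauss x) = of_real (gauss_mass TYPE('a)) * gauss (\<xi>::'a::euclidean_space)"
proof -
  define F where "F \<xi> = (LINT x|lborel. cis (\<xi> \<bullet> x) * gauss x)" for \<xi> :: 'a
  have D: "((\<lambda>\<xi>. cis (\<xi> \<bullet> x) * gauss x) has_derivative
      (\<lambda>v. \<i> * of_real (v \<bullet> x) * cis (\<xi> \<bullet> x) * gauss x)) (at \<xi>)" for x \<xi> :: 'a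
    by (intro has_derivative_mult_left has_derivative_cis) (auto intro!: derivative_eq_intros)
  have pd: "pdiff b (\<lambda>\<xi>. cis (\<xi> \<bullet> x) * gauss x) \<xi> = \<i> * of_real (b \<bullet> x) * cis (\<xi> \<bullet> x) * gauss x"
    for b x \<xi> :: 'a
    by (rule pdiff_eqI[OF D])
  have d: "(\<lambda>\<xi>. cis (\<xi> \<bullet> x) * gauss x) differentiable (at \<xi>)" for x \<xi> :: 'a
    by (rule differentiableI[OF D])
  have i: "integrable lborel (\<lambda>x. cis (\<xi> \<bullet> x) * gauss x)" for \<xi> :: 'a
    by (rule integrable_cis_mult[OF integrable_gauss])
  have bd: "norm (pdiff b (\<lambda>\<xi>. cis (\<xi> \<bullet> x) * gauss x) \<xi>) \<le> norm (of_real (x \<bullet> b) * gauss x)"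
    for b x \<xi> :: 'a
    by (simp add: pd norm_mult inner_commute)
  have gi: "integrable lborel (\<lambda>x. norm (of_real (x \<bullet> b) * gauss x))" for b :: 'a
    by (rule integrable_norm[OF integrable_inner_gauss])
  have m: "(\<lambda>x. pdiff b (\<lambda>\<xi>. cis (\<xi> \<bullet> x) * gauss x) \<xi>) \<in> borel_measurable lborel" for b \<xi> :: 'a
    unfolding pd by measurable
  note * = pdiff_integral[where M = lborel and H = "\<lambda>x \<xi>. cis (\<xi> \<bullet> x) * gauss x" and
      g = "\<lambda>b x. norm (of_real (x \<bullet> b) * gauss x)", OF i d bd gi m]
  have F_diff: "F differentiable (at \<xi>)" for \<xi>
    unfolding F_def[abs_def] by (rule *(1))
  have F_pd: "pdiff b F \<xi> = - of_real (\<xi> \<bullet> b) * F \<xi>" if b: "b \<in> Basis" for b \<xi>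
  proof -
    have "pdiff b F \<xi> = (LINT x|lborel. \<i> * of_real (b \<bullet> x) * cis (\<xi> \<bullet> x) * gauss x)"
      unfolding F_def[abs_def] pd[symmetric] by (rule *(2)[OF b])
    also have "\<dots> = (LINT x|lborel. - \<i> * (cis (\<xi> \<bullet> x) * pdiff b gauss x))"
      by (intro Bochner_Integration.integral_cong) (auto simp: pdiff_gauss inner_commute)
    also have "\<dots> = - \<i> * (LINT x|lborel. cis (\<xi> \<bullet> x) * pdiff b gauss x)"
      by (rule integral_mult_right_zero)
    also have "(LINT x|lborel. cis (\<xi> \<bullet> x) * pdiff b gauss x) = - \<i> * of_real (\<xi> \<bullet> b) * F \<xi>"
      unfolding F_def
    proof (rule fourier_pdiff[OF gauss_differentiable _ integrable_gauss])
      show "continuous_on UNIV (pdiff b (gauss :: 'a \<Rightarrow> complex))"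
        unfolding pdiff_gauss[abs_def] by (intro continuous_intros)
      show "integrable lborel (pdiff b (gauss :: 'a \<Rightarrow> complex))"
        unfolding pdiff_gauss[abs_def] using integrable_inner_gauss[of b] by simp
    qed
    finally show ?thesis by (simp add: algebra_simps)
  qed
  define G where "G \<xi> = F \<xi> * of_real (exp ((\<xi> \<bullet> \<xi>) / 2))" for \<xi>
  have "(G has_derivative (\<lambda>_. 0)) (at \<xi>)" for \<xi>
  proof -
    have "((\<lambda>x. exp ((x \<bullet> x) / 2)) has_derivative (\<lambda>v. (\<xi> \<bullet> v) * exp ((\<xi> \<bullet> \<xi>) / 2))) (at \<xi>)"
      by (rule has_derivative_eq_rhs, (rule derivative_eq_intros refl)+)
        (auto simp: fun_eq_iff inner_commute algebra_simps)
    from has_derivative_mult[OF has_derivative_pdiff[OF F_diff]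
        has_derivative_of_real[OF this, where 'a = complex]]
    have "(G has_derivative (\<lambda>v. F \<xi> * of_real ((\<xi> \<bullet> v) * exp ((\<xi> \<bullet> \<xi>) / 2)) +
        (\<Sum>b\<in>Basis. of_real (v \<bullet> b) * pdiff b F \<xi>) * of_real (exp ((\<xi> \<bullet> \<xi>) / 2)))) (at \<xi>)"
      by (simp add: G_def[abs_def])
    moreover have "(\<Sum>b\<in>Basis. of_real (v \<bullet> b) * pdiff b F \<xi>) = - of_real (\<xi> \<bullet> v) * F \<xi>" for v
    proof -
      have "(\<Sum>b\<in>Basis. of_real (v \<bullet> b) * pdiff b F \<xi>)
          = - (of_real (\<Sum>b\<in>Basis. (\<xi> \<bullet> b) * (v \<bullet> b)) * F \<xi>)"
        unfolding of_real_sum sum_distrib_right sum_negf[symmetric]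
        by (intro sum.cong) (auto simp: F_pd)
      then show ?thesis by (simp add: euclidean_inner[of \<xi> v])
    qed
    ultimately show ?thesis by (simp add: algebra_simps)
  qed
  then obtain c where c: "\<And>\<xi>. G \<xi> = c"
    using has_derivative_zero_unique[of UNIV G] by (metis UNIV_I convex_UNIV has_derivative_at_withinI)
  have "F 0 = of_real (gauss_mass TYPE('a))"
    by (simp add: F_def gauss_mass_eq)
  then have c': "c = of_real (gauss_mass TYPE('a))"
    using c[of 0] by (simp add: G_def)
  have "of_real (exp ((\<xi> \<bullet> \<xi>) / 2)) * gauss \<xi> = 1"
    unfolding gauss_def power2_norm_eq_inner of_real_mult[symmetric] by (simp add: exp_minus)
  then have "F \<xi> = G \<xi> * gauss \<xi>"
    by (simp add: G_def mult.assoc)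
  then show ?thesis
    by (simp add: c c' F_def)
qed

lemma lborel_integral_affine:
  fixes f :: "'a::euclidean_space \<Rightarrow> complex"
  assumes "c \<noteq> 0" and [measurable]: "f \<in> borel_measurable borel"
  shows "(LINT x|lborel. f x) = of_real (\<bar>c\<bar> ^ DIM('a)) * (LINT x|lborel. f (t + c *\<^sub>R x))"
proof -
  have "(LINT x|lborel. f x)
      = (LINT x|density (distr lborel borel (\<lambda>x. t + c *\<^sub>R x)) (\<lambda>_. ennreal (\<bar>c\<bar> ^ DIM('a))). f x)"
    by (subst lborel_affine[OF assms(1), of t]) simp
  also have "\<dots> = (LINT x|distr lborel borel (\<lambda>x. t + c *\<^sub>R x). (\<bar>c\<bar> ^ DIM('a)) *\<^sub>R f x)"
    by (subst integral_density) auto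
  also have "\<dots> = (LINT x|lborel. (\<bar>c\<bar> ^ DIM('a)) *\<^sub>R f (t + c *\<^sub>R x))"
    by (subst integral_distr) auto
  finally show ?thesis
    by (simp add: scaleR_conv_of_real)
qed

text \<open>
  The integral of the Fourier transform of \<open>h\<close> is regularised by a dilated Gaussian, which
  amounts to an average of \<open>h\<close> with respect to a Gaussian that concentrates.
\<close>

theorem fourier_inversion:
  fixes h :: "'a::euclidean_space \<Rightarrow> complex"
  defines "H \<equiv> \<lambda>q. LINT y|lborel. cis (- (q \<bullet> y)) * h y"
  assumes cont: "continuous_on UNIV h" and bdd: "\<And>y. norm (h y) \<le> B"
    and int: "integrable lborel h" "integrable lborel H"
  shows "(LINT q|lborel. cis (q \<bullet> t) * H q) = of_real ((gauss_mass TYPE('a))\<^sup>2) * h t"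
proof -
  define \<delta> :: "nat \<Rightarrow> real" where "\<delta> n = 1 / real (Suc n)" for n
  have \<delta>: "\<delta> n > 0" for n by (simp add: \<delta>_def)
  have \<delta>_lim: "\<delta> \<longlonglongrightarrow> 0"
    unfolding \<delta>_def by (rule LIMSEQ_Suc[OF lim_1_over_n])
  define J where "J n = (LINT q|lborel. gauss (\<delta> n *\<^sub>R q) * (cis (q \<bullet> t) * H q))" for n
  have mh[measurable]: "h \<in> borel_measurable borel" "H \<in> borel_measurable borel"
    using int by auto
  have g1: "norm (gauss x) \<le> 1" for x :: 'a
    by (simp add: norm_gauss)
  have cont_lim: "(\<lambda>n. f (a + \<delta> n *\<^sub>R x)) \<longlonglongrightarrow> f a"
    if "continuous_on UNIV f" for f :: "'a \<Rightarrow> complex" and a x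
  proof -
    have "(\<lambda>n. a + \<delta> n *\<^sub>R x) \<longlonglongrightarrow> a + 0 *\<^sub>R x"
      by (intro tendsto_intros \<delta>_lim)
    moreover have "isCont f a"
      using that by (simp add: continuous_on_eq_continuous_at)
    ultimately show ?thesis
      using isCont_tendsto_compose by force
  qed
  have gi: "integrable lborel (\<lambda>q::'a. gauss (\<delta> n *\<^sub>R q))" for n
  proof -
    obtain C where C0: "C \<ge> 0" and C: "\<And>x::'a. norm (gauss x) \<le> C / jap x ^ (2 * DIM('a))"
      using gauss_decay by blast
    have le1: "\<delta> n \<le> 1" by (simp add: \<delta>_def)
    have j: "\<delta> n * jap x \<le> jap (\<delta> n *\<^sub>R x)" for x :: 'a
    proof (rule power2_le_imp_le)
      have "(\<delta> n)\<^sup>2 \<le> 1\<^sup>2" using le1 \<delta>[of n] by (intro power_mono) auto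
      then show "(\<delta> n * jap x)\<^sup>2 \<le> (jap (\<delta> n *\<^sub>R x))\<^sup>2"
        by (simp add: power_mult_distrib jap_sq algebra_simps)
    qed simp
    have "integrable lborel (\<lambda>x::'a. C / \<delta> n ^ (2 * DIM('a)) * (1 / jap x ^ (2 * DIM('a))))"
      by (intro integrable_mult_right integrable_jap) auto
    then show ?thesis
    proof (rule integrable_dominated)
      fix x :: 'a
      have "C / jap (\<delta> n *\<^sub>R x) ^ (2 * DIM('a)) \<le> C / (\<delta> n * jap x) ^ (2 * DIM('a))"
        using \<delta>[of n] j[of x] C0 by (intro divide_left_mono power_mono mult_pos_pos zero_less_power) auto
      with C[of "\<delta> n *\<^sub>R x"]
      show "norm (gauss (\<delta> n *\<^sub>R x)) \<le> C / \<delta> n ^ (2 * DIM('a)) * (1 / jap x ^ (2 * DIM('a)))"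
        by (simp add: power_mult_distrib)
    qed auto
  qed
  have lim1: "J \<longlonglongrightarrow> (LINT q|lborel. cis (q \<bullet> t) * H q)"
    unfolding J_def
  proof (rule integral_dominated_convergence)
    show "AE q in lborel. (\<lambda>n. gauss (\<delta> n *\<^sub>R q) * (cis (q \<bullet> t) * H q)) \<longlonglongrightarrow> cis (q \<bullet> t) * H q"
    proof (rule AE_I2)
      fix q :: 'a
      have "(\<lambda>n. gauss (\<delta> n *\<^sub>R q)) \<longlonglongrightarrow> 1"
        using cont_lim[of gauss 0 q] by (simp add: continuous_intros) (simp add: gauss_def)
      from tendsto_mult_right[OF this] show
        "(\<lambda>n. gauss (\<delta> n *\<^sub>R q) * (cis (q \<bullet> t) * H q)) \<longlonglongrightarrow> cis (q \<bullet> t) * H q"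
        by simp
    qed
    show "AE q in lborel. norm (gauss (\<delta> n *\<^sub>R q) * (cis (q \<bullet> t) * H q)) \<le> norm (H q)" for n
      using g1 by (intro AE_I2) (simp add: norm_mult mult_left_le_one_le)
  qed (use int in \<open>auto intro: integrable_norm\<close>)
  have J: "J n = of_real (gauss_mass TYPE('a)) * (LINT v|lborel. h (t + \<delta> n *\<^sub>R v) * gauss v)" for n
  proof -
    let ?d = "\<delta> n"
    have "J n = (LINT q|lborel. LINT y|lborel. gauss (?d *\<^sub>R q) * cis ((t - y) \<bullet> q) * h y)"
    proof -
      have "cis ((t - y) \<bullet> q) = cis (q \<bullet> t) * cis (- (q \<bullet> y))" for q y
        by (simp add: cis_mult inner_diff_left inner_commute[of q])
      then show ?thesis
        by (simp add: J_def H_def mult.assoc)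
    qed
    also have "\<dots> = (LINT y|lborel. LINT q|lborel. gauss (?d *\<^sub>R q) * cis ((t - y) \<bullet> q) * h y)"
    proof (rule lborel_pair.Fubini_integral[symmetric])
      have "integrable lborel (\<lambda>(q, y). gauss (?d *\<^sub>R q) * cis ((t - y) \<bullet> q) * h y)"
      proof (rule integrable_pair_bound[where g = "\<lambda>q. norm (gauss (?d *\<^sub>R q))" and h = "\<lambda>y. norm (h y)"])
        show "(\<lambda>(q, y). gauss (?d *\<^sub>R q) * cis ((t - y) \<bullet> q) * h y) \<in> borel_measurable borel"
          unfolding borel_prod[symmetric] by measurable
      qed (use gi[of n] int in \<open>auto simp: norm_mult\<close>)
      then show "integrable (lborel \<Otimes>\<^sub>M lborel) (\<lambda>(q, y). gauss (?d *\<^sub>R q) * cis ((t - y) \<bullet> q) * h y)"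
        by (simp add: lborel_prod)
    qed
    also have "\<dots> = (LINT y|lborel. of_real (gauss_mass TYPE('a) / ?d ^ DIM('a)) * (gauss ((1 / ?d) *\<^sub>R (t - y)) * h y))"
    proof (intro Bochner_Integration.integral_cong refl)
      fix y
      let ?F = "\<lambda>p. cis (((1 / ?d) *\<^sub>R (t - y)) \<bullet> p) * gauss p"
      have "(LINT p|lborel. ?F p) = of_real (?d ^ DIM('a)) * (LINT q|lborel. ?F (0 + ?d *\<^sub>R q))"
        using \<delta>[of n] by (subst lborel_integral_affine[of ?d _ 0]) auto
      also have "(LINT p|lborel. ?F p) = of_real (gauss_mass TYPE('a)) * gauss ((1 / ?d) *\<^sub>R (t - y))"
        by (rule fourier_gauss)
      also have "(\<lambda>q. ?F (0 + ?d *\<^sub>R q)) = (\<lambda>q. gauss (?d *\<^sub>R q) * cis ((t - y) \<bullet> q))"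
        using \<delta>[of n] by (auto simp: fun_eq_iff mult.commute)
      finally have "(LINT q|lborel. gauss (?d *\<^sub>R q) * cis ((t - y) \<bullet> q))
          = of_real (gauss_mass TYPE('a) / ?d ^ DIM('a)) * gauss ((1 / ?d) *\<^sub>R (t - y))"
        using \<delta>[of n] by (simp add: field_simps)
      then show "(LINT q|lborel. gauss (?d *\<^sub>R q) * cis ((t - y) \<bullet> q) * h y)
          = of_real (gauss_mass TYPE('a) / ?d ^ DIM('a)) * (gauss ((1 / ?d) *\<^sub>R (t - y)) * h y)"
        by simp
    qed
    also have "\<dots> = of_real (?d ^ DIM('a)) * (LINT v|lborel. of_real (gauss_mass TYPE('a) / ?d ^ DIM('a)) *
        (gauss ((1 / ?d) *\<^sub>R (t - (t + ?d *\<^sub>R v))) * h (t + ?d *\<^sub>R v)))"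
      using \<delta>[of n] by (subst lborel_integral_affine[of ?d _ t]) auto
    also have "\<dots> = of_real (gauss_mass TYPE('a)) * (LINT v|lborel. h (t + ?d *\<^sub>R v) * gauss v)"
      using \<delta>[of n] by (simp add: mult.commute)
    finally show ?thesis .
  qed
  have "(\<lambda>n. LINT v|lborel. h (t + \<delta> n *\<^sub>R v) * gauss v) \<longlonglongrightarrow> (LINT v|lborel. h t * gauss (v :: 'a))"
  proof (rule integral_dominated_convergence)
    show "integrable lborel (\<lambda>v::'a. B * norm (gauss v))"
      by (intro integrable_mult_right integrable_norm integrable_gauss)
    show "AE v in lborel. (\<lambda>n. h (t + \<delta> n *\<^sub>R v) * gauss v) \<longlonglongrightarrow> h t * gauss v"
      by (intro AE_I2 tendsto_mult_right cont_lim cont)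
    show "AE v in lborel. norm (h (t + \<delta> n *\<^sub>R v) * gauss v) \<le> B * norm (gauss v)" for n
      using bdd by (intro AE_I2) (simp add: norm_mult mult_right_mono)
  qed auto
  then have "J \<longlonglongrightarrow> of_real (gauss_mass TYPE('a)) * (LINT v|lborel. h t * gauss (v :: 'a))"
    unfolding J[abs_def] by (rule tendsto_mult_left)
  also have "(LINT v|lborel. h t * gauss (v :: 'a)) = h t * of_real (gauss_mass TYPE('a))"
    by (simp add: gauss_mass_eq)
  finally show ?thesis
    using LIMSEQ_unique[OF lim1] by (simp add: power2_eq_square algebra_simps)
qed


section \<open>Superpositions of time-frequency shifts\<close>

definition tf_shift :: "'a::euclidean_space \<times> 'a \<Rightarrow> ('a \<Rightarrow> complex) \<Rightarrow> 'a \<Rightarrow> complex"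
  where "tf_shift w f = (\<lambda>t. cis (t \<bullet> snd w) * f (t - fst w))"

lemma modulation_translation: "modulation \<xi> (translation x f) = tf_shift (x, \<xi>) f"
  by (simp add: modulation_def translation_def tf_shift_def)

lemma pdiff_tf_shift:
  assumes "smooth \<psi>"
  shows "tf_shift w \<psi> differentiable (at t)"
    and "pdiff b (tf_shift w \<psi>) t = \<i> * of_real (snd w \<bullet> b) * tf_shift w \<psi> t + tf_shift w (pdiff b \<psi>) t"
proof -
  have "((\<lambda>t. t - fst w) has_derivative (\<lambda>v. v)) (at t)"
    by (auto intro!: derivative_eq_intros)
  from has_derivative_compose[OF this frechet_derivative_worksI[OF smooth_differentiable[OF assms]]]
  have D: "((\<lambda>t. \<psi> (t - fst w)) has_derivative frechet_derivative \<psi> (at (t - fst w))) (at t)" .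
  then have d: "(\<lambda>t. \<psi> (t - fst w)) differentiable (at t)"
    by (rule differentiableI)
  show "tf_shift w \<psi> differentiable (at t)"
    using pdiff_cis_mult(1)[OF d, of "snd w"] by (simp add: tf_shift_def inner_commute)
  show "pdiff b (tf_shift w \<psi>) t = \<i> * of_real (snd w \<bullet> b) * tf_shift w \<psi> t + tf_shift w (pdiff b \<psi>) t"
    using pdiff_cis_mult(2)[OF d, of b "snd w"] pdiff_eqI[OF D, of b]
    by (simp add: tf_shift_def inner_commute pdiff_def)
qed

text \<open>
  Derivatives of \<^term>\<open>tf_shift w \<psi>\<close> produce powers of the frequency.  The following families
  indexed by phase space are closed under derivatives, and inherit from the generators decay
  and Lipschitz bounds with polynomial growth in the phase space variable.
\<close>

inductive tf_family :: "('a::euclidean_space \<times> 'a \<Rightarrow> 'a \<Rightarrow> complex) \<Rightarrow> bool"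
  where
    shift: "\<psi> \<in> schwartz \<Longrightarrow> tf_family (\<lambda>w. tf_shift w \<psi>)"
  | freq: "tf_family F \<Longrightarrow> tf_family (\<lambda>w t. \<i> * of_real (snd w \<bullet> b) * F w t)"
  | add: "tf_family F \<Longrightarrow> tf_family G \<Longrightarrow> tf_family (\<lambda>w t. F w t + G w t)"

lemma tf_family_differentiable: "tf_family F \<Longrightarrow> F w differentiable (at t)"
  by (induction rule: tf_family.induct)
    (auto simp: pdiff_tf_shift schwartz_smooth intro!: differentiable_mult differentiable_add)

lemma tf_family_pdiff:
  assumes "tf_family F" "b \<in> Basis"
  shows "tf_family (\<lambda>w. pdiff b (F w))"
  using assms
proof (induction rule: tf_family.induct)
  case (shift \<psi>)
  then have "(\<lambda>w. pdiff b (tf_shift w \<psi>)) = (\<lambda>w t. \<i> * of_real (snd w \<bullet> b) * tf_shift w \<psi> t + tf_shift w (pdiff b \<psi>) t)"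
    by (intro ext pdiff_tf_shift schwartz_smooth)
  then show ?case
    using tf_family.add[OF tf_family.freq[OF tf_family.shift[OF shift(1)], of b]
        tf_family.shift[OF schwartz_pdiff[OF shift]]] by simp
next
  case (freq F c)
  have "pdiff b (\<lambda>t. \<i> * of_real (snd w \<bullet> c) * F w t) = (\<lambda>t. \<i> * of_real (snd w \<bullet> c) * pdiff b (F w) t)" for w
    by (intro ext pdiff_const_mult tf_family_differentiable freq)
  then show ?case
    using tf_family.freq[OF freq.IH[OF freq.prems], of c] by simp
next
  case (add F G)
  have "pdiff b (\<lambda>t. F w t + G w t) = (\<lambda>t. pdiff b (F w) t + pdiff b (G w) t)" for w
    by (intro ext pdiff_add tf_family_differentiable add)
  then show ?case
    using tf_family.add[OF add.IH(1,2)] add.prems by simp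
qed

lemma tf_family_smooth: "tf_family F \<Longrightarrow> smooth (F w)"
  by (rule smooth_invariant[of tf_family]) (auto intro: tf_family_pdiff tf_family_differentiable)

lemma tf_family_partials: "tf_family F \<Longrightarrow> set bs \<subseteq> Basis \<Longrightarrow> tf_family (\<lambda>w. partials bs (F w))"
  by (rule partials_invariant[of tf_family]) (auto intro: tf_family_pdiff)

lemma tf_family_continuous: "tf_family F \<Longrightarrow> continuous_on UNIV (\<lambda>w. F w t)"
proof (induction rule: tf_family.induct)
  case (shift \<psi>)
  show ?case
    unfolding tf_shift_def
    by (intro continuous_intros continuous_on_compose2[OF schwartz_continuous[OF shift]]) auto
qed (auto intro!: continuous_intros)

lemma inverse_jap_shift: "1 / jap (x - y) ^ k \<le> 2 ^ k * jap y ^ k / jap x ^ k"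
  using jap_le_diff_power[of x k y] by (simp add: field_simps)

lemma tf_family_bound:
  assumes "tf_family F"
  shows "\<exists>C\<ge>0. \<exists>l. \<forall>w t. norm (F w t) \<le> C * jap w ^ l / jap t ^ k"
  using assms
proof (induction rule: tf_family.induct)
  case (shift \<psi>)
  obtain C where C: "C \<ge> 0" "\<And>x. norm (\<psi> x) \<le> C / jap x ^ k"
    using schwartz_bound[OF shift] by blast
  have "norm (tf_shift w \<psi> t) \<le> C * 2 ^ k * jap w ^ k / jap t ^ k" for w t
  proof -
    have "norm (tf_shift w \<psi> t) \<le> C * (1 / jap (t - fst w) ^ k)"
      using C(2)[of "t - fst w"] by (simp add: tf_shift_def)
    also have "\<dots> \<le> C * (2 ^ k * jap (fst w) ^ k / jap t ^ k)"
      by (intro mult_left_mono inverse_jap_shift C)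
    also have "\<dots> \<le> C * (2 ^ k * jap w ^ k / jap t ^ k)"
      using C(1) by (intro mult_left_mono divide_right_mono power_mono jap_fst_le) auto
    finally show ?thesis by (simp add: mult.assoc)
  qed
  then show ?case
    using C(1) by (intro exI[of _ "C * 2 ^ k"]) auto
next
  case (freq F b)
  then obtain C l where C: "C \<ge> 0" "\<And>w t. norm (F w t) \<le> C * jap w ^ l / jap t ^ k"
    by blast
  have "norm (\<i> * of_real (snd w \<bullet> b) * F w t) \<le> norm b * C * jap w ^ Suc l / jap t ^ k" for w t
  proof -
    have "\<bar>snd w \<bullet> b\<bar> \<le> jap w * norm b"
      using Cauchy_Schwarz_ineq2[of "snd w" b] norm_le_jap[of "snd w"] jap_snd_le[of w]
      by (meson mult_right_mono norm_ge_zero order_trans)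
    then have "\<bar>snd w \<bullet> b\<bar> * norm (F w t) \<le> (jap w * norm b) * (C * jap w ^ l / jap t ^ k)"
      by (rule mult_mono) (use C in auto)
    then show ?thesis by (simp add: norm_mult algebra_simps)
  qed
  then show ?case
    using C(1) by (intro exI[of _ "norm b * C"] conjI exI[of _ "Suc l"]) auto
next
  case (add F G)
  then obtain C l D m where C: "C \<ge> 0" "\<And>w t. norm (F w t) \<le> C * jap w ^ l / jap t ^ k"
    and D: "D \<ge> 0" "\<And>w t. norm (G w t) \<le> D * jap w ^ m / jap t ^ k"
    by blast
  have "norm (F w t + G w t) \<le> (C + D) * jap w ^ (l + m) / jap t ^ k" for w t
  proof -
    have "norm (F w t + G w t) \<le> C * jap w ^ l / jap t ^ k + D * jap w ^ m / jap t ^ k"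
      by (intro norm_triangle_mono C D)
    also have "\<dots> \<le> C * jap w ^ (l + m) / jap t ^ k + D * jap w ^ (l + m) / jap t ^ k"
      using C(1) D(1) by (intro add_mono divide_right_mono mult_left_mono jap_power_mono) auto
    finally show ?thesis by (simp add: algebra_simps add_divide_distrib)
  qed
  then show ?case
    using C(1) D(1) by (intro exI[of _ "C + D"]) auto
qed

lemma norm_cis_diff_le: "norm (cis a - cis b) \<le> \<bar>a - b\<bar>"
proof -
  have "((\<lambda>x::real. cis x) has_derivative (\<lambda>v. \<i> * of_real v * cis x)) (at x)" for x
    by (rule has_derivative_cis) (rule has_derivative_ident)
  moreover have "onorm (\<lambda>v. \<i> * of_real v * cis x) \<le> 1" for x
    by (rule onorm_le) (simp add: norm_mult)
  ultimately have "norm (cis a - cis b) \<le> 1 * norm (a - b)"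
    by (intro differentiable_bound[of UNIV cis "\<lambda>x v. \<i> * of_real v * cis x"]) auto
  then show ?thesis by simp
qed

lemma schwartz_lipschitz:
  fixes \<psi> :: "'a::euclidean_space \<Rightarrow> complex"
  assumes "\<psi> \<in> schwartz"
  obtains C where "C \<ge> 0" "\<And>t p p'. norm (\<psi> (t - p) - \<psi> (t - p')) \<le> C * (jap p * jap p') ^ k * norm (p - p') / jap t ^ k"
proof -
  have "\<forall>b\<in>Basis. \<exists>C\<ge>0. \<forall>x. norm (pdiff b \<psi> x) \<le> C / jap x ^ k"
    using schwartz_bound[OF schwartz_pdiff[OF assms]] by metis
  then obtain c where c: "\<And>b. b \<in> Basis \<Longrightarrow> c b \<ge> 0"
    "\<And>b x. b \<in> Basis \<Longrightarrow> norm (pdiff b \<psi> x) \<le> c b / jap x ^ k"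
    by metis
  define C where "C = (\<Sum>b\<in>Basis. c b)"
  have C0: "C \<ge> 0" unfolding C_def by (intro sum_nonneg c)
  let ?D = "\<lambda>x v. \<Sum>b\<in>Basis. of_real (v \<bullet> b) * pdiff b \<psi> x"
  have D: "(\<psi> has_derivative ?D x) (at x)" for x
    using assms by (intro has_derivative_pdiff smooth_differentiable schwartz_smooth)
  have nD: "norm (?D x v) \<le> C / jap x ^ k * norm v" for x v
  proof -
    have "norm (?D x v) \<le> (\<Sum>b\<in>Basis. norm v * (c b / jap x ^ k))"
    proof (intro sum_norm_le)
      fix b :: 'a assume b: "b \<in> Basis"
      show "norm (of_real (v \<bullet> b) * pdiff b \<psi> x) \<le> norm v * (c b / jap x ^ k)"
        unfolding norm_mult using c(2)[OF b, of x] Basis_le_norm[OF b, of v]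
        by (intro mult_mono) auto
    qed
    also have "\<dots> = C / jap x ^ k * norm v"
      by (simp add: C_def sum_distrib_left sum_distrib_right sum_divide_distrib mult.commute)
    finally show ?thesis .
  qed
  show ?thesis
  proof (rule that[of "2 ^ k * C"])
    show "2 ^ k * C \<ge> 0" using C0 by simp
    fix t p p' :: 'a
    let ?S = "closed_segment (t - p) (t - p')" and ?B = "C * (2 ^ k * (jap p * jap p') ^ k / jap t ^ k)"
    have "norm (\<psi> (t - p) - \<psi> (t - p')) \<le> ?B * norm ((t - p) - (t - p'))"
    proof (rule differentiable_bound[of ?S \<psi> ?D])
      show "(\<psi> has_derivative ?D x) (at x within ?S)" for x
        by (rule has_derivative_at_withinI[OF D])
      fix x assume "x \<in> ?S"
      then obtain r where r: "0 \<le> r" "r \<le> 1" "x = (1 - r) *\<^sub>R (t - p) + r *\<^sub>R (t - p')"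
        by (auto simp: in_segment)
      define y where "y = t - x"
      have "y = (1 - r) *\<^sub>R p + r *\<^sub>R p'"
        unfolding y_def r(3) by (simp add: algebra_simps)
      then have "norm y \<le> (1 - r) * norm p + r * norm p'"
        using norm_triangle_ineq[of "(1 - r) *\<^sub>R p" "r *\<^sub>R p'"] r by simp
      also have "\<dots> \<le> (1 - r) * max (norm p) (norm p') + r * max (norm p) (norm p')"
        using r by (intro add_mono mult_left_mono) auto
      finally have "norm y \<le> max (norm p) (norm p')"
        by (simp add: algebra_simps)
      then have "jap y \<le> jap p \<or> jap y \<le> jap p'"
        using jap_mono[of y p] jap_mono[of y p'] by (auto simp: max_def split: if_splits)
      moreover have "jap p \<le> jap p * jap p'" "jap p' \<le> jap p * jap p'"
        using mult_left_mono[OF jap_ge_1[of p'], of "jap p"] mult_right_mono[OF jap_ge_1[of p], of "jap p'"]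
        by auto
      ultimately have y: "jap y \<le> jap p * jap p'"
        by (meson order.trans)
      have "1 / jap x ^ k \<le> 2 ^ k * jap y ^ k / jap t ^ k"
        using inverse_jap_shift[of t y k] by (simp add: y_def)
      also have "\<dots> \<le> 2 ^ k * (jap p * jap p') ^ k / jap t ^ k"
        by (intro divide_right_mono mult_left_mono power_mono y) auto
      finally have "C * (1 / jap x ^ k) \<le> ?B"
        using C0 by (intro mult_left_mono) auto
      then have "norm (?D x v) \<le> ?B * norm v" for v
        using nD[where x = x and v = v] mult_right_mono[of "C * (1 / jap x ^ k)" ?B "norm v"] by simp
      then show "onorm (?D x) \<le> ?B"
        by (rule onorm_le)
    qed auto
    then show "norm (\<psi> (t - p) - \<psi> (t - p')) \<le> 2 ^ k * C * (jap p * jap p') ^ k * norm (p - p') / jap t ^ k"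
      by (simp add: norm_minus_commute algebra_simps)
  qed
qed

lemma tf_family_lipschitz:
  assumes "tf_family F"
  shows "\<exists>C\<ge>0. \<exists>l. \<forall>w w' t. norm (F w t - F w' t) \<le> C * (jap w * jap w') ^ l * norm (w - w') / jap t ^ k"
  using assms
proof (induction rule: tf_family.induct)
  case (shift \<psi>)
  obtain C where C: "C \<ge> 0" "\<And>x. norm (\<psi> x) \<le> C / jap x ^ Suc k"
    using schwartz_bound[OF shift] by blast
  obtain D where D: "D \<ge> 0" "\<And>t p p'. norm (\<psi> (t - p) - \<psi> (t - p')) \<le> D * (jap p * jap p') ^ k * norm (p - p') / jap t ^ k"
    using schwartz_lipschitz[OF shift] by blast
  have "norm (tf_shift w \<psi> t - tf_shift w' \<psi> t)
      \<le> (C * 2 ^ Suc k + D) * (jap w * jap w') ^ Suc k * norm (w - w') / jap t ^ k" for w w' t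
  proof -
    obtain p q p' q' where w: "w = (p, q)" "w' = (p', q')" by (metis surj_pair)
    let ?J = "(jap w * jap w') ^ Suc k"
    have p: "norm (p - p') \<le> norm (w - w')" and q: "norm (q - q') \<le> norm (w - w')"
      using norm_fst_le[of "p - p'" "q - q'"] norm_snd_le[of "q - q'" "p - p'"] by (auto simp: w)
    have ww: "1 \<le> jap w * jap w'"
      using mult_mono[OF jap_ge_1[of w] jap_ge_1[of w']] by simp
    have "norm ((cis (t \<bullet> q) - cis (t \<bullet> q')) * \<psi> (t - p)) \<le> (jap t * norm (w - w')) * (C * (1 / jap (t - p) ^ Suc k))"
      unfolding norm_mult
    proof (intro mult_mono)
      have "norm (cis (t \<bullet> q) - cis (t \<bullet> q')) \<le> \<bar>t \<bullet> (q - q')\<bar>"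
        using norm_cis_diff_le[of "t \<bullet> q" "t \<bullet> q'"] by (simp add: inner_diff_right)
      also have "\<dots> \<le> norm t * norm (q - q')"
        by (rule Cauchy_Schwarz_ineq2)
      also have "\<dots> \<le> jap t * norm (w - w')"
        by (intro mult_mono norm_le_jap q) auto
      finally show "norm (cis (t \<bullet> q) - cis (t \<bullet> q')) \<le> jap t * norm (w - w')" .
    qed (use C in auto)
    also have "\<dots> \<le> (jap t * norm (w - w')) * (C * (2 ^ Suc k * ?J / jap t ^ Suc k))"
    proof (intro mult_left_mono)
      have "jap p ^ Suc k \<le> ?J"
        using jap_fst_le[of w] mult_mono[OF _ jap_ge_1[of w'], of "jap p" "jap w"]
        by (intro power_mono) (auto simp: w)
      then have "2 ^ Suc k * jap p ^ Suc k / jap t ^ Suc k \<le> 2 ^ Suc k * ?J / jap t ^ Suc k"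
        by (intro divide_right_mono mult_left_mono) auto
      then show "1 / jap (t - p) ^ Suc k \<le> 2 ^ Suc k * ?J / jap t ^ Suc k"
        using inverse_jap_shift[of t p "Suc k"] by linarith
    qed (use C in auto)
    also have "\<dots> = C * 2 ^ Suc k * ?J * norm (w - w') / jap t ^ k"
      by simp
    finally have 1: "norm ((cis (t \<bullet> q) - cis (t \<bullet> q')) * \<psi> (t - p)) \<le> C * 2 ^ Suc k * ?J * norm (w - w') / jap t ^ k" .
    have "norm (cis (t \<bullet> q') * (\<psi> (t - p) - \<psi> (t - p'))) \<le> D * (jap p * jap p') ^ k * norm (p - p') / jap t ^ k"
      using D(2)[of t p p'] by simp
    also have "\<dots> \<le> D * ?J * norm (w - w') / jap t ^ k"
    proof (intro divide_right_mono mult_mono p)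
      have "(jap p * jap p') ^ k \<le> (jap w * jap w') ^ k"
        using jap_fst_le[of w] jap_fst_le[of w'] by (intro power_mono mult_mono) (auto simp: w)
      also have "\<dots> \<le> ?J"
        by (rule power_increasing) (use ww in auto)
      finally show "(jap p * jap p') ^ k \<le> ?J" .
    qed (use D in auto)
    finally have 2: "norm (cis (t \<bullet> q') * (\<psi> (t - p) - \<psi> (t - p'))) \<le> D * ?J * norm (w - w') / jap t ^ k" .
    have "tf_shift w \<psi> t - tf_shift w' \<psi> t
        = (cis (t \<bullet> q) - cis (t \<bullet> q')) * \<psi> (t - p) + cis (t \<bullet> q') * (\<psi> (t - p) - \<psi> (t - p'))"
      by (simp add: tf_shift_def w algebra_simps)
    then have "norm (tf_shift w \<psi> t - tf_shift w' \<psi> t)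
        \<le> C * 2 ^ Suc k * ?J * norm (w - w') / jap t ^ k + D * ?J * norm (w - w') / jap t ^ k"
      using norm_triangle_mono[OF 1 2] by simp
    also have "\<dots> = (C * 2 ^ Suc k + D) * ?J * norm (w - w') / jap t ^ k"
      by (simp only: distrib_right add_divide_distrib)
    finally show ?thesis .
  qed
  then show ?case
    using C(1) D(1) by (intro exI[of _ "C * 2 ^ Suc k + D"] conjI exI[of _ "Suc k"]) auto
next
  case (freq F b)
  then obtain C l where C: "C \<ge> 0" "\<And>w w' t. norm (F w t - F w' t) \<le> C * (jap w * jap w') ^ l * norm (w - w') / jap t ^ k"
    by blast
  obtain D m where D: "D \<ge> 0" "\<And>w t. norm (F w t) \<le> D * jap w ^ m / jap t ^ k"
    using tf_family_bound[OF freq(1)] by blast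
  have "norm (\<i> * of_real (snd w \<bullet> b) * F w t - \<i> * of_real (snd w' \<bullet> b) * F w' t)
      \<le> (norm b * (C + D)) * (jap w * jap w') ^ (Suc l + m) * norm (w - w') / jap t ^ k" for w w' t
  proof -
    have ww: "1 \<le> jap w * jap w'"
      using mult_mono[OF jap_ge_1[of w] jap_ge_1[of w']] by simp
    have jw: "jap w \<le> jap w * jap w'" "jap w' \<le> jap w * jap w'"
      using mult_left_mono[OF jap_ge_1[of w'], of "jap w"] mult_right_mono[OF jap_ge_1[of w], of "jap w'"] by auto
    let ?J = "(jap w * jap w') ^ (Suc l + m)"
    have "\<bar>snd (w - w') \<bullet> b\<bar> \<le> norm (w - w') * norm b"
    proof -
      have "norm (snd (w - w')) \<le> norm (w - w')"
        by (metis norm_snd_le prod.collapse)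
      then show ?thesis
        using Cauchy_Schwarz_ineq2[of "snd (w - w')" b] by (meson mult_right_mono norm_ge_zero order_trans)
    qed
    then have "norm (of_real (snd (w - w') \<bullet> b) * F w t) \<le> (norm (w - w') * norm b) * (D * jap w ^ m / jap t ^ k)"
      unfolding norm_mult using D by (intro mult_mono) auto
    also have "\<dots> \<le> (norm (w - w') * norm b) * (D * ?J / jap t ^ k)"
    proof (intro mult_left_mono divide_right_mono)
      have "jap w ^ m \<le> (jap w * jap w') ^ m"
        using jw by (intro power_mono) auto
      also have "\<dots> \<le> ?J"
        using ww by (intro power_increasing) auto
      finally show "jap w ^ m \<le> ?J" .
    qed (use D in auto)
    finally have 1: "norm (of_real (snd (w - w') \<bullet> b) * F w t) \<le> (norm (w - w') * norm b) * (D * ?J / jap t ^ k)" .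
    have "\<bar>snd w' \<bullet> b\<bar> \<le> (jap w * jap w') * norm b"
      using Cauchy_Schwarz_ineq2[of "snd w'" b] norm_le_jap[of "snd w'"] jap_snd_le[of w'] jw(2)
      by (meson mult_right_mono norm_ge_zero order_trans)
    then have "norm (of_real (snd w' \<bullet> b) * (F w t - F w' t))
        \<le> ((jap w * jap w') * norm b) * (C * (jap w * jap w') ^ l * norm (w - w') / jap t ^ k)"
      unfolding norm_mult using C by (intro mult_mono) auto
    also have "\<dots> = norm b * (C * (jap w * jap w') ^ Suc l * norm (w - w') / jap t ^ k)"
      by (simp add: algebra_simps)
    also have "\<dots> \<le> norm b * (C * ?J * norm (w - w') / jap t ^ k)"
      using ww C by (intro mult_left_mono mult_right_mono divide_right_mono power_increasing) auto
    finally have 2: "norm (of_real (snd w' \<bullet> b) * (F w t - F w' t)) \<le> norm b * (C * ?J * norm (w - w') / jap t ^ k)" .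
    have "\<i> * of_real (snd w \<bullet> b) * F w t - \<i> * of_real (snd w' \<bullet> b) * F w' t
        = \<i> * (of_real (snd (w - w') \<bullet> b) * F w t + of_real (snd w' \<bullet> b) * (F w t - F w' t))"
      by (simp add: algebra_simps inner_diff_left snd_diff)
    then have "norm (\<i> * of_real (snd w \<bullet> b) * F w t - \<i> * of_real (snd w' \<bullet> b) * F w' t)
        = norm (of_real (snd (w - w') \<bullet> b) * F w t + of_real (snd w' \<bullet> b) * (F w t - F w' t))"
      by (simp add: norm_mult)
    also have "\<dots> \<le> (norm (w - w') * norm b) * (D * ?J / jap t ^ k) + norm b * (C * ?J * norm (w - w') / jap t ^ k)"
      by (rule norm_triangle_mono[OF 1 2])
    also have "\<dots> = (norm b * (C + D)) * ?J * norm (w - w') / jap t ^ k"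
      by (simp add: field_simps)
    finally show ?thesis .
  qed
  then show ?case
    using C(1) D(1) by (intro exI[of _ "norm b * (C + D)"] conjI exI[of _ "Suc l + m"]) auto
next
  case (add F G)
  then obtain C l D m where C: "C \<ge> 0" "\<And>w w' t. norm (F w t - F w' t) \<le> C * (jap w * jap w') ^ l * norm (w - w') / jap t ^ k"
    and D: "D \<ge> 0" "\<And>w w' t. norm (G w t - G w' t) \<le> D * (jap w * jap w') ^ m * norm (w - w') / jap t ^ k"
    by blast
  have "norm ((F w t + G w t) - (F w' t + G w' t)) \<le> (C + D) * (jap w * jap w') ^ (l + m) * norm (w - w') / jap t ^ k" for w w' t
  proof -
    have ww: "1 \<le> jap w * jap w'"
      using mult_mono[OF jap_ge_1[of w] jap_ge_1[of w']] by simp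
    have "norm ((F w t + G w t) - (F w' t + G w' t)) \<le> C * (jap w * jap w') ^ l * norm (w - w') / jap t ^ k
        + D * (jap w * jap w') ^ m * norm (w - w') / jap t ^ k"
      using norm_triangle_mono[OF C(2) D(2), of w t w' w t w'] by (simp add: algebra_simps)
    also have "\<dots> \<le> C * (jap w * jap w') ^ (l + m) * norm (w - w') / jap t ^ k
        + D * (jap w * jap w') ^ (l + m) * norm (w - w') / jap t ^ k"
      using C(1) D(1) ww
      by (intro add_mono divide_right_mono mult_right_mono mult_left_mono power_increasing) auto
    finally show ?thesis by (simp add: algebra_simps add_divide_distrib)
  qed
  then show ?case
    using C(1) D(1) by (intro exI[of _ "C + D"] conjI exI[of _ "l + m"]) auto
qed


subsection \<open>Interchange with a tempered distribution\<close>

definition rapidly_decaying :: "('a::euclidean_space \<Rightarrow> complex) \<Rightarrow> bool"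
  where "rapidly_decaying K \<longleftrightarrow> K \<in> borel_measurable borel \<and>
    (\<forall>N. \<exists>C\<ge>0. \<forall>w. norm (K w) \<le> C / jap w ^ N)"

lemma rapidly_decaying_measurable: "rapidly_decaying K \<Longrightarrow> K \<in> borel_measurable borel"
  by (simp add: rapidly_decaying_def)

lemma rapidly_decaying_integrable:
  fixes K :: "'a::euclidean_space \<Rightarrow> complex"
  assumes "rapidly_decaying K"
  shows "integrable lborel (\<lambda>w. norm (K w) * jap w ^ l)"
proof -
  obtain C where C: "\<And>w. norm (K w) \<le> C / jap w ^ (l + 2 * DIM('a))"
    using assms unfolding rapidly_decaying_def by blast
  have [measurable]: "K \<in> borel_measurable borel"
    using assms by (rule rapidly_decaying_measurable)
  have "integrable lborel (\<lambda>w::'a. C * (1 / jap w ^ (2 * DIM('a))))"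
    by (intro integrable_mult_right integrable_jap) auto
  then show ?thesis
  proof (rule integrable_dominated)
    fix w
    show "norm (norm (K w) * jap w ^ l) \<le> C * (1 / jap w ^ (2 * DIM('a)))"
      using mult_right_mono[OF C[of w], of "jap w ^ l"] by (simp add: power_add field_simps)
  qed auto
qed

text \<open>
  The argument of \<open>F\<close> is allowed to be \<open>\<sigma> w\<close> instead of \<open>w\<close>, in order to cover approximations of
  the integral by finite sums.
\<close>

lemma superposition:
  fixes F :: "'a::euclidean_space \<times> 'a \<Rightarrow> 'a \<Rightarrow> complex"
    and K :: "'a \<times> 'a \<Rightarrow> complex"
  assumes F: "tf_family F" and K: "rapidly_decaying K"
    and [measurable]: "\<sigma> \<in> borel_measurable borel" and \<sigma>: "\<And>w. jap (\<sigma> w) \<le> 2 * jap w"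
    and bs: "set bs \<subseteq> Basis"
  shows superposition_integrable: "integrable lborel (\<lambda>w. K w * partials bs (F (\<sigma> w)) t)"
    and superposition_partials: "partials bs (\<lambda>t. LINT w|lborel. K w * F (\<sigma> w) t)
      = (\<lambda>t. LINT w|lborel. K w * partials bs (F (\<sigma> w)) t)"
    and superposition_schwartz: "(\<lambda>t. LINT w|lborel. K w * F (\<sigma> w) t) \<in> schwartz"
proof -
  have [measurable]: "K \<in> borel_measurable borel"
    using K by (rule rapidly_decaying_measurable)
  have Fm: "(\<lambda>w. partials bs (F w) t) \<in> borel_measurable borel" if "set bs \<subseteq> Basis" for bs t
    by (intro borel_measurable_continuous_onI tf_family_continuous tf_family_partials F that)
  have m: "(\<lambda>w. K w * partials bs (F (\<sigma> w)) t) \<in> borel_measurable lborel" if "set bs \<subseteq> Basis" for bs t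
    using measurable_compose[OF assms(3) Fm[OF that, of t]] by simp
  have bd: "\<exists>C\<ge>0. \<exists>l. \<forall>w t. norm (K w * partials bs (F (\<sigma> w)) t) \<le> C * (norm (K w) * jap w ^ l) / jap t ^ k"
    if b: "set bs \<subseteq> Basis" for bs k
  proof -
    obtain C l where C: "C \<ge> 0" "\<And>w t. norm (partials bs (F w) t) \<le> C * jap w ^ l / jap t ^ k"
      using tf_family_bound[OF tf_family_partials[OF F b]] by blast
    have "norm (K w * partials bs (F (\<sigma> w)) t) \<le> (C * 2 ^ l) * (norm (K w) * jap w ^ l) / jap t ^ k" for w t
    proof -
      have "norm (partials bs (F (\<sigma> w)) t) \<le> C * (2 * jap w) ^ l / jap t ^ k"
        using C(1) by (intro order.trans[OF C(2)] divide_right_mono mult_left_mono power_mono \<sigma>) auto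
      then have "norm (K w) * norm (partials bs (F (\<sigma> w)) t) \<le> norm (K w) * (C * (2 * jap w) ^ l / jap t ^ k)"
        by (intro mult_left_mono) auto
      then show ?thesis
        by (simp add: norm_mult power_mult_distrib mult_ac)
    qed
    then show ?thesis
      using C(1) by (intro exI[of _ "C * 2 ^ l"]) auto
  qed
  have "\<forall>bs. \<exists>C. \<exists>l. set bs \<subseteq> Basis \<longrightarrow> C \<ge> 0 \<and> (\<forall>w t. norm (K w * partials bs (F (\<sigma> w)) t) \<le> C * (norm (K w) * jap w ^ l))"
      proof
    fix bs
    show "\<exists>C. \<exists>l. set bs \<subseteq> Basis \<longrightarrow> C \<ge> 0 \<and> (\<forall>w t. norm (K w * partials bs (F (\<sigma> w)) t) \<le> C * (norm (K w) * jap w ^ l))"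
      using bd[of bs 0] by (cases "set bs \<subseteq> Basis") auto
  qed
  then obtain C l where C: "\<And>bs. set bs \<subseteq> Basis \<Longrightarrow> C bs \<ge> 0"
    "\<And>bs w t. set bs \<subseteq> Basis \<Longrightarrow> norm (K w * partials bs (F (\<sigma> w)) t) \<le> C bs * (norm (K w) * jap w ^ l bs)"
    by metis
  have pK: "partials bs (\<lambda>t. K w * F (\<sigma> w) t) = (\<lambda>t. K w * partials bs (F (\<sigma> w)) t)"
    if "set bs \<subseteq> Basis" for bs w
    by (intro partials_const_mult tf_family_smooth F that)
  have gi: "integrable lborel (\<lambda>w. C bs * (norm (K w) * jap w ^ l bs))" for bs
    by (intro integrable_mult_right rapidly_decaying_integrable K)
  have int: "integrable lborel (\<lambda>w. K w * partials bs (F (\<sigma> w)) t)" if "set bs \<subseteq> Basis" for bs t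
    by (rule integrable_dominated[OF gi m[OF that]]) (rule C(2)[OF that])
  then show "integrable lborel (\<lambda>w. K w * partials bs (F (\<sigma> w)) t)"
    using bs by blast
  have sm: "smooth (\<lambda>t. K w * F (\<sigma> w) t)" for w
    by (intro smooth_const_mult tf_family_smooth F)
  have b': "norm (partials bs (\<lambda>t. K w * F (\<sigma> w) t) x) \<le> C bs * (norm (K w) * jap w ^ l bs)"
    if "set bs \<subseteq> Basis" for bs w x
    unfolding pK[OF that] by (rule C(2)[OF that])
  have m': "(\<lambda>w. partials bs (\<lambda>t. K w * F (\<sigma> w) t) x) \<in> borel_measurable lborel"
    if "set bs \<subseteq> Basis" for bs x
    unfolding pK[OF that] by (rule m[OF that])
  have P: "partials bs (\<lambda>t. LINT w|lborel. K w * F (\<sigma> w) t) = (\<lambda>t. LINT w|lborel. K w * partials bs (F (\<sigma> w)) t)"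
    if b: "set bs \<subseteq> Basis" for bs
  proof -
    have "partials bs (\<lambda>t. LINT w|lborel. K w * F (\<sigma> w) t)
        = (\<lambda>t. LINT w|lborel. partials bs (\<lambda>t. K w * F (\<sigma> w) t) t)"
      by (rule partials_integral(1)[where g = "\<lambda>bs w. C bs * (norm (K w) * jap w ^ l bs)", OF sm b' gi m' b])
    then show ?thesis
      by (simp only: pK[OF b])
  qed
  have S: "smooth (\<lambda>t. LINT w|lborel. K w * F (\<sigma> w) t)"
    by (rule partials_integral(2)[where g = "\<lambda>bs w. C bs * (norm (K w) * jap w ^ l bs)" and bs = "[]",
        OF sm b' gi m']) auto
  from P[OF bs] show "partials bs (\<lambda>t. LINT w|lborel. K w * F (\<sigma> w) t) = (\<lambda>t. LINT w|lborel. K w * partials bs (F (\<sigma> w)) t)" .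
  show "(\<lambda>t. LINT w|lborel. K w * F (\<sigma> w) t) \<in> schwartz"
    unfolding schwartz_iff_dbounded dbounded_def
  proof safe
    show "smooth (\<lambda>t. LINT w|lborel. K w * F (\<sigma> w) t)"
      by (rule S)
  next
    fix bs :: "'a list" and k assume bs: "set bs \<subseteq> Basis"
    obtain C l where C: "C \<ge> 0" "\<And>w t. norm (K w * partials bs (F (\<sigma> w)) t) \<le> C * (norm (K w) * jap w ^ l) / jap t ^ k"
      using bd[OF bs] by blast
    let ?I = "LINT w|lborel. norm (K w) * jap w ^ l"
    have "norm (LINT w|lborel. K w * partials bs (F (\<sigma> w)) t) \<le> C * ?I / jap t ^ k" for t
    proof -
      have "norm (LINT w|lborel. K w * partials bs (F (\<sigma> w)) t) \<le> (LINT w|lborel. C / jap t ^ k * (norm (K w) * jap w ^ l))"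
        using C(2) by (intro order.trans[OF integral_norm_bound] integral_mono integrable_norm int[OF bs]
            integrable_mult_right rapidly_decaying_integrable K) auto
      then show ?thesis by simp
    qed
    moreover have "?I \<ge> 0"
      by (intro integral_nonneg_AE) auto
    ultimately show "\<exists>C\<ge>0. \<forall>i x. norm (partials bs (\<lambda>t. LINT w|lborel. K w * F (\<sigma> w) t) x) \<le> C * (1 / jap x ^ k)"
      unfolding P[OF bs] using C(1) by (intro exI[of _ "C * ?I"]) auto
  qed
qed

lemma schwartz_seminorm_le:
  assumes "\<And>bs x. set bs \<subseteq> Basis \<Longrightarrow> length bs \<le> k \<Longrightarrow> norm (partials bs f x) \<le> B / jap x ^ k"
  shows "schwartz_seminorm k (f :: 'a::euclidean_space \<Rightarrow> complex) \<le> B"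
  unfolding schwartz_seminorm_def
proof (rule cSUP_least)
  have "[] \<in> {bs :: 'a list. set bs \<subseteq> Basis \<and> length bs \<le> k}" by simp
  then show "(UNIV :: 'a set) \<times> {bs :: 'a list. set bs \<subseteq> Basis \<and> length bs \<le> k} \<noteq> {}"
    by blast
  fix z assume "z \<in> (UNIV :: 'a set) \<times> {bs :: 'a list. set bs \<subseteq> Basis \<and> length bs \<le> k}"
  then show "(case z of (x, bs) \<Rightarrow> jap x ^ k * norm (partials bs f x)) \<le> B"
    using assms by (auto simp: field_simps)
qed

lemma schwartz_seminorm_nonneg:
  assumes f: "f \<in> schwartz"
  shows "0 \<le> schwartz_seminorm k (f :: 'a::euclidean_space \<Rightarrow> complex)"
proof -
  let ?L = "{bs :: 'a list. set bs \<subseteq> Basis \<and> length bs \<le> k}"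
  have fin: "finite ?L" by (intro finite_lists_length_le) auto
  have "bdd_above (\<Union>bs\<in>?L. range (\<lambda>x. jap x ^ k * norm (partials bs f x)))"
    using f fin by (subst bdd_above_UN) (auto simp: schwartz_def)
  moreover have "(\<lambda>(x, bs). jap x ^ k * norm (partials bs f x)) ` (UNIV \<times> ?L)
      \<subseteq> (\<Union>bs\<in>?L. range (\<lambda>x. jap x ^ k * norm (partials bs f x)))"
    by auto
  ultimately have bdd: "bdd_above ((\<lambda>(x, bs). jap x ^ k * norm (partials bs f x)) ` (UNIV \<times> ?L))"
    by (rule bdd_above_mono)
  have "0 \<le> (case (0, []) of (x, bs) \<Rightarrow> jap x ^ k * norm (partials bs f x))"
    by simp
  also have "\<dots> \<le> schwartz_seminorm k f"
    unfolding schwartz_seminorm_def by (rule cSUP_upper[OF _ bdd]) simp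
  finally show ?thesis .
qed

text \<open>
  The continuity of a tempered distribution in a form that avoids the supremum in the seminorm.
\<close>

lemma tempered_bound:
  fixes u :: "('a::euclidean_space \<Rightarrow> complex) \<Rightarrow> complex"
  assumes "u \<in> tempered"
  obtains C k where "C \<ge> 0" "\<And>f B. f \<in> schwartz \<Longrightarrow>
    (\<And>bs x. set bs \<subseteq> Basis \<Longrightarrow> length bs \<le> k \<Longrightarrow> norm (partials bs f x) \<le> B / jap x ^ k) \<Longrightarrow>
    norm (u f) \<le> C * B"
proof -
  obtain C k where C: "\<And>f. f \<in> schwartz \<Longrightarrow> norm (u f) \<le> C * schwartz_seminorm k f"
    using assms unfolding tempered_def by blast
  show ?thesis
  proof (rule that[of "\<bar>C\<bar>" k])
    fix f :: "'a \<Rightarrow> complex" and B assume f: "f \<in> schwartz"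
      and B: "\<And>bs x. set bs \<subseteq> Basis \<Longrightarrow> length bs \<le> k \<Longrightarrow> norm (partials bs f x) \<le> B / jap x ^ k"
    have "norm (u f) \<le> \<bar>C\<bar> * schwartz_seminorm k f"
      by (rule order.trans[OF C[OF f]], rule mult_right_mono[OF abs_ge_self schwartz_seminorm_nonneg[OF f]])
    also have "\<dots> \<le> \<bar>C\<bar> * B"
      by (intro mult_left_mono schwartz_seminorm_le B) auto
    finally show "norm (u f) \<le> \<bar>C\<bar> * B" .
  qed simp
qed

lemma tempered_add: "u \<in> tempered \<Longrightarrow> f \<in> schwartz \<Longrightarrow> g \<in> schwartz \<Longrightarrow> u (\<lambda>x. f x + g x) = u f + u g"
  by (simp add: tempered_def)

lemma tempered_mult: "u \<in> tempered \<Longrightarrow> f \<in> schwartz \<Longrightarrow> u (\<lambda>x. c * f x) = c * u f"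
  by (simp add: tempered_def)

lemma tempered_diff:
  assumes "u \<in> tempered" "f \<in> schwartz" "g \<in> schwartz"
  shows "u (\<lambda>x. f x - g x) = u f - u g"
  using tempered_add[OF assms(1,2) schwartz_const_mult[OF assms(3), of "-1"]] tempered_mult[OF assms(1,3), of "-1"]
  by simp

lemma schwartz_diff: "f \<in> schwartz \<Longrightarrow> g \<in> schwartz \<Longrightarrow> (\<lambda>x. f x - g x) \<in> schwartz"
  using schwartz_add[OF _ schwartz_const_mult[of g "-1"], of f] by simp

lemma tempered_zero:
  assumes "u \<in> tempered" shows "u (\<lambda>_. 0) = 0"
  using tempered_mult[OF assms schwartz_zero, of 0] by simp

lemma tempered_sum:
  assumes "u \<in> tempered" "\<And>i. i \<in> A \<Longrightarrow> f i \<in> schwartz" "finite A"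
  shows "u (\<lambda>x. \<Sum>i\<in>A. f i x) = (\<Sum>i\<in>A. u (f i))"
  using assms(3,2)
  by (induction A rule: finite_induct)
    (auto simp: tempered_zero[OF assms(1)] tempered_add[OF assms(1)] schwartz_sum)

lemma partials_diff:
  assumes "smooth f" "smooth g" "set bs \<subseteq> Basis"
  shows "partials bs (\<lambda>x. f x - g x) = (\<lambda>x. partials bs f x - partials bs g x)"
  using partials_add[OF assms(1) smooth_const_mult[OF assms(2), of "-1"] assms(3)]
  by (simp add: partials_const_mult[OF assms(2,3), of "-1", simplified])

lemma tf_family_schwartz:
  fixes F :: "'a::euclidean_space \<times> 'a \<Rightarrow> 'a \<Rightarrow> complex"
  assumes "tf_family F"
  shows "F w \<in> schwartz"
  unfolding schwartz_iff_dbounded dbounded_def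
proof safe
  show "smooth (F w)" by (rule tf_family_smooth[OF assms])
  fix bs :: "'a list" and k assume "set bs \<subseteq> Basis"
  from tf_family_bound[OF tf_family_partials[OF assms this], of k]
  obtain C l where "C \<ge> 0" "\<And>w t. norm (partials bs (F w) t) \<le> C * jap w ^ l / jap t ^ k"
    by blast
  then show "\<exists>C\<ge>0. \<forall>i x. norm (partials bs (F w) x) \<le> C * (1 / jap x ^ k)"
    by (intro exI[of _ "C * jap w ^ l"]) auto
qed

lemma finite_common_bound:
  assumes "finite A" "\<And>a. a \<in> A \<Longrightarrow> \<exists>C\<ge>(0::real). \<exists>l::nat. P a C l"
    and mono: "\<And>a C l D m. P a C l \<Longrightarrow> 0 \<le> C \<Longrightarrow> C \<le> D \<Longrightarrow> l \<le> m \<Longrightarrow> P a D m"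
  shows "\<exists>C\<ge>0. \<exists>l. \<forall>a\<in>A. P a C l"
  using assms(1,2)
proof (induction A rule: finite_induct)
  case (insert a A)
  then obtain C l D m where "C \<ge> 0" "\<forall>a\<in>A. P a C l" "D \<ge> 0" "P a D m"
    by (meson insertCI)
  then show ?case
    by (intro exI[of _ "C + D"] conjI exI[of _ "l + m"]) (auto intro: mono)
qed auto

lemma tf_family_lipschitz_upto:
  fixes F :: "'a::euclidean_space \<times> 'a \<Rightarrow> 'a \<Rightarrow> complex"
  assumes F: "tf_family F"
  shows "\<exists>D\<ge>0. \<exists>l. \<forall>bs\<in>{bs. set bs \<subseteq> Basis \<and> length bs \<le> k}. \<forall>w w' t. norm (partials bs (F w) t - partials bs (F w') t)
      \<le> D * (jap w * jap w') ^ l * norm (w - w') / jap t ^ k"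
proof (rule finite_common_bound)
    fix bs C l D m assume H: "\<forall>w w' t. norm (partials bs (F w) t - partials bs (F w') t)
      \<le> C * (jap w * jap w') ^ l * norm (w - w') / jap t ^ k" "0 \<le> C" "C \<le> D" "l \<le> m"
    show "\<forall>w w' t. norm (partials bs (F w) t - partials bs (F w') t)
      \<le> D * (jap w * jap w') ^ m * norm (w - w') / jap t ^ k"
    proof (intro allI)
      fix w w' :: "'a \<times> 'a" and t :: 'a
      have ww: "1 \<le> jap w * jap w'"
        using mult_mono[OF jap_ge_1[of w] jap_ge_1[of w']] by simp
      have "C * (jap w * jap w') ^ l * norm (w - w') / jap t ^ k \<le> D * (jap w * jap w') ^ m * norm (w - w') / jap t ^ k"
        using H ww by (intro divide_right_mono mult_right_mono mult_mono power_increasing) auto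
      with H(1) show "norm (partials bs (F w) t - partials bs (F w') t) \<le> D * (jap w * jap w') ^ m * norm (w - w') / jap t ^ k"
        by (meson order.trans)
    qed
qed (use tf_family_lipschitz[OF tf_family_partials[OF F]] in \<open>auto intro: finite_lists_length_le\<close>)

lemma tempered_tf_family:
  fixes F :: "'a::euclidean_space \<times> 'a \<Rightarrow> 'a \<Rightarrow> complex"
  assumes u: "u \<in> tempered" and F: "tf_family F"
  shows tempered_tf_bound: "\<exists>C\<ge>0. \<exists>l. \<forall>w. norm (u (F w)) \<le> C * jap w ^ l"
    and tempered_tf_lipschitz: "\<exists>C\<ge>0. \<exists>l. \<forall>w w'. norm (u (F w) - u (F w')) \<le> C * (jap w * jap w') ^ l * norm (w - w')"
proof -
  obtain C k where C: "C \<ge> 0" and u_bd: "\<And>f B. f \<in> schwartz \<Longrightarrow>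
    (\<And>bs x. set bs \<subseteq> Basis \<Longrightarrow> length bs \<le> k \<Longrightarrow> norm (partials bs f x) \<le> B / jap x ^ k) \<Longrightarrow>
    norm (u f) \<le> C * B"
    using tempered_bound[OF u] by blast
  let ?L = "{bs :: 'a list. set bs \<subseteq> Basis \<and> length bs \<le> k}"
  have fin: "finite ?L" by (intro finite_lists_length_le) auto
  have "\<exists>D\<ge>0. \<exists>l. \<forall>bs\<in>?L. \<forall>w t. norm (partials bs (F w) t) \<le> D * jap w ^ l / jap t ^ k"
  proof (rule finite_common_bound[OF fin])
    fix bs C l D m assume H: "\<forall>w t. norm (partials bs (F w) t) \<le> C * jap w ^ l / jap t ^ k" "0 \<le> C" "C \<le> D" "l \<le> m"
    show "\<forall>w t. norm (partials bs (F w) t) \<le> D * jap w ^ m / jap t ^ k"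
    proof (intro allI)
      fix w :: "'a \<times> 'a" and t :: 'a
      have "C * jap w ^ l / jap t ^ k \<le> D * jap w ^ m / jap t ^ k"
        using H by (intro divide_right_mono mult_mono jap_power_mono) auto
      with H(1) show "norm (partials bs (F w) t) \<le> D * jap w ^ m / jap t ^ k"
        by (meson order.trans)
    qed
  qed (use tf_family_bound[OF tf_family_partials[OF F]] in blast)
  then obtain D l where D: "D \<ge> 0" "\<And>bs w t. bs \<in> ?L \<Longrightarrow> norm (partials bs (F w) t) \<le> D * jap w ^ l / jap t ^ k"
    by blast
  have "norm (u (F w)) \<le> C * (D * jap w ^ l)" for w
    by (rule u_bd[OF tf_family_schwartz[OF F]]) (use D in auto)
  then show "\<exists>C\<ge>0. \<exists>l. \<forall>w. norm (u (F w)) \<le> C * jap w ^ l"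
    using C D(1) by (intro exI[of _ "C * D"] conjI exI[of _ l]) (auto simp: mult.assoc)
  have "\<exists>D\<ge>0. \<exists>l. \<forall>bs\<in>?L. \<forall>w w' t. norm (partials bs (F w) t - partials bs (F w') t)
      \<le> D * (jap w * jap w') ^ l * norm (w - w') / jap t ^ k"
    by (rule tf_family_lipschitz_upto[OF F])
  then obtain D l where D: "D \<ge> 0" "\<And>bs w w' t. bs \<in> ?L \<Longrightarrow> norm (partials bs (F w) t - partials bs (F w') t)
      \<le> D * (jap w * jap w') ^ l * norm (w - w') / jap t ^ k"
    by blast
  have "norm (u (F w) - u (F w')) \<le> C * (D * (jap w * jap w') ^ l * norm (w - w'))" for w w'
  proof -
    have "u (F w) - u (F w') = u (\<lambda>x. F w x - F w' x)"
      by (intro tempered_diff[symmetric] u tf_family_schwartz F)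
    moreover have "norm (u (\<lambda>x. F w x - F w' x)) \<le> C * (D * (jap w * jap w') ^ l * norm (w - w'))"
      by (rule u_bd) (use D in \<open>auto simp: partials_diff tf_family_smooth[OF F] intro!: schwartz_diff tf_family_schwartz[OF F]\<close>)
    ultimately show ?thesis by simp
  qed
  then show "\<exists>C\<ge>0. \<exists>l. \<forall>w w'. norm (u (F w) - u (F w')) \<le> C * (jap w * jap w') ^ l * norm (w - w')"
    using C D(1) by (intro exI[of _ "C * D"] conjI exI[of _ l]) (auto simp: mult.assoc)
qed

lemma tempered_tf_continuous:
  fixes F :: "'a::euclidean_space \<times> 'a \<Rightarrow> 'a \<Rightarrow> complex"
  assumes "u \<in> tempered" "tf_family F"
  shows "continuous_on UNIV (\<lambda>w. u (F w))"
  unfolding continuous_on_sequentially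
proof safe
  fix v :: "nat \<Rightarrow> 'a \<times> 'a" and w assume v: "v \<longlonglongrightarrow> w"
  obtain B j where B: "B \<ge> 0" "\<And>w w'. norm (u (F w) - u (F w')) \<le> B * (jap w * jap w') ^ j * norm (w - w')"
    using tempered_tf_lipschitz[OF assms] by blast
  have "(\<lambda>n. B * (jap (v n) * jap w) ^ j * norm (v n - w)) \<longlonglongrightarrow> B * (jap w * jap w) ^ j * norm (w - w)"
    unfolding jap_def by (intro tendsto_intros v)
  then have lim: "(\<lambda>n. B * (jap (v n) * jap w) ^ j * norm (v n - w)) \<longlonglongrightarrow> 0"
    by simp
  have "(\<lambda>n. u (F (v n)) - u (F w)) \<longlonglongrightarrow> 0"
    by (rule Lim_null_comparison[OF always_eventually lim]) (use B in auto)
  then show "((\<lambda>w. u (F w)) \<circ> v) \<longlonglongrightarrow> u (F w)"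
    by (simp add: LIM_zero_iff comp_def)
qed

text \<open>
  The integration variable is approximated by simple functions.  For these the superposition
  is a finite sum, and the Lipschitz bounds give convergence in every Schwartz seminorm.
\<close>

theorem tempered_superposition:
  fixes F :: "'a::euclidean_space \<times> 'a \<Rightarrow> 'a \<Rightarrow> complex"
  assumes u: "u \<in> tempered" and F: "tf_family F" and K: "rapidly_decaying K"
  shows "u (\<lambda>t. LINT w|lborel. K w * F w t) = (LINT w|lborel. K w * u (F w))"
proof -
  obtain s :: "nat \<Rightarrow> 'a \<times> 'a \<Rightarrow> 'a \<times> 'a" where s_all: "\<forall>n. simple_function lborel (s n)"
    "\<forall>w. (\<lambda>n. s n w) \<longlonglongrightarrow> w" "\<forall>n w. norm (s n w) \<le> 2 * norm w"
    using borel_measurable_implies_sequence_metric[of "\<lambda>w. w" lborel 0]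
    by (simp del: split_paired_All add: dist_norm) blast
  have s: "simple_function lborel (s n)" and s_lim: "(\<lambda>n. s n w) \<longlonglongrightarrow> w"
    and s_bd: "norm (s n w) \<le> 2 * norm w" for n w
    using s_all by blast+
  have sm[measurable]: "s n \<in> borel_measurable borel" for n
    using borel_measurable_simple_function[OF s[of n]] by simp
  have Km[measurable]: "K \<in> borel_measurable borel"
    using K by (rule rapidly_decaying_measurable)
  have js: "jap (s n w) \<le> 2 * jap w" for n w
  proof (rule power2_le_imp_le)
    have "(norm (s n w))\<^sup>2 \<le> (2 * norm w)\<^sup>2"
      by (intro power_mono s_bd) auto
    then show "(jap (s n w))\<^sup>2 \<le> (2 * jap w)\<^sup>2"
      by (simp add: jap_sq power_mult_distrib)
  qed simp
  define G where "G n t = (LINT w|lborel. K w * F (s n w) t)" for n t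
  define G' where "G' t = (LINT w|lborel. K w * F w t)" for t
  have GS: "G n \<in> schwartz" for n
    unfolding G_def[abs_def] using superposition_schwartz[OF F K sm js, of "[]"] by simp
  have G'S: "G' \<in> schwartz"
    unfolding G'_def[abs_def] using superposition_schwartz[OF F K, of "\<lambda>w. w" "[]"] by simp

  \<comment> \<open>For simple functions the interchange is linearity.\<close>
  have G_u: "u (G n) = (LINT w|lborel. K w * u (F (s n w)))" for n
  proof -
    define R where "R = range (s n)"
    have fR: "finite R"
      using simple_functionD(1)[OF s[of n]] by (simp add: R_def)
    define a where "a c = (LINT w|lborel. K w * indicator {w. s n w = c} w)" for c
    have i: "integrable lborel (\<lambda>w. K w * indicator {w. s n w = c} w)" for c
    proof (rule integrable_dominated)
      show "integrable lborel (\<lambda>w. norm (K w) * jap w ^ 0)"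
        by (rule rapidly_decaying_integrable[OF K])
      have "{w. s n w = c} \<in> sets borel"
        using measurable_sets[OF sm, of "{c}" n] by (simp add: vimage_def)
      then show "(\<lambda>w. K w * indicator {w. s n w = c} w) \<in> borel_measurable lborel"
        by measurable
    qed (auto simp: indicator_def)
    have split: "f (s n w) = (\<Sum>c\<in>R. indicator {w. s n w = c} w * f c)" for f :: "'a \<times> 'a \<Rightarrow> complex" and w
    proof -
      have "(\<Sum>c\<in>R. indicator {w. s n w = c} w * f c) = (\<Sum>c\<in>R. if s n w = c then f c else 0)"
        by (intro sum.cong) (auto simp: indicator_def)
      then show ?thesis
        using fR by (simp add: R_def sum.delta)
    qed
    have int: "(LINT w|lborel. K w * f (s n w)) = (\<Sum>c\<in>R. a c * f c)" for f :: "'a \<times> 'a \<Rightarrow> complex"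
    proof -
      have "(LINT w|lborel. K w * f (s n w)) = (LINT w|lborel. (\<Sum>c\<in>R. (K w * indicator {w. s n w = c} w) * f c))"
        unfolding split[of f] by (simp only: sum_distrib_left mult.assoc)
      also have "\<dots> = (\<Sum>c\<in>R. (LINT w|lborel. (K w * indicator {w. s n w = c} w) * f c))"
        by (intro Bochner_Integration.integral_sum integrable_mult_left i)
      finally show ?thesis
        by (simp add: a_def)
    qed
    have "G n = (\<lambda>t. \<Sum>c\<in>R. a c * F c t)"
      by (rule ext) (simp only: G_def int[of "\<lambda>w. F w t" for t])
    then have "u (G n) = (\<Sum>c\<in>R. u (\<lambda>t. a c * F c t))"
      using tempered_sum[OF u _ fR, of "\<lambda>c t. a c * F c t"] by (simp add: schwartz_const_mult tf_family_schwartz[OF F])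
    also have "\<dots> = (\<Sum>c\<in>R. a c * u (F c))"
      by (intro sum.cong refl tempered_mult u tf_family_schwartz F)
    finally show ?thesis
      by (simp add: int[of "\<lambda>w. u (F w)"])
  qed

  obtain C k where C: "C \<ge> 0" and u_bd: "\<And>f B. f \<in> schwartz \<Longrightarrow>
    (\<And>bs x. set bs \<subseteq> Basis \<Longrightarrow> length bs \<le> k \<Longrightarrow> norm (partials bs f x) \<le> B / jap x ^ k) \<Longrightarrow>
    norm (u f) \<le> C * B"
    using tempered_bound[OF u] by blast
  let ?L = "{bs :: 'a list. set bs \<subseteq> Basis \<and> length bs \<le> k}"
  have fin: "finite ?L" by (intro finite_lists_length_le) auto
  have "\<exists>D\<ge>0. \<exists>l. \<forall>bs\<in>?L. \<forall>w w' t. norm (partials bs (F w) t - partials bs (F w') t)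
      \<le> D * (jap w * jap w') ^ l * norm (w - w') / jap t ^ k"
    by (rule tf_family_lipschitz_upto[OF F])
  then obtain D l where D: "D \<ge> 0" "\<And>bs w w' t. bs \<in> ?L \<Longrightarrow> norm (partials bs (F w) t - partials bs (F w') t)
      \<le> D * (jap w * jap w') ^ l * norm (w - w') / jap t ^ k"
    by blast
  define q where "q n w = D * (jap w * jap (s n w)) ^ l * norm (w - s n w)" for n w
  have q0: "0 \<le> q n w" for n w
    unfolding q_def using D by simp
  have q_le: "norm (K w) * q n w \<le> 3 * D * 2 ^ l * (norm (K w) * jap w ^ Suc (2 * l))" for n w
  proof -
    have "norm (w - s n w) \<le> 3 * jap w"
      using norm_triangle_ineq4[of w "s n w"] s_bd[of n w] norm_le_jap[of w] by linarith
    then have "q n w \<le> D * (jap w * (2 * jap w)) ^ l * (3 * jap w)"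
      unfolding q_def using D(1) js by (intro mult_mono power_mono) auto
    also have "\<dots> = 3 * D * 2 ^ l * jap w ^ Suc (2 * l)"
      by (simp add: power_mult_distrib power_mult power2_eq_square)
    finally have "norm (K w) * q n w \<le> norm (K w) * (3 * D * 2 ^ l * jap w ^ Suc (2 * l))"
      by (intro mult_left_mono) auto
    then show ?thesis by (simp add: mult_ac)
  qed
  have dom: "integrable lborel (\<lambda>w. 3 * D * 2 ^ l * (norm (K w) * jap w ^ Suc (2 * l)))"
    by (intro integrable_mult_right rapidly_decaying_integrable K)
  have q_meas[measurable]: "q n \<in> borel_measurable borel" for n
    unfolding q_def by measurable
  have q_int: "integrable lborel (\<lambda>w. norm (K w) * q n w)" for n
    by (rule integrable_dominated[OF dom]) (use q_le q0 in \<open>auto simp: abs_mult\<close>)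
  have q_lim: "(\<lambda>n. LINT w|lborel. norm (K w) * q n w) \<longlonglongrightarrow> (LINT w|(lborel :: ('a \<times> 'a) measure). 0)"
  proof (rule integral_dominated_convergence[OF _ _ dom])
    show "AE w in lborel. (\<lambda>n. norm (K w) * q n w) \<longlonglongrightarrow> 0"
    proof (rule AE_I2)
      fix w
      have "(\<lambda>n. norm (K w) * (D * (jap w * (2 * jap w)) ^ l * norm (w - s n w)))
          \<longlonglongrightarrow> norm (K w) * (D * (jap w * (2 * jap w)) ^ l * norm (w - w))"
        by (intro tendsto_intros s_lim)
      then have lim: "(\<lambda>n. norm (K w) * (D * (jap w * (2 * jap w)) ^ l * norm (w - s n w))) \<longlonglongrightarrow> 0"
        by simp
      show "(\<lambda>n. norm (K w) * q n w) \<longlonglongrightarrow> 0"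
      proof (rule tendsto_sandwich[OF _ _ tendsto_const lim])
        show "\<forall>\<^sub>F n in sequentially. norm (K w) * q n w \<le> norm (K w) * (D * (jap w * (2 * jap w)) ^ l * norm (w - s n w))"
          unfolding q_def using D(1) js
          by (intro always_eventually allI mult_left_mono mult_right_mono power_mono) auto
      qed (use q0 in auto)
    qed
    show "AE w in lborel. norm (norm (K w) * q n w) \<le> 3 * D * 2 ^ l * (norm (K w) * jap w ^ Suc (2 * l))" for n
      using q_le q0 by (auto simp: abs_mult)
  qed auto
  have u_conv: "norm (u G' - u (G n)) \<le> C * (LINT w|lborel. norm (K w) * q n w)" for n
  proof -
    have "norm (u (\<lambda>t. G' t - G n t)) \<le> C * (LINT w|lborel. norm (K w) * q n w)"
    proof (rule u_bd[OF schwartz_diff[OF G'S GS]])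
      fix bs :: "'a list" and t assume bs: "set bs \<subseteq> Basis" "length bs \<le> k"
      have i1: "integrable lborel (\<lambda>w. K w * partials bs (F (s n w)) t)"
        by (rule superposition_integrable[OF F K sm js bs(1)])
      have i2: "integrable lborel (\<lambda>w. K w * partials bs (F w) t)"
        using superposition_integrable[OF F K, of "\<lambda>w. w"] bs(1) by simp
      have "partials bs (\<lambda>t. G' t - G n t) t = partials bs G' t - partials bs (G n) t"
        using partials_diff[OF schwartz_smooth[OF G'S] schwartz_smooth[OF GS] bs(1)] by simp
      also have "partials bs G' t = (LINT w|lborel. K w * partials bs (F w) t)"
        unfolding G'_def[abs_def] using superposition_partials[OF F K, of "\<lambda>w. w"] bs(1) by simp
      also have "partials bs (G n) t = (LINT w|lborel. K w * partials bs (F (s n w)) t)"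
        unfolding G_def[abs_def] using superposition_partials[OF F K sm js bs(1)] by simp
      also have "(LINT w|lborel. K w * partials bs (F w) t) - (LINT w|lborel. K w * partials bs (F (s n w)) t)
          = (LINT w|lborel. K w * (partials bs (F w) t - partials bs (F (s n w)) t))"
        by (subst Bochner_Integration.integral_diff[symmetric, OF i2 i1]) (simp add: right_diff_distrib)
      also have "norm \<dots> \<le> (LINT w|lborel. norm (K w * (partials bs (F w) t - partials bs (F (s n w)) t)))"
        by (rule integral_norm_bound)
      also have "\<dots> \<le> (LINT w|lborel. (norm (K w) * q n w) / jap t ^ k)"
      proof (intro integral_mono)
        show "integrable lborel (\<lambda>w. norm (K w * (partials bs (F w) t - partials bs (F (s n w)) t)))"
          using Bochner_Integration.integrable_diff[OF i2 i1] by (intro integrable_norm) (simp add: right_diff_distrib)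
        show "norm (K w * (partials bs (F w) t - partials bs (F (s n w)) t)) \<le> norm (K w) * q n w / jap t ^ k" for w
          using mult_left_mono[OF D(2)[of bs w t "s n w"], of "norm (K w)"] bs by (simp add: norm_mult q_def)
      qed (use q_int in auto)
      also have "\<dots> = (LINT w|lborel. norm (K w) * q n w) / jap t ^ k"
        by simp
      finally show "norm (partials bs (\<lambda>t. G' t - G n t) t) \<le> (LINT w|lborel. norm (K w) * q n w) / jap t ^ k" .
    qed
    then show ?thesis
      by (simp add: tempered_diff[OF u G'S GS])
  qed
  have "(\<lambda>n. C * (LINT w|lborel. norm (K w) * q n w)) \<longlonglongrightarrow> 0"
    using tendsto_mult_left[OF q_lim, of C] by simp
  then have "(\<lambda>n. u G' - u (G n)) \<longlonglongrightarrow> 0"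
    by (rule Lim_null_comparison[OF always_eventually, rotated]) (use u_conv in auto)
  then have lim1: "(\<lambda>n. u (G n)) \<longlonglongrightarrow> u G'"
    using tendsto_diff[OF tendsto_const[of "u G'"], of "\<lambda>n. u G' - u (G n)" 0] by simp

  obtain A m where A: "A \<ge> 0" "\<And>w. norm (u (F w)) \<le> A * jap w ^ m"
    using tempered_tf_bound[OF u F] by blast
  have cont: "continuous_on UNIV (\<lambda>w. u (F w))"
    by (rule tempered_tf_continuous[OF u F])
  then have uF_lim: "(\<lambda>n. u (F (v n))) \<longlonglongrightarrow> u (F w)" if "v \<longlonglongrightarrow> w" for v w
    using that unfolding continuous_on_sequentially comp_def by blast
  have uFm[measurable]: "(\<lambda>w. u (F w)) \<in> borel_measurable borel"
    by (rule borel_measurable_continuous_onI[OF cont])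
  have "(\<lambda>n. LINT w|lborel. K w * u (F (s n w))) \<longlonglongrightarrow> (LINT w|lborel. K w * u (F w))"
  proof (rule integral_dominated_convergence)
    show "integrable lborel (\<lambda>w. A * 2 ^ m * (norm (K w) * jap w ^ m))"
      by (intro integrable_mult_right rapidly_decaying_integrable K)
    show "AE w in lborel. (\<lambda>n. K w * u (F (s n w))) \<longlonglongrightarrow> K w * u (F w)"
      by (intro AE_I2 tendsto_mult_left uF_lim s_lim)
    show "AE w in lborel. norm (K w * u (F (s n w))) \<le> A * 2 ^ m * (norm (K w) * jap w ^ m)" for n
    proof (rule AE_I2)
      fix w
      have "norm (u (F (s n w))) \<le> A * (2 * jap w) ^ m"
        by (intro order.trans[OF A(2)] mult_left_mono power_mono js A(1)) auto
      from mult_left_mono[OF this, of "norm (K w)"]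
      show "norm (K w * u (F (s n w))) \<le> A * 2 ^ m * (norm (K w) * jap w ^ m)"
        by (simp add: norm_mult power_mult_distrib mult_ac)
    qed
    show "(\<lambda>w. K w * u (F (s n w))) \<in> borel_measurable lborel" for n
      using measurable_compose[OF sm[of n] uFm] by simp
  qed auto
  then have "(\<lambda>n. u (G n)) \<longlonglongrightarrow> (LINT w|lborel. K w * u (F w))"
    by (simp add: G_u)
  with lim1 have "u G' = (LINT w|lborel. K w * u (F w))"
    by (rule LIMSEQ_unique)
  then show ?thesis
    by (simp add: G'_def[abs_def])
qed


section \<open>The Wigner transform\<close>

lemma dbounded_linear:
  fixes a :: "'a::euclidean_space"
  shows "dbounded (\<lambda>(_::unit) (_::unit) z. jap z) (\<lambda>_ z. c * of_real (z \<bullet> a))"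
proof (rule dbounded_sum_closure[where Q = "\<lambda>F. \<exists>a c d. F = (\<lambda>_ z. c * of_real (z \<bullet> a) + d)"])
  have D: "((\<lambda>z. c * of_real (z \<bullet> a) + d) has_derivative (\<lambda>v. c * of_real (v \<bullet> a))) (at x)"
    for a x :: 'a and c d :: complex
    by (rule has_derivative_eq_rhs, (rule derivative_eq_intros has_derivative_of_real refl)+) auto
  show "\<exists>a' c' d. (\<lambda>_ z. c * of_real (z \<bullet> a)) = (\<lambda>_ z. c' * of_real (z \<bullet> a') + d)"
    by (intro exI[of _ a] exI[of _ c] exI[of _ 0]) simp
  fix F :: "unit \<Rightarrow> 'a \<Rightarrow> complex" assume "\<exists>a c d. F = (\<lambda>_ z. c * of_real (z \<bullet> a) + d)"
  then obtain a c d where F: "F = (\<lambda>_ z. c * of_real (z \<bullet> a) + d)"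
    by blast
  show "F i differentiable (at x)" for i x
    unfolding F by (rule differentiableI[OF D])
  show "sum_closure (\<lambda>F. \<exists>a c d. F = (\<lambda>_ z. c * of_real (z \<bullet> a) + d)) (\<lambda>i. pdiff b (F i))" for b
  proof (rule sum_closure.base)
    have "(\<lambda>i. pdiff b (F i)) = (\<lambda>_ z. 0 * of_real (z \<bullet> 0) + c * of_real (b \<bullet> a))"
      unfolding F by (intro ext) (simp add: pdiff_eqI[OF D])
    then show "\<exists>a c d. (\<lambda>i. pdiff b (F i)) = (\<lambda>_ z. c * of_real (z \<bullet> a) + d)"
      by blast
  qed
  show "\<exists>C\<ge>0. \<forall>i x. norm (F i x) \<le> C * jap x" for k :: unit
  proof (intro exI[of _ "norm c * norm a + norm d"] conjI allI)
    fix i x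
    have "norm (F i x) \<le> norm c * (norm x * norm a) + norm d"
      unfolding F using Cauchy_Schwarz_ineq2[of x a]
      by (intro norm_triangle_mono) (auto simp: norm_mult mult_left_mono)
    also have "\<dots> \<le> norm c * (jap x * norm a) + norm d * jap x"
      using jap_ge_1[of x] by (intro add_mono mult_left_mono mult_right_mono norm_le_jap) (auto simp: mult_le_cancel_left1)
    finally show "norm (F i x) \<le> (norm c * norm a + norm d) * jap x"
      by (simp add: algebra_simps)
  qed auto
qed

lemma schwartz_linear_mult:
  assumes "\<Psi> \<in> schwartz"
  shows "(\<lambda>z. c * of_real (z \<bullet> a) * \<Psi> z) \<in> schwartz"
  unfolding schwartz_iff_dbounded
proof (rule dbounded_mult[OF dbounded_linear assms[unfolded schwartz_iff_dbounded]])
  fix k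
  have "jap x * (1 / jap x ^ Suc k) \<le> 1 * (1 / jap x ^ k)" for x :: 'a
    by simp
  then show "\<exists>k1 k2. \<exists>C\<ge>0. \<forall>i x. jap (x::'a) * (1 / jap x ^ k2) \<le> C * (1 / jap x ^ k)"
    by (intro exI[of _ undefined] exI[of _ "Suc k"] exI[of _ 1]) auto
qed

text \<open>
  The partial Fourier transform in the second variable maps Schwartz functions to Schwartz
  functions, since its first order derivatives are again partial Fourier transforms of Schwartz
  functions.
\<close>

definition partial_fourier :: "('a::euclidean_space \<times> 'a \<Rightarrow> complex) \<Rightarrow> 'a \<times> 'a \<Rightarrow> complex"
  where "partial_fourier \<Psi> = (\<lambda>(v, \<xi>). LINT r|lborel. cis (\<xi> \<bullet> r) * \<Psi> (v, r))"

lemma schwartz_fst_snd_bound: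
  fixes \<Psi> :: "'a::euclidean_space \<times> 'a \<Rightarrow> complex"
  assumes "\<Psi> \<in> schwartz"
  obtains C where "C \<ge> 0" "\<And>v r. norm (\<Psi> (v, r)) \<le> C / (jap v ^ k * jap r ^ l)"
proof -
  obtain C where C: "C \<ge> 0" "\<And>x. norm (\<Psi> x) \<le> C / jap x ^ (k + l)"
    using schwartz_bound[OF assms] by blast
  show ?thesis
  proof (rule that[OF C(1)])
    fix v r :: 'a
    have "jap v ^ k * jap r ^ l \<le> jap (v, r) ^ k * jap (v, r) ^ l"
      using jap_fst_le[of "(v, r)"] jap_snd_le[of "(v, r)"] by (intro mult_mono power_mono) auto
    then have "C / jap (v, r) ^ (k + l) \<le> C / (jap v ^ k * jap r ^ l)"
      using C(1) by (intro divide_left_mono mult_pos_pos zero_less_power) (auto simp: power_add)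
    then show "norm (\<Psi> (v, r)) \<le> C / (jap v ^ k * jap r ^ l)"
      using C(2)[of "(v, r)"] by linarith
  qed
qed

lemma schwartz_slice_integrable:
  fixes \<Psi> :: "'a::euclidean_space \<times> 'a \<Rightarrow> complex"
  assumes "\<Psi> \<in> schwartz"
  shows "integrable lborel (\<lambda>r. \<Psi> (v, r))"
proof -
  obtain C where C: "C \<ge> 0" "\<And>v r. norm (\<Psi> (v, r)) \<le> C / (jap v ^ 0 * jap r ^ (2 * DIM('a)))"
    using schwartz_fst_snd_bound[OF assms] by blast
  have "integrable lborel (\<lambda>r::'a. C * (1 / jap r ^ (2 * DIM('a))))"
    by (intro integrable_mult_right integrable_jap) auto
  then show ?thesis
  proof (rule integrable_dominated)
    have "continuous_on UNIV (\<lambda>r. \<Psi> (v, r))"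
      by (rule continuous_on_compose2[OF schwartz_continuous[OF assms]]) (auto intro!: continuous_intros)
    then show "(\<lambda>r. \<Psi> (v, r)) \<in> borel_measurable lborel"
      using borel_measurable_continuous_onI by simp
  qed (use C in auto)
qed

lemma partial_fourier_pdiff:
  fixes \<Psi> :: "'a::euclidean_space \<times> 'a \<Rightarrow> complex"
  assumes \<Psi>: "\<Psi> \<in> schwartz"
  shows "partial_fourier \<Psi> differentiable (at z)"
    and "b \<in> Basis \<Longrightarrow> \<exists>\<Psi>'\<in>schwartz. pdiff b (partial_fourier \<Psi>) = partial_fourier \<Psi>'"
proof -
  define H where "H r z = cis (snd z \<bullet> r) * \<Psi> (fst z, r)" for r z
  have pf: "partial_fourier \<Theta> = (\<lambda>z. LINT r|lborel. cis (snd z \<bullet> r) * \<Theta> (fst z, r))" for \<Theta>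
    by (auto simp: partial_fourier_def fun_eq_iff)
  have DH: "(H r has_derivative (\<lambda>c. \<i> * of_real (snd c \<bullet> r) * cis (snd z \<bullet> r) * \<Psi> (fst z, r)
      + cis (snd z \<bullet> r) * frechet_derivative \<Psi> (at (fst z, r)) (fst c, 0))) (at z)" for r z
  proof -
    have 1: "((\<lambda>z::'a\<times>'a. cis (snd z \<bullet> r)) has_derivative (\<lambda>c. \<i> * of_real (snd c \<bullet> r) * cis (snd z \<bullet> r))) (at z)"
      by (intro has_derivative_cis) (auto intro!: derivative_eq_intros)
    have "((\<lambda>z::'a\<times>'a. (fst z, r)) has_derivative (\<lambda>c. (fst c, 0))) (at z)"
      by (auto intro!: derivative_eq_intros)
    from has_derivative_compose[OF this frechet_derivative_worksI[OF smooth_differentiable[OF schwartz_smooth[OF \<Psi>]]]]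
    have 2: "((\<lambda>z::'a\<times>'a. \<Psi> (fst z, r)) has_derivative (\<lambda>c. frechet_derivative \<Psi> (at (fst z, r)) (fst c, 0))) (at z)" .
    show ?thesis
      unfolding H_def[abs_def]
      by (rule has_derivative_eq_rhs[OF has_derivative_mult[OF 1 2]]) (auto simp: algebra_simps)
  qed
  have lin: "linear (frechet_derivative \<Psi> (at x))" for x
    by (rule linear_frechet_derivative[OF smooth_differentiable[OF schwartz_smooth[OF \<Psi>]]])
  have ex: "\<exists>\<Psi>'\<in>schwartz. \<forall>r z. pdiff b (H r) z = cis (snd z \<bullet> r) * \<Psi>' (fst z, r)" if b: "b \<in> Basis" for b
  proof -
    from b consider c where "c \<in> Basis" "b = (c, 0)" | c where "c \<in> Basis" "b = (0, c)"
      by (auto simp: Basis_prod_def)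
    then show ?thesis
    proof cases
      case 1
      then have "\<forall>r z. pdiff b (H r) z = cis (snd z \<bullet> r) * pdiff b \<Psi> (fst z, r)"
        by (simp add: pdiff_eqI[OF DH]) (simp add: pdiff_def)
      then show ?thesis
        using schwartz_pdiff[OF \<Psi> b] by blast
    next
      case 2
      have "\<forall>r z. pdiff b (H r) z = cis (snd z \<bullet> r) * (\<i> * of_real ((fst z, r) \<bullet> b) * \<Psi> (fst z, r))"
        using 2 by (simp add: pdiff_eqI[OF DH] linear_0[OF lin] inner_commute zero_prod_def[symmetric])
      then show ?thesis
        by (intro bexI[OF _ schwartz_linear_mult[OF \<Psi>, of \<i> b]])
    qed
  qed
  then obtain \<Psi>' where \<Psi>': "\<And>b. b \<in> Basis \<Longrightarrow> \<Psi>' b \<in> schwartz"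
    "\<And>b r z. b \<in> Basis \<Longrightarrow> pdiff b (H r) z = cis (snd z \<bullet> r) * \<Psi>' b (fst z, r)"
    by metis
  have "\<exists>C. b \<in> Basis \<longrightarrow> (\<forall>v r. norm (\<Psi>' b (v, r)) \<le> C / jap r ^ (2 * DIM('a)))" for b
  proof (cases "b \<in> Basis")
    case True
    show ?thesis
      using schwartz_fst_snd_bound[OF \<Psi>'(1)[OF True], of 0 "2 * DIM('a)"] by (metis mult_1 power_0)
  qed simp
  then obtain C where C: "\<And>b v r. b \<in> Basis \<Longrightarrow> norm (\<Psi>' b (v, r)) \<le> C b / jap r ^ (2 * DIM('a))"
    by metis
  have i: "integrable lborel (\<lambda>r. H r z)" for z
    unfolding H_def by (intro integrable_cis_mult schwartz_slice_integrable \<Psi>)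
  have d: "H r differentiable (at z)" for r z
    by (rule differentiableI[OF DH])
  have bd: "norm (pdiff b (H r) z) \<le> C b * (1 / jap r ^ (2 * DIM('a)))" if "b \<in> Basis" for b r z
    using C[OF that, of "fst z" r] by (simp add: \<Psi>'(2)[OF that])
  have gi: "integrable lborel (\<lambda>r::'a. C b * (1 / jap r ^ (2 * DIM('a))))" for b
    by (intro integrable_mult_right integrable_jap) auto
  have m: "(\<lambda>r. pdiff b (H r) z) \<in> borel_measurable lborel" if "b \<in> Basis" for b z
    unfolding \<Psi>'(2)[OF that]
    using integrable_cis_mult[OF schwartz_slice_integrable[OF \<Psi>'(1)[OF that], of "fst z"], of "snd z"]
    by (rule borel_measurable_integrable)
  have eq: "partial_fourier \<Psi> = (\<lambda>z. LINT r|lborel. H r z)"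
    unfolding pf H_def ..
  show "partial_fourier \<Psi> differentiable (at z)"
    unfolding eq by (rule pdiff_integral(1)[OF i d bd gi m])
  show "\<exists>\<Psi>'\<in>schwartz. pdiff b (partial_fourier \<Psi>) = partial_fourier \<Psi>'" if b: "b \<in> Basis"
  proof (intro bexI[of _ "\<Psi>' b"] ext)
    fix z
    have "pdiff b (partial_fourier \<Psi>) z = (LINT r|lborel. pdiff b (H r) z)"
      unfolding eq by (rule pdiff_integral(2)[OF i d bd gi m b])
    then show "pdiff b (partial_fourier \<Psi>) z = partial_fourier (\<Psi>' b) z"
      by (simp add: \<Psi>'(2)[OF b] pf)
  qed (rule \<Psi>'(1)[OF b])
qed

lemma partial_fourier_bound:
  fixes \<Psi> :: "'a::euclidean_space \<times> 'a \<Rightarrow> complex"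
  assumes \<Psi>: "\<Psi> \<in> schwartz"
  shows "\<exists>C\<ge>0. \<forall>z. norm (partial_fourier \<Psi> z) \<le> C / jap z ^ k"
proof -
  let ?W = "\<lambda>k v r::'a. 1 / (jap (v::'a) ^ k * jap r ^ (2 * DIM('a)))"
  let ?I = "LINT r|lborel. 1 / jap (r::'a) ^ (2 * DIM('a))"
  have "dbounded (\<lambda>k (_::'a) z. 1 / jap z ^ k) (\<lambda>_. \<Psi>)"
    using \<Psi> unfolding schwartz_iff_dbounded dbounded_def by simp
  then have "dbounded ?W (\<lambda>v r. \<Psi> ((0, r) + (v, 0)))"
  proof (rule dbounded_affine[where A = "\<lambda>_ r. (0, r)" and e = "\<lambda>v. (v, 0)" and D = 1])
    show "\<exists>k1. \<exists>C\<ge>0. \<forall>v r. 1 / jap ((0, r) + (v, 0)) ^ k1 \<le> C * ?W k v r" for k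
    proof (intro exI[of _ "k + 2 * DIM('a)"] exI[of _ 1] conjI allI)
      fix v r :: 'a
      have "jap v ^ k * jap r ^ (2 * DIM('a)) \<le> jap (v, r) ^ k * jap (v, r) ^ (2 * DIM('a))"
        using jap_fst_le[of "(v, r)"] jap_snd_le[of "(v, r)"] by (intro mult_mono power_mono) auto
      then have "1 / jap (v, r) ^ (k + 2 * DIM('a)) \<le> 1 / (jap v ^ k * jap r ^ (2 * DIM('a)))"
        by (intro divide_left_mono mult_pos_pos zero_less_power) (auto simp: power_add)
      then show "1 / jap ((0, r) + (v, 0)) ^ (k + 2 * DIM('a)) \<le> 1 * ?W k v r"
        by simp
    qed simp
  qed (auto simp: linear_iff norm_Pair)
  then have W: "dbounded ?W (\<lambda>v r. \<Psi> (v, r))" by simp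
  have int: "integrable lborel (?W k v)" and le: "(LINT r|lborel. ?W k v r) \<le> ?I / jap v ^ k" for v
  proof -
    have eq: "?W k v = (\<lambda>r. (1 / jap v ^ k) * (1 / jap r ^ (2 * DIM('a))))"
      by (simp add: fun_eq_iff)
    show "integrable lborel (?W k v)"
      unfolding eq by (intro integrable_mult_right integrable_jap) auto
    show "(LINT r|lborel. ?W k v r) \<le> ?I / jap v ^ k"
      unfolding eq integral_mult_right_zero by simp
  qed
  obtain C where C: "C \<ge> 0"
    "\<And>v \<zeta>. norm (LINT r|lborel. cis (\<zeta> \<bullet> r) * \<Psi> (v, r)) \<le> C * (?I / jap v ^ k) / jap \<zeta> ^ k"
    using dbounded_fourier_decay[OF W, of k "\<lambda>v. ?I / jap v ^ k" k] int le by blast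
  have I0: "0 \<le> ?I" by (intro integral_nonneg_AE) auto
  have "norm (partial_fourier \<Psi> (v, \<xi>)) \<le> C * ?I / jap (v, \<xi>) ^ k" for v \<xi>
  proof -
    have "jap (v, \<xi>) ^ k \<le> jap v ^ k * jap \<xi> ^ k"
      unfolding power_mult_distrib[symmetric] by (intro power_mono jap_Pair_le) auto
    then have "C * ?I / (jap v ^ k * jap \<xi> ^ k) \<le> C * ?I / jap (v, \<xi>) ^ k"
      using C(1) I0 by (intro divide_left_mono mult_pos_pos zero_less_power) auto
    then show ?thesis
      using C(2)[of \<xi> v] by (simp add: partial_fourier_def)
  qed
  then show ?thesis
    using C(1) I0 by (intro exI[of _ "C * ?I"]) auto
qed

lemma partial_fourier_schwartz:
  fixes \<Psi> :: "'a::euclidean_space \<times> 'a \<Rightarrow> complex"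
  assumes "\<Psi> \<in> schwartz"
  shows "partial_fourier \<Psi> \<in> schwartz"
proof -
  define Q where "Q = (\<lambda>F. \<exists>\<Psi>\<in>schwartz. F = (\<lambda>_::unit. partial_fourier (\<Psi> :: 'a \<times> 'a \<Rightarrow> complex)))"
  have Q: "Q (\<lambda>_. partial_fourier \<Psi>)"
    unfolding Q_def using assms by blast
  have der: "Q (\<lambda>i. pdiff b (F i))" if F: "Q F" and b: "b \<in> Basis" for F b
  proof -
    obtain \<Theta> where \<Theta>: "\<Theta> \<in> schwartz" "F = (\<lambda>_. partial_fourier \<Theta>)"
      using F unfolding Q_def by blast
    from partial_fourier_pdiff(2)[OF \<Theta>(1) b] show ?thesis
      unfolding Q_def \<Theta>(2) by metis
  qed
  have diff: "F i differentiable (at x)" if "Q F" for F i x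
    using that partial_fourier_pdiff(1) unfolding Q_def by blast
  show ?thesis
    unfolding schwartz_iff_dbounded dbounded_def
  proof safe
    show "smooth (partial_fourier \<Psi>)"
      by (rule smooth_invariant[of Q "\<lambda>_. partial_fourier \<Psi>"]) (blast intro: Q der diff)+
    fix bs :: "('a \<times> 'a) list" and k assume bs: "set bs \<subseteq> Basis"
    have "Q (\<lambda>_. partials bs (partial_fourier \<Psi>))"
      by (rule partials_invariant[of Q "\<lambda>_. partial_fourier \<Psi>"]) (rule Q bs | blast intro: der)+
    then obtain \<Theta> where "\<Theta> \<in> schwartz" "partials bs (partial_fourier \<Psi>) = partial_fourier \<Theta>"
      unfolding Q_def by metis
    then show "\<exists>C\<ge>0. \<forall>i x. norm (partials bs (partial_fourier \<Psi>) x) \<le> C * (1 / jap x ^ k)"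
      using partial_fourier_bound by auto
  qed
qed

definition wigner_window :: "('a::euclidean_space \<Rightarrow> complex) \<Rightarrow> ('a \<Rightarrow> complex) \<Rightarrow> 'a \<times> 'a \<Rightarrow> complex"
  where "wigner_window f h = (\<lambda>z. f (fst z - (1/2) *\<^sub>R snd z) * cnj (h (fst z + (1/2) *\<^sub>R snd z)))"

definition wigner :: "('a::euclidean_space \<Rightarrow> complex) \<Rightarrow> ('a \<Rightarrow> complex) \<Rightarrow> 'a \<times> 'a \<Rightarrow> complex"
  where "wigner f h = partial_fourier (wigner_window f h)"

lemma wigner_eq:
  "wigner f h (v, \<xi>) = (LINT r|lborel. cis (\<xi> \<bullet> r) * (f (v - (1/2) *\<^sub>R r) * cnj (h (v + (1/2) *\<^sub>R r))))"
  by (simp add: wigner_def partial_fourier_def wigner_window_def)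

lemma wigner_window_schwartz:
  fixes f h :: "'a::euclidean_space \<Rightarrow> complex"
  assumes "f \<in> schwartz" "h \<in> schwartz"
  shows "wigner_window f h \<in> schwartz"
proof -
  let ?a = "\<lambda>z. fst z - (1/2) *\<^sub>R snd z :: 'a" and ?b = "\<lambda>z. fst z + (1/2) *\<^sub>R snd z :: 'a"
  have nb: "norm (fst z) \<le> 1" "norm (snd z) \<le> 1" if "z \<in> Basis" for z :: "'a \<times> 'a"
    using that by (auto simp: Basis_prod_def)
  have na: "norm (?a z) \<le> 2" "norm (?b z) \<le> 2" if "z \<in> Basis" for z :: "'a \<times> 'a"
    using nb[OF that] norm_triangle_ineq4[of "fst z" "(1/2) *\<^sub>R snd z"]
      norm_triangle_ineq[of "fst z" "(1/2) *\<^sub>R snd z"] by auto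
  have lin: "linear ?a" "linear ?b"
    by (auto simp: linear_iff algebra_simps)
  have W: "\<exists>k1. \<exists>C\<ge>0. \<forall>(i::unit) z. 1 / jap (g z) ^ k1 \<le> C * (1 / jap (g z) ^ k)"
    for k and g :: "'a \<times> 'a \<Rightarrow> 'a"
    by (intro exI[of _ k] exI[of _ 1]) auto
  have "dbounded (\<lambda>k (_::unit) z. 1 / jap (?a z) ^ k) (\<lambda>_ z. f (?a z + 0))"
    by (rule dbounded_affine[OF assms(1)[unfolded schwartz_iff_dbounded], where D = 2, OF lin(1) na(1)])
      (simp_all only: add_0_right W[of ?a])
  then have 1: "dbounded (\<lambda>k (_::unit) z. 1 / jap (?a z) ^ k) (\<lambda>_ z. f (?a z))"
    by simp
  have "dbounded (\<lambda>k (_::unit) z. 1 / jap (?b z) ^ k) (\<lambda>_ z. cnj (h (?b z + 0)))"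
    by (rule dbounded_affine[OF schwartz_cnj[OF assms(2), unfolded schwartz_iff_dbounded], where D = 2, OF lin(2) na(2)])
      (simp_all only: add_0_right W[of ?b])
  then have 2: "dbounded (\<lambda>k (_::unit) z. 1 / jap (?b z) ^ k) (\<lambda>_ z. cnj (h (?b z)))"
    by simp
  show ?thesis
    unfolding schwartz_iff_dbounded wigner_window_def
  proof (rule dbounded_mult[OF 1 2])
    fix k
    have "1 / jap (?a z) ^ (2 * k) * (1 / jap (?b z) ^ (2 * k)) \<le> 4 ^ k * (1 / jap z ^ k)" for z :: "'a \<times> 'a"
    proof -
      \<comment> \<open>Both components of \<open>z\<close> are controlled by the product of the two weights, hence \<open>2 * k\<close>.\<close>
      let ?j = "jap (?a z) * jap (?b z)"
      have half: "x + x = 2 *\<^sub>R x" for x :: 'a by (simp add: scaleR_2)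
      have "snd z = ?b z + - ?a z"
        by (simp add: algebra_simps) (simp flip: scaleR_left_distrib)
      then have s: "jap (snd z) \<le> 2 * ?j"
        using jap_add[of "?b z" "- ?a z"] by (simp only: jap_minus mult_ac)
      have "fst z = (1/2) *\<^sub>R (?a z + ?b z)"
        by (simp add: half)
      then have "jap (fst z) \<le> jap (?a z + ?b z)"
        using jap_scaleR_le[of "1/2" "?a z + ?b z"] by simp
      then have f: "jap (fst z) \<le> 2 * ?j"
        using jap_add[of "?a z" "?b z"] by (simp only: mult.assoc)
      have "jap z \<le> jap (fst z) * jap (snd z)"
        using jap_Pair_le[of "fst z" "snd z"] by simp
      also have "\<dots> \<le> (2 * ?j) * (2 * ?j)"
        by (intro mult_mono f s) auto
      finally have "jap z ^ k \<le> ((2 * ?j) * (2 * ?j)) ^ k"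
        by (rule power_mono) simp
      also have "\<dots> = 4 ^ k * (jap (?a z) ^ (2 * k) * jap (?b z) ^ (2 * k))"
        by (simp add: power_mult_distrib power_mult power2_eq_square)
      finally have "jap z ^ k \<le> 4 ^ k * (jap (?a z) ^ (2 * k) * jap (?b z) ^ (2 * k))" .
      moreover have "0 < jap (?a z) ^ (2 * k) * jap (?b z) ^ (2 * k)"
        by (intro mult_pos_pos zero_less_power jap_pos)
      moreover have "0 < jap z ^ k" by simp
      ultimately have "1 / (jap (?a z) ^ (2 * k) * jap (?b z) ^ (2 * k)) \<le> 4 ^ k / jap z ^ k"
        by (simp add: divide_le_eq pos_le_divide_eq field_simps)
      then show ?thesis by simp
    qed
    then show "\<exists>k1 k2. \<exists>C\<ge>0. \<forall>i z. 1 / jap (?a z) ^ k1 * (1 / jap (?b z) ^ k2) \<le> C * (1 / jap z ^ k)"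
      by (intro exI[of _ "2 * k"] exI[of _ "4 ^ k"]) auto
  qed
qed

lemma wigner_schwartz: "f \<in> schwartz \<Longrightarrow> h \<in> schwartz \<Longrightarrow> wigner f h \<in> schwartz"
  unfolding wigner_def by (intro partial_fourier_schwartz wigner_window_schwartz)

text \<open>
  The covariance of the Wigner transform: translating the integration variable by the difference of
  the two positions moves both position shifts to their midpoint, and the exponentials combine in
  the same way, leaving a modulation by the symplectic rotation of \<open>z - w\<close>.
\<close>

lemma wigner_tf_shift:
  fixes f h :: "'a::euclidean_space \<Rightarrow> complex"
  assumes fh: "f \<in> schwartz" "h \<in> schwartz"
  shows "wigner (tf_shift z f) (tf_shift w h) x =
    cis ((snd z - snd w, fst w - fst z) \<bullet> x) * cis ((fst z - fst w) \<bullet> ((1/2) *\<^sub>R (snd z + snd w)))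
      * wigner f h (x - (1/2) *\<^sub>R (z + w))"
proof -
  obtain p0 q0 p q v \<xi> where z: "z = (p0, q0)" and w: "w = (p, q)" and x: "x = (v, \<xi>)"
    by (metis surj_pair)
  let ?c = "(1/2) *\<^sub>R (p0 + p)" and ?k = "(1/2) *\<^sub>R (q0 + q)" and ?d = "p0 - p"
  let ?V = "v - ?c" and ?X = "\<xi> - ?k"
  let ?g = "\<lambda>r. cis (?X \<bullet> r) * (f (?V - (1/2) *\<^sub>R r) * cnj (h (?V + (1/2) *\<^sub>R r)))"
  let ?\<theta> = "cis (v \<bullet> (q0 - q)) * cis (- (?X \<bullet> ?d))"
  have half: "(1/2) *\<^sub>R y + (1/2) *\<^sub>R y = y" for y :: 'a
    by (simp flip: scaleR_left_distrib)
  have pt: "cis (\<xi> \<bullet> r) * (tf_shift z f (v - (1/2) *\<^sub>R r) * cnj (tf_shift w h (v + (1/2) *\<^sub>R r)))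
      = ?\<theta> * ?g (r + ?d)" for r
  proof -
    have 1: "?V - (1/2) *\<^sub>R (r + ?d) = v - (1/2) *\<^sub>R r - p0"
      using half[of p0] by (simp add: algebra_simps)
    have 2: "?V + (1/2) *\<^sub>R (r + ?d) = v + (1/2) *\<^sub>R r - p"
      using half[of p] by (simp add: algebra_simps)
    have "\<xi> \<bullet> r + (v - (1/2) *\<^sub>R r) \<bullet> q0 - (v + (1/2) *\<^sub>R r) \<bullet> q = v \<bullet> (q0 - q) - ?X \<bullet> ?d + ?X \<bullet> (r + ?d)"
      by (simp add: inner_diff_left inner_diff_right inner_add_left inner_add_right inner_commute[of r]) (simp add: algebra_simps)
    then have "cis (\<xi> \<bullet> r) * (cis ((v - (1/2) *\<^sub>R r) \<bullet> q0) * cis (- ((v + (1/2) *\<^sub>R r) \<bullet> q)))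
        = ?\<theta> * cis (?X \<bullet> (r + ?d))"
      by (simp add: cis_mult algebra_simps)
    then show ?thesis
      unfolding 1 2 by (simp add: tf_shift_def z w cis_cnj mult_ac)
  qed
  have int: "integrable lborel ?g"
    using integrable_cis_mult[OF schwartz_slice_integrable[OF wigner_window_schwartz[OF fh]], of ?X ?V]
    by (simp add: wigner_window_def)
  have "wigner (tf_shift z f) (tf_shift w h) x = (LINT r|lborel. ?\<theta> * ?g (r + ?d))"
    unfolding x wigner_eq pt ..
  also have "\<dots> = ?\<theta> * (LINT r|lborel. ?g (r + ?d))"
    by (rule integral_mult_right_zero)
  also have "(LINT r|lborel. ?g (r + ?d)) = (LINT r|lborel. ?g r)"
    using int by (intro lborel_integral_shift) auto
  also have "\<dots> = wigner f h (x - (1/2) *\<^sub>R (z + w))"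
    by (simp add: x z w wigner_eq)
  also have "?\<theta> = cis ((snd z - snd w, fst w - fst z) \<bullet> x) * cis ((fst z - fst w) \<bullet> ((1/2) *\<^sub>R (snd z + snd w)))"
    by (simp add: x z w cis_mult inner_diff_left inner_diff_right inner_add_left inner_add_right inner_commute)
      (simp add: algebra_simps)
  finally show ?thesis .
qed


section \<open>The Weyl quantization of time-frequency shifts\<close>

definition weyl_kernel ::
    "('a::euclidean_space \<Rightarrow> complex) \<Rightarrow> ('a \<times> 'a \<Rightarrow> complex) \<Rightarrow> 'a \<times> 'a \<Rightarrow> 'a \<times> 'a \<Rightarrow> complex"
  where "weyl_kernel \<phi> b z w = (LINT x|lborel. b x * wigner (tf_shift z \<phi>) (tf_shift w \<phi>) x)"

text \<open>
  By covariance the integrand is a smooth function concentrated at the midpoint of \<open>z\<close> and \<open>w\<close>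
  times an exponential with frequency of length \<open>\<bar>z - w\<bar>\<close>; integration by parts gives decay.
\<close>

lemma weyl_kernel_decay:
  fixes b :: "'i \<Rightarrow> 'a::euclidean_space \<times> 'a \<Rightarrow> complex"
  assumes b: "dbounded (\<lambda>(_::unit) _ x. jap x ^ M) b" and \<phi>: "\<phi> \<in> schwartz"
  obtains C where "C \<ge> 0"
    "\<And>i z w. norm (weyl_kernel \<phi> (b i) z w) \<le> C * jap z ^ M / jap (z - w) ^ N"
proof -
  let ?n = "2 * DIM('a \<times> 'a)"
  let ?I = "LINT x|lborel. 1 / jap (x :: 'a \<times> 'a) ^ ?n"
  have 1: "dbounded (\<lambda>(_::unit) (j :: 'i \<times> 'a \<times> 'a) x. jap x ^ M) (\<lambda>j. b (fst j))"
    using dbounded_reindex[OF b, of fst] by simp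
  have "dbounded (\<lambda>k (_ :: 'i \<times> 'a \<times> 'a) x. 1 / jap x ^ k) (\<lambda>_. wigner \<phi> \<phi>)"
    using wigner_schwartz[OF \<phi> \<phi>] unfolding schwartz_iff_dbounded dbounded_def by simp
  then have "dbounded (\<lambda>k (j :: 'i \<times> 'a \<times> 'a) x. 1 / jap (x - snd j) ^ k) (\<lambda>j x. wigner \<phi> \<phi> (x + - snd j))"
  proof (rule dbounded_affine[where A = "\<lambda>_ x. x" and D = 1])
    show "\<exists>k1. \<exists>C\<ge>0. \<forall>(j :: 'i \<times> 'a \<times> 'a) x. 1 / jap (x + - snd j) ^ k1 \<le> C * (1 / jap (x - snd j) ^ k)" for k
      by (intro exI[of _ k] exI[of _ 1]) simp
  qed (auto simp: linear_iff)
  then have 2: "dbounded (\<lambda>k (j :: 'i \<times> 'a \<times> 'a) x. 1 / jap (x - snd j) ^ k) (\<lambda>j x. wigner \<phi> \<phi> (x - snd j))"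
    by simp
  have 3: "dbounded (\<lambda>(_::unit) (j :: 'i \<times> 'a \<times> 'a) x. jap (snd j) ^ M * (1 / jap (x - snd j) ^ ?n))
      (\<lambda>j x. b (fst j) x * wigner \<phi> \<phi> (x - snd j))"
  proof (rule dbounded_mult[OF 1 2])
    have "jap x ^ M * (1 / jap (x - e) ^ (M + ?n)) \<le> 2 ^ M * (jap e ^ M * (1 / jap (x - e) ^ ?n))" for x e :: "'a \<times> 'a"
      using mult_right_mono[OF jap_le_diff_power[of x M e], of "1 / jap (x - e) ^ (M + ?n)"]
      by (simp add: power_add field_simps)
    then show "\<exists>k1 k2. \<exists>C\<ge>0. \<forall>(j :: 'i \<times> 'a \<times> 'a) x. jap x ^ M * (1 / jap (x - snd j) ^ k2)
        \<le> C * (jap (snd j) ^ M * (1 / jap (x - snd j) ^ ?n))"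
      by (intro exI[of _ undefined] exI[of _ "M + ?n"] exI[of _ "2 ^ M"]) simp
  qed
  have int: "integrable lborel (\<lambda>x. jap e ^ M * (1 / jap (x - e) ^ ?n))"
    and le: "(LINT x|lborel. jap e ^ M * (1 / jap (x - e) ^ ?n)) \<le> jap e ^ M * ?I" for e :: "'a \<times> 'a"
    using integrable_mult_right[OF integrable_jap_shift(1)[of ?n e], of "jap e ^ M"]
      integrable_jap_shift(2)[of ?n e]
    unfolding integral_mult_right_zero by simp_all
  \<comment> \<open>The weight at the midpoint costs the power \<open>M\<close> of the distance of \<open>z\<close> and \<open>w\<close>.\<close>
  obtain C where C: "C \<ge> 0" "\<And>(j :: 'i \<times> 'a \<times> 'a) \<zeta>. norm (LINT x|lborel. cis (\<zeta> \<bullet> x) * (b (fst j) x * wigner \<phi> \<phi> (x - snd j)))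
      \<le> C * (jap (snd j) ^ M * ?I) / jap \<zeta> ^ (N + M)"
    using dbounded_fourier_decay[OF 3, where A = "\<lambda>j. jap (snd j) ^ M * ?I" and N = "N + M"] int le by blast
  have I0: "0 \<le> ?I" by (intro integral_nonneg_AE) auto
  show ?thesis
  proof (rule that[of "C * ?I * 2 ^ M"])
    show "0 \<le> C * ?I * 2 ^ M" using C I0 by simp
    fix i and z w :: "'a \<times> 'a"
    let ?e = "(1/2) *\<^sub>R (z + w)" and ?\<zeta> = "(snd z - snd w, fst w - fst z)"
    let ?c = "cis ((fst z - fst w) \<bullet> ((1/2) *\<^sub>R (snd z + snd w)))"
    have "weyl_kernel \<phi> (b i) z w = (LINT x|lborel. ?c * (cis (?\<zeta> \<bullet> x) * (b i x * wigner \<phi> \<phi> (x - ?e))))"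
      unfolding weyl_kernel_def wigner_tf_shift[OF \<phi> \<phi>]
      by (intro Bochner_Integration.integral_cong) (auto simp: mult_ac)
    then have "norm (weyl_kernel \<phi> (b i) z w) = norm (LINT x|lborel. cis (?\<zeta> \<bullet> x) * (b i x * wigner \<phi> \<phi> (x - ?e)))"
      unfolding integral_mult_right_zero by simp
    also have "\<dots> \<le> C * (jap ?e ^ M * ?I) / jap ?\<zeta> ^ (N + M)"
      using C(2)[of ?\<zeta> "(i, ?e)"] by simp
    also have "jap ?\<zeta> = jap (z - w)"
      by (simp add: jap_def norm_prod_def norm_minus_commute add.commute)
    also have "C * (jap ?e ^ M * ?I) / jap (z - w) ^ (N + M) \<le> C * ((2 * jap z * jap (z - w)) ^ M * ?I) / jap (z - w) ^ (N + M)"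
    proof (intro divide_right_mono mult_left_mono mult_right_mono power_mono)
      have "z = (1/2) *\<^sub>R z + (1/2) *\<^sub>R z"
        by (simp flip: scaleR_left_distrib)
      then have "?e = z + (- (1/2)) *\<^sub>R (z - w)"
        by (simp add: algebra_simps)
      then have "jap ?e \<le> 2 * jap z * jap ((- (1/2)) *\<^sub>R (z - w))"
        using jap_add[of z "(- (1/2)) *\<^sub>R (z - w)"] by (simp only:)
      also have "\<dots> \<le> 2 * jap z * jap (z - w)"
        by (intro mult_left_mono jap_scaleR_le) auto
      finally show "jap ?e \<le> 2 * jap z * jap (z - w)" .
    qed (use C I0 in auto)
    also have "\<dots> = C * ?I * 2 ^ M * jap z ^ M / jap (z - w) ^ N"
      by (simp add: power_mult_distrib power_add)
    finally show "norm (weyl_kernel \<phi> (b i) z w) \<le> C * ?I * 2 ^ M * jap z ^ M / jap (z - w) ^ N" .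
  qed
qed

lemma tf_shift_schwartz: "\<phi> \<in> schwartz \<Longrightarrow> tf_shift w \<phi> \<in> schwartz"
  using tf_family_schwartz[OF tf_family.shift] by blast

lemma weyl_kernel_measurable:
  fixes b :: "'a::euclidean_space \<times> 'a \<Rightarrow> complex"
  assumes [measurable]: "b \<in> borel_measurable borel" and \<phi>: "\<phi> \<in> schwartz"
  shows "weyl_kernel \<phi> b z \<in> borel_measurable borel"
proof -
  have [measurable]: "wigner \<phi> \<phi> \<in> borel_measurable borel"
    by (intro schwartz_measurable wigner_schwartz \<phi>)
  have [measurable]: "fst \<in> borel_measurable (borel :: ('a \<times> 'a) measure)" "snd \<in> borel_measurable (borel :: ('a \<times> 'a) measure)"
    by (intro borel_measurable_continuous_onI continuous_intros)+
  let ?F = "\<lambda>p. b (snd p) * (cis ((snd z - snd (fst p)) \<bullet> fst (snd p) + (fst (fst p) - fst z) \<bullet> snd (snd p))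
      * cis ((fst z - fst (fst p)) \<bullet> ((1/2) *\<^sub>R (snd z + snd (fst p)))) * wigner \<phi> \<phi> (snd p - (1/2) *\<^sub>R (z + fst p)))"
  have "?F \<in> borel_measurable (lborel \<Otimes>\<^sub>M lborel)"
    by measurable
  then have "(\<lambda>w. LINT x|lborel. ?F (w, x)) \<in> borel_measurable lborel"
    by (intro lborel.borel_measurable_lebesgue_integral) (simp add: case_prod_beta')
  moreover have "weyl_kernel \<phi> b z = (\<lambda>w. LINT x|lborel. ?F (w, x))"
    unfolding weyl_kernel_def wigner_tf_shift[OF \<phi> \<phi>] by (simp add: inner_prod_def)
  ultimately show ?thesis by simp
qed

subsection \<open>Symbols with a frequency cut-off\<close>

text \<open>
  The decay in the frequency is integrable, so that the integral that defines the Weyl operator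
  converges absolutely.
\<close>

definition cutoff_symbol :: "nat \<Rightarrow> ('a::euclidean_space \<times> 'a \<Rightarrow> complex) \<Rightarrow> bool"
  where "cutoff_symbol M \<beta> \<longleftrightarrow> continuous_on UNIV \<beta> \<and>
    (\<exists>C\<ge>0. \<forall>v \<xi>. norm (\<beta> (v, \<xi>)) \<le> C * jap v ^ M / jap \<xi> ^ (2 * DIM('a)))"

definition weyl_integrand ::
    "('a::euclidean_space \<times> 'a \<Rightarrow> complex) \<Rightarrow> ('a \<Rightarrow> complex) \<Rightarrow> 'a \<Rightarrow> 'a \<Rightarrow> 'a \<Rightarrow> complex"
  where "weyl_integrand \<beta> f t y \<xi> = cis ((t - y) \<bullet> \<xi>) * \<beta> ((1/2) *\<^sub>R (t + y), \<xi>) * f y"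

text \<open>The factor \<open>(2 \<pi>)\<^sup>-\<^sup>d\<close> is left out, because multiplicative constants do not matter.\<close>

definition weyl_op :: "('a::euclidean_space \<times> 'a \<Rightarrow> complex) \<Rightarrow> ('a \<Rightarrow> complex) \<Rightarrow> 'a \<Rightarrow> complex"
  where "weyl_op \<beta> f t =
    (LINT x|lborel. weyl_integrand \<beta> f t (fst x) (snd x))"

lemma weyl_op_dominated:
  fixes f :: "'a::euclidean_space \<Rightarrow> complex"
  assumes "cutoff_symbol M \<beta>" "f \<in> schwartz"
  obtains D where "D \<ge> 0"
    "\<And>t y \<xi>. norm (weyl_integrand \<beta> f t y \<xi>) \<le> D * jap t ^ M * (1 / jap y ^ (2 * DIM('a)) * (1 / jap \<xi> ^ (2 * DIM('a))))"
proof -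
  obtain C where C: "C \<ge> 0" "\<And>v \<xi>. norm (\<beta> (v, \<xi>)) \<le> C * jap v ^ M / jap \<xi> ^ (2 * DIM('a))"
    using assms unfolding cutoff_symbol_def by blast
  obtain C2 where C2: "C2 \<ge> 0" "\<And>y. norm (f y) \<le> C2 / jap y ^ (M + 2 * DIM('a))"
    using schwartz_bound[OF assms(2)] by blast
  show ?thesis
  proof (rule that[of "C * 2 ^ M * C2"])
    show "0 \<le> C * 2 ^ M * C2" using C C2 by simp
    fix t y \<xi> :: 'a
    have "jap ((1/2) *\<^sub>R (t + y)) \<le> 2 * jap t * jap y"
      using jap_scaleR_le[of "1/2" "t + y"] jap_add[of t y] by simp
    then have "norm (\<beta> ((1/2) *\<^sub>R (t + y), \<xi>)) \<le> C * (2 * jap t * jap y) ^ M / jap \<xi> ^ (2 * DIM('a))"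
      using C(1) by (intro order.trans[OF C(2)] divide_right_mono mult_left_mono power_mono) auto
    then have "norm (\<beta> ((1/2) *\<^sub>R (t + y), \<xi>)) * norm (f y)
        \<le> (C * (2 * jap t * jap y) ^ M / jap \<xi> ^ (2 * DIM('a))) * (C2 / jap y ^ (M + 2 * DIM('a)))"
      using C(1) by (intro mult_mono C2) auto
    then show "norm (weyl_integrand \<beta> f t y \<xi>)
        \<le> C * 2 ^ M * C2 * jap t ^ M * (1 / jap y ^ (2 * DIM('a)) * (1 / jap \<xi> ^ (2 * DIM('a))))"
      by (simp add: weyl_integrand_def norm_mult power_mult_distrib power_add mult_ac)
  qed
qed

lemma weyl_integrand_continuous:
  fixes f :: "'a::euclidean_space \<Rightarrow> complex" and t y \<xi> :: "'b::topological_space \<Rightarrow> 'a"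
  assumes "cutoff_symbol M \<beta>" "f \<in> schwartz"
    and "continuous_on UNIV t" "continuous_on UNIV y" "continuous_on UNIV \<xi>"
  shows "continuous_on UNIV (\<lambda>p. weyl_integrand \<beta> f (t p) (y p) (\<xi> p))"
proof -
  have "continuous_on UNIV \<beta>"
    using assms(1) by (simp add: cutoff_symbol_def)
  then have "continuous_on UNIV (\<lambda>p. \<beta> ((1/2) *\<^sub>R (t p + y p), \<xi> p))"
    by (rule continuous_on_compose2) (auto intro!: continuous_intros assms)
  moreover have "continuous_on UNIV (\<lambda>p. f (y p))"
    by (rule continuous_on_compose2[OF schwartz_continuous[OF assms(2)] assms(4)]) auto
  ultimately show ?thesis
    unfolding weyl_integrand_def
    by (intro continuous_intros assms) auto
qed

lemma integrable_jap_jap: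
  "integrable lborel (\<lambda>x::'a::euclidean_space \<times> 'a. 1 / jap (fst x) ^ (2 * DIM('a)) * (1 / jap (snd x) ^ (2 * DIM('a))))"
proof (rule integrable_pair_bound[OF _ integrable_jap[of "2 * DIM('a)"] integrable_jap[of "2 * DIM('a)"]])
  have "continuous_on UNIV (\<lambda>x::'a \<times> 'a. 1 / jap (fst x) ^ (2 * DIM('a)) * (1 / jap (snd x) ^ (2 * DIM('a))))"
    by (intro continuous_intros) auto
  then show "(\<lambda>x::'a \<times> 'a. 1 / jap (fst x) ^ (2 * DIM('a)) * (1 / jap (snd x) ^ (2 * DIM('a)))) \<in> borel_measurable borel"
    by (rule borel_measurable_continuous_onI)
qed auto

lemma weyl_op_integrable:
  fixes f :: "'a::euclidean_space \<Rightarrow> complex"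
  assumes "cutoff_symbol M \<beta>" "f \<in> schwartz"
  shows "integrable lborel (\<lambda>x. weyl_integrand \<beta> f t (fst x) (snd x))"
proof -
  obtain D where D: "D \<ge> 0" "\<And>t y \<xi>. norm (weyl_integrand \<beta> f t y \<xi>)
      \<le> D * jap t ^ M * (1 / jap y ^ (2 * DIM('a)) * (1 / jap \<xi> ^ (2 * DIM('a))))"
    using weyl_op_dominated[OF assms] by blast
  have "integrable lborel (\<lambda>x::'a \<times> 'a. D * jap t ^ M * (1 / jap (fst x) ^ (2 * DIM('a)) * (1 / jap (snd x) ^ (2 * DIM('a)))))"
    by (intro integrable_mult_right integrable_jap_jap)
  then show ?thesis
  proof (rule integrable_dominated)
    show "(\<lambda>x. weyl_integrand \<beta> f t (fst x) (snd x)) \<in> borel_measurable lborel"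
      using borel_measurable_continuous_onI[OF weyl_integrand_continuous[OF assms, of "\<lambda>_. t" fst snd]]
      by (simp add: continuous_intros)
  qed (rule D(2))
qed

lemma weyl_op_growth:
  fixes f :: "'a::euclidean_space \<Rightarrow> complex"
  assumes "cutoff_symbol M \<beta>" "f \<in> schwartz"
  obtains D where "D \<ge> 0" "\<And>t. norm (weyl_op \<beta> f t) \<le> D * jap t ^ M"
proof -
  obtain D where D: "D \<ge> 0" "\<And>t y \<xi>. norm (weyl_integrand \<beta> f t y \<xi>)
      \<le> D * jap t ^ M * (1 / jap y ^ (2 * DIM('a)) * (1 / jap \<xi> ^ (2 * DIM('a))))"
    using weyl_op_dominated[OF assms] by blast
  let ?I = "LINT x|lborel. 1 / jap (fst (x::'a \<times> 'a)) ^ (2 * DIM('a)) * (1 / jap (snd x) ^ (2 * DIM('a)))"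
  show ?thesis
  proof (rule that[of "D * ?I"])
    show "0 \<le> D * ?I"
      using D(1) by (intro mult_nonneg_nonneg integral_nonneg_AE) auto
    fix t
    have "norm (weyl_op \<beta> f t) \<le> (LINT x|lborel. D * jap t ^ M * (1 / jap (fst (x::'a \<times> 'a)) ^ (2 * DIM('a)) * (1 / jap (snd x) ^ (2 * DIM('a)))))"
      unfolding weyl_op_def
      by (rule order.trans[OF integral_norm_bound])
        (intro integral_mono integrable_norm weyl_op_integrable[OF assms] integrable_mult_right integrable_jap_jap D(2))
    then show "norm (weyl_op \<beta> f t) \<le> D * ?I * jap t ^ M"
      by (simp only: integral_mult_right_zero mult_ac)
  qed
qed

lemma weyl_op_continuous:
  fixes f :: "'a::euclidean_space \<Rightarrow> complex"
  assumes "cutoff_symbol M \<beta>" "f \<in> schwartz"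
  shows "continuous_on UNIV (weyl_op \<beta> f)"
  unfolding continuous_on_sequentially
proof safe
  fix X t assume X: "X \<longlonglongrightarrow> (t :: 'a)"
  obtain D where D: "D \<ge> 0" "\<And>t y \<xi>. norm (weyl_integrand \<beta> f t y \<xi>)
      \<le> D * jap t ^ M * (1 / jap y ^ (2 * DIM('a)) * (1 / jap \<xi> ^ (2 * DIM('a))))"
    using weyl_op_dominated[OF assms] by blast
  have "Bseq X"
    using X by (intro convergent_imp_Bseq convergentI)
  then obtain R where R: "\<And>n. norm (X n) \<le> R"
    unfolding Bseq_def by blast
  have j: "jap (X n) \<le> 1 + R" for n
    using jap_le_norm[of "X n"] R[of n] by linarith
  show "(weyl_op \<beta> f \<circ> X) \<longlonglongrightarrow> weyl_op \<beta> f t"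
    unfolding weyl_op_def comp_def
  proof (rule integral_dominated_convergence)
    show "integrable lborel (\<lambda>x::'a \<times> 'a. D * (1 + R) ^ M * (1 / jap (fst x) ^ (2 * DIM('a)) * (1 / jap (snd x) ^ (2 * DIM('a)))))"
      by (intro integrable_mult_right integrable_jap_jap)
    show "AE x in lborel. norm (weyl_integrand \<beta> f (X n) (fst x) (snd x))
        \<le> D * (1 + R) ^ M * (1 / jap (fst x) ^ (2 * DIM('a)) * (1 / jap (snd x) ^ (2 * DIM('a))))" for n
    proof (rule AE_I2)
      fix x :: "'a \<times> 'a"
      have "D * jap (X n) ^ M * (1 / jap (fst x) ^ (2 * DIM('a)) * (1 / jap (snd x) ^ (2 * DIM('a))))
          \<le> D * (1 + R) ^ M * (1 / jap (fst x) ^ (2 * DIM('a)) * (1 / jap (snd x) ^ (2 * DIM('a))))"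
        using D(1) by (intro mult_right_mono mult_left_mono power_mono j) auto
      with D(2)[of "X n" "fst x" "snd x"]
      show "norm (weyl_integrand \<beta> f (X n) (fst x) (snd x))
        \<le> D * (1 + R) ^ M * (1 / jap (fst x) ^ (2 * DIM('a)) * (1 / jap (snd x) ^ (2 * DIM('a))))"
        by (rule order.trans)
    qed
    show "AE x in lborel. (\<lambda>n. weyl_integrand \<beta> f (X n) (fst x) (snd x))
        \<longlonglongrightarrow> weyl_integrand \<beta> f t (fst x) (snd x)"
    proof (rule AE_I2)
      fix x :: "'a \<times> 'a"
      have "continuous_on UNIV (\<lambda>s. weyl_integrand \<beta> f s (fst x) (snd x))"
        by (rule weyl_integrand_continuous[OF assms, of "\<lambda>s. s" "\<lambda>_. fst x" "\<lambda>_. snd x"]) (auto intro!: continuous_intros)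
      then show "(\<lambda>n. weyl_integrand \<beta> f (X n) (fst x) (snd x))
        \<longlonglongrightarrow> weyl_integrand \<beta> f t (fst x) (snd x)"
        using X unfolding continuous_on_sequentially comp_def by blast
    qed
    show "(\<lambda>x. weyl_integrand \<beta> f t (fst x) (snd x)) \<in> borel_measurable lborel"
      "(\<lambda>x. weyl_integrand \<beta> f (X n) (fst x) (snd x)) \<in> borel_measurable lborel" for n
      using weyl_op_integrable[OF assms] by (auto intro: borel_measurable_integrable)
  qed
qed

text \<open>
  The pairing of a Weyl operator with a function is the pairing of its symbol with the Wigner
  transform: with a cut-off symbol everything converges absolutely, and the substitution of
  midpoint and difference proves the formula.
\<close>

lemma weyl_op_pairing:
  fixes f h :: "'a::euclidean_space \<Rightarrow> complex"
  assumes \<beta>: "cutoff_symbol M \<beta>" and f: "f \<in> schwartz" and h: "h \<in> schwartz"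
  shows "(LINT t|lborel. weyl_op \<beta> f t * cnj (h t)) = (LINT x|lborel. \<beta> x * wigner f h x)"
proof -
  let ?n = "2 * DIM('a)"
  obtain C where C: "C \<ge> 0" "\<And>v \<xi>. norm (\<beta> (v, \<xi>)) \<le> C * jap v ^ M / jap \<xi> ^ ?n"
    using \<beta> unfolding cutoff_symbol_def by blast
  obtain D where D: "D \<ge> 0" "\<And>t y \<xi>. norm (weyl_integrand \<beta> f t y \<xi>)
      \<le> D * jap t ^ M * (1 / jap y ^ ?n * (1 / jap \<xi> ^ ?n))"
    using weyl_op_dominated[OF \<beta> f] by blast
  obtain H where H: "H \<ge> 0" "\<And>t. norm (h t) \<le> H / jap t ^ (M + ?n)"
    using schwartz_bound[OF h] by blast
  have c\<beta>: "continuous_on UNIV \<beta>"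
    using \<beta> by (simp add: cutoff_symbol_def)
  have ch: "continuous_on UNIV (\<lambda>p. cnj (h (t p)))" if "continuous_on UNIV t" for t :: "'b::topological_space \<Rightarrow> 'a"
    by (intro continuous_on_cnj continuous_on_compose2[OF schwartz_continuous[OF h] that]) auto
  define B where "B t y \<xi> = weyl_integrand \<beta> f t y \<xi> * cnj (h t)" for t y \<xi>
  have B_cont: "continuous_on UNIV (\<lambda>p. B (t p) (y p) (\<xi> p))"
    if "continuous_on UNIV t" "continuous_on UNIV y" "continuous_on UNIV \<xi>" for t y \<xi> :: "'b::topological_space \<Rightarrow> 'a"
    unfolding B_def by (intro continuous_on_mult weyl_integrand_continuous[OF \<beta> f] ch that)
  have B_le: "norm (B t y \<xi>) \<le> D * H * (1 / jap t ^ ?n * (1 / jap y ^ ?n)) * (1 / jap \<xi> ^ ?n)" for t y \<xi>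
  proof -
    have "norm (weyl_integrand \<beta> f t y \<xi>) * norm (h t)
        \<le> (D * jap t ^ M * (1 / jap y ^ ?n * (1 / jap \<xi> ^ ?n))) * (H / jap t ^ (M + ?n))"
      using D(1) by (intro mult_mono D H) auto
    also have "\<dots> = D * H * (1 / jap t ^ ?n * (1 / jap y ^ ?n)) * (1 / jap \<xi> ^ ?n)"
      by (simp add: power_add)
    finally show ?thesis
      by (simp add: B_def norm_mult)
  qed
  have B_int: "integrable (lborel \<Otimes>\<^sub>M lborel) (\<lambda>(x, \<xi>). B (fst x) (snd x) \<xi>)"
    unfolding lborel_prod
  proof (rule integrable_pair_bound[where g = "\<lambda>x. D * H * (1 / jap (fst x) ^ ?n * (1 / jap (snd x) ^ ?n))" and h = "\<lambda>\<xi>. 1 / jap \<xi> ^ ?n"])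
    have "continuous_on UNIV (\<lambda>p :: ('a \<times> 'a) \<times> 'a. B (fst (fst p)) (snd (fst p)) (snd p))"
      by (intro B_cont continuous_intros)
    then show "(\<lambda>(x, \<xi>). B (fst x) (snd x) \<xi>) \<in> borel_measurable borel"
      unfolding case_prod_beta' by (rule borel_measurable_continuous_onI)
    show "integrable lborel (\<lambda>x::'a \<times> 'a. D * H * (1 / jap (fst x) ^ ?n * (1 / jap (snd x) ^ ?n)))"
      by (intro integrable_mult_right integrable_jap_jap)
    show "integrable lborel (\<lambda>\<xi>::'a. 1 / jap \<xi> ^ ?n)"
      by (rule integrable_jap) simp
  qed (use B_le in auto)
  have By_int: "integrable (lborel \<Otimes>\<^sub>M lborel) (\<lambda>(y, \<xi>). B t y \<xi>)" for t
    unfolding lborel_prod case_prod_beta'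
    using integrable_mult_left[OF weyl_op_integrable[OF \<beta> f, of t], of "cnj (h t)"] by (simp add: B_def)
  define A where "A x = (LINT \<xi>|lborel. B (fst x) (snd x) \<xi>)" for x
  have A_int: "integrable lborel A"
    unfolding A_def[abs_def] using lborel_pair.integrable_fst[OF B_int] .
  have "(LINT t|lborel. weyl_op \<beta> f t * cnj (h t)) = (LINT t|lborel. LINT y|lborel. A (t, y))"
  proof (intro Bochner_Integration.integral_cong refl)
    fix t
    have "weyl_op \<beta> f t * cnj (h t) = (LINT x|lborel. B t (fst x) (snd x))"
      unfolding weyl_op_def B_def by (rule integral_mult_left_zero[symmetric])
    also have "\<dots> = (LINT y|lborel. LINT \<xi>|lborel. B t y \<xi>)"
      using lborel_pair.integral_fst[OF By_int[of t]] by (simp add: lborel_prod case_prod_beta')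
    finally show "weyl_op \<beta> f t * cnj (h t) = (LINT y|lborel. A (t, y))"
      by (simp add: A_def)
  qed
  also have "\<dots> = (LINT x|lborel. A x)"
    using lborel_pair.integral_fst'[of A] A_int by (simp add: lborel_prod)
  also have "\<dots> = (LINT (v, r)|lborel. A (v + (1/2) *\<^sub>R r, v - (1/2) *\<^sub>R r))"
    by (rule lborel_midpoint_substitution(2)[OF A_int])
  also have "\<dots> = (LINT v|lborel. LINT r|lborel. A (v + (1/2) *\<^sub>R r, v - (1/2) *\<^sub>R r))"
    using lborel_pair.integral_fst'[of "\<lambda>(v, r). A (v + (1/2) *\<^sub>R r, v - (1/2) *\<^sub>R r)"] lborel_midpoint_substitution(1)[OF A_int]
    by (simp add: lborel_prod)
  also have "\<dots> = (LINT v|lborel. LINT \<xi>|lborel. \<beta> (v, \<xi>) * wigner f h (v, \<xi>))"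
  proof (rule Bochner_Integration.integral_cong[OF refl])
    fix v
    let ?G = "\<lambda>r \<xi>. \<beta> (v, \<xi>) * (cis (\<xi> \<bullet> r) * wigner_window f h (v, r))"
    have AG: "A (v + (1/2) *\<^sub>R r, v - (1/2) *\<^sub>R r) = (LINT \<xi>|lborel. ?G r \<xi>)" for r
    proof -
      have 1: "(v + (1/2) *\<^sub>R r) - (v - (1/2) *\<^sub>R r) = r"
        by (simp add: algebra_simps) (simp flip: scaleR_left_distrib)
      have 2: "(1/2) *\<^sub>R ((v + (1/2) *\<^sub>R r) + (v - (1/2) *\<^sub>R r)) = v"
        by (simp add: algebra_simps) (simp flip: scaleR_left_distrib)
      show ?thesis
        unfolding A_def B_def weyl_integrand_def fst_conv snd_conv 1 2
        by (intro Bochner_Integration.integral_cong) (auto simp: wigner_window_def inner_commute mult_ac)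
    qed
    obtain E where E: "E \<ge> 0" "\<And>v r. norm (wigner_window f h (v, r)) \<le> E / (jap v ^ 0 * jap r ^ ?n)"
      using schwartz_fst_snd_bound[OF wigner_window_schwartz[OF f h]] by blast
    have "integrable (lborel \<Otimes>\<^sub>M lborel) (\<lambda>(r, \<xi>). ?G r \<xi>)"
      unfolding lborel_prod
    proof (rule integrable_pair_bound[where g = "\<lambda>r. E * (1 / jap r ^ ?n)" and h = "\<lambda>\<xi>. C * jap v ^ M * (1 / jap \<xi> ^ ?n)"])
      have "continuous_on UNIV (\<lambda>p::'a \<times> 'a. ?G (fst p) (snd p))"
        by (intro continuous_on_mult continuous_intros continuous_on_compose2[OF c\<beta>]
            continuous_on_compose2[OF schwartz_continuous[OF wigner_window_schwartz[OF f h]]]) auto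
      then show "(\<lambda>(r, \<xi>). ?G r \<xi>) \<in> borel_measurable borel"
        unfolding case_prod_beta' by (rule borel_measurable_continuous_onI)
      show "integrable lborel (\<lambda>r::'a. E * (1 / jap r ^ ?n))" "integrable lborel (\<lambda>\<xi>::'a. C * jap v ^ M * (1 / jap \<xi> ^ ?n))"
        by (intro integrable_mult_right integrable_jap; simp)+
      fix r \<xi> :: 'a
      have "norm (wigner_window f h (v, r)) * norm (\<beta> (v, \<xi>)) \<le> (E / (jap v ^ 0 * jap r ^ ?n)) * (C * jap v ^ M / jap \<xi> ^ ?n)"
        using E(1) by (intro mult_mono E C) auto
      then show "norm (case (r, \<xi>) of (r, \<xi>) \<Rightarrow> ?G r \<xi>) \<le> E * (1 / jap r ^ ?n) * (C * jap v ^ M * (1 / jap \<xi> ^ ?n))"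
        by (simp add: norm_mult mult_ac)
    qed
    then have "(LINT r|lborel. LINT \<xi>|lborel. ?G r \<xi>) = (LINT \<xi>|lborel. LINT r|lborel. ?G r \<xi>)"
      by (rule lborel_pair.Fubini_integral[symmetric])
    then show "(LINT r|lborel. A (v + (1/2) *\<^sub>R r, v - (1/2) *\<^sub>R r)) = (LINT \<xi>|lborel. \<beta> (v, \<xi>) * wigner f h (v, \<xi>))"
      by (simp add: AG wigner_def partial_fourier_def)
  qed
  also have "\<dots> = (LINT x|lborel. \<beta> x * wigner f h x)"
  proof -
    obtain E where E: "E \<ge> 0" "\<And>v \<xi>. norm (wigner f h (v, \<xi>)) \<le> E / (jap v ^ (M + ?n) * jap \<xi> ^ 0)"
      using schwartz_fst_snd_bound[OF wigner_schwartz[OF f h]] by blast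
    have "integrable lborel (\<lambda>x. \<beta> x * wigner f h x)"
    proof (rule integrable_pair_bound[where g = "\<lambda>v. C * E * (1 / jap v ^ ?n)" and h = "\<lambda>\<xi>. 1 / jap \<xi> ^ ?n"])
      show "(\<lambda>x. \<beta> x * wigner f h x) \<in> borel_measurable borel"
        by (intro borel_measurable_continuous_onI continuous_on_mult c\<beta> schwartz_continuous wigner_schwartz f h)
      show "integrable lborel (\<lambda>v::'a. C * E * (1 / jap v ^ ?n))" "integrable lborel (\<lambda>\<xi>::'a. 1 / jap \<xi> ^ ?n)"
        by (intro integrable_mult_right integrable_jap; simp)+
      fix v \<xi> :: 'a
      have "norm (\<beta> (v, \<xi>)) * norm (wigner f h (v, \<xi>)) \<le> (C * jap v ^ M / jap \<xi> ^ ?n) * (E / (jap v ^ (M + ?n) * jap \<xi> ^ 0))"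
        using C(1) by (intro mult_mono E C) auto
      then show "norm (\<beta> (v, \<xi>) * wigner f h (v, \<xi>)) \<le> C * E * (1 / jap v ^ ?n) * (1 / jap \<xi> ^ ?n)"
        by (simp add: norm_mult power_add mult_ac)
    qed
    then show ?thesis
      using lborel_pair.integral_fst'[of "\<lambda>x. \<beta> x * wigner f h x"] by (simp add: lborel_prod)
  qed
  finally show ?thesis .
qed

definition window_mass :: "('a::euclidean_space \<Rightarrow> complex) \<Rightarrow> real"
  where "window_mass \<phi> = (LINT x|lborel. (norm (\<phi> x))\<^sup>2)"

lemma weyl_kernel_product_decay:
  fixes b :: "'i \<Rightarrow> 'a::euclidean_space \<times> 'a \<Rightarrow> complex"
  assumes "dbounded (\<lambda>(_::unit) _ x. jap x ^ M) b" and "\<phi> \<in> schwartz"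
  obtains C where "C \<ge> 0" "\<And>i z p q. norm (weyl_kernel \<phi> (b i) z (p, q))
    \<le> C * jap z ^ M * (1 / jap (p - fst z) ^ (2 * DIM('a)) * (1 / jap (q - snd z) ^ (2 * DIM('a))))"
proof -
  let ?n = "2 * DIM('a)"
  obtain C where C: "C \<ge> 0" "\<And>i z w. norm (weyl_kernel \<phi> (b i) z w) \<le> C * jap z ^ M / jap (z - w) ^ (?n + ?n)"
    using weyl_kernel_decay[OF assms] by blast
  show ?thesis
  proof (rule that[OF C(1)])
    fix i z and p q :: 'a
    have "jap (p - fst z) \<le> jap (z - (p, q))" "jap (q - snd z) \<le> jap (z - (p, q))"
      using jap_fst_le[of "z - (p, q)"] jap_snd_le[of "z - (p, q)"] by (simp_all add: jap_commute)
    then have "jap (p - fst z) ^ ?n * jap (q - snd z) ^ ?n \<le> jap (z - (p, q)) ^ (?n + ?n)"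
      unfolding power_add by (intro mult_mono power_mono) auto
    then have "C * jap z ^ M / jap (z - (p, q)) ^ (?n + ?n) \<le> C * jap z ^ M / (jap (p - fst z) ^ ?n * jap (q - snd z) ^ ?n)"
      using C(1) by (intro divide_left_mono mult_pos_pos zero_less_power mult_nonneg_nonneg) auto
    then show "norm (weyl_kernel \<phi> (b i) z (p, q)) \<le> C * jap z ^ M * (1 / jap (p - fst z) ^ ?n * (1 / jap (q - snd z) ^ ?n))"
      using C(2)[of i z "(p, q)"] by simp
  qed
qed

text \<open>
  For fixed \<open>p\<close> the Weyl kernel at \<open>(p, q)\<close> is, as a function of \<open>q\<close>, the Fourier transform of the
  output of the operator times a translate of the conjugate window.  Fourier inversion, followed
  by integration over \<open>p\<close> against the same translate of the window, recovers the output.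
\<close>

lemma weyl_op_reproducing:
  fixes \<phi> :: "'a::euclidean_space \<Rightarrow> complex"
  assumes \<beta>: "cutoff_symbol M \<beta>" and db: "dbounded (\<lambda>(_::unit) (_::unit) x. jap x ^ M) (\<lambda>_. \<beta>)"
    and \<phi>: "\<phi> \<in> schwartz"
  shows "(LINT w|lborel. weyl_kernel \<phi> \<beta> z w * tf_shift w \<phi> t)
    = of_real ((gauss_mass TYPE('a))\<^sup>2 * window_mass \<phi>) * weyl_op \<beta> (tf_shift z \<phi>) t"
proof -
  let ?n = "2 * DIM('a)" and ?c = "complex_of_real ((gauss_mass TYPE('a))\<^sup>2)"
  define g where "g = weyl_op \<beta> (tf_shift z \<phi>)"
  define K where "K = weyl_kernel \<phi> \<beta> z"
  have f: "tf_shift z \<phi> \<in> schwartz"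
    by (rule tf_shift_schwartz[OF \<phi>])
  have "\<beta> \<in> borel_measurable borel"
    using \<beta> unfolding cutoff_symbol_def by (intro borel_measurable_continuous_onI) auto
  then have Km[measurable]: "K \<in> borel_measurable borel"
    unfolding K_def by (rule weyl_kernel_measurable[OF _ \<phi>])
  obtain C where C0: "C \<ge> 0" and C': "\<And>(i::unit) z p q. norm (weyl_kernel \<phi> \<beta> z (p, q))
      \<le> C * jap z ^ M * (1 / jap (p - fst z) ^ ?n * (1 / jap (q - snd z) ^ ?n))"
    by (rule weyl_kernel_product_decay[OF db \<phi>]) (rule that)
  have C: "norm (K (p, q)) \<le> C * jap z ^ M * (1 / jap (p - fst z) ^ ?n * (1 / jap (q - snd z) ^ ?n))" for p q
    unfolding K_def by (rule C')
  obtain G where G: "G \<ge> 0" "\<And>t. norm (g t) \<le> G * jap t ^ M"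
    using weyl_op_growth[OF \<beta> f] unfolding g_def by blast
  obtain P where P: "P \<ge> 0" "\<And>x. norm (\<phi> x) \<le> P / jap x ^ (M + ?n)"
    using schwartz_bound[OF \<phi>] by blast
  have g_cont: "continuous_on UNIV g"
    unfolding g_def by (rule weyl_op_continuous[OF \<beta> f])
  have inversion: "(LINT q|lborel. cis (q \<bullet> t) * K (p, q)) = ?c * (g t * cnj (\<phi> (t - p)))" for p t
  proof -
    let ?h = "\<lambda>t. g t * cnj (\<phi> (t - p))"
    have "continuous_on UNIV (\<lambda>t. \<phi> (t - p))"
      by (rule continuous_on_compose2[OF schwartz_continuous[OF \<phi>]]) (auto intro!: continuous_intros)
    then have h_cont: "continuous_on UNIV ?h"
      by (intro continuous_on_mult g_cont continuous_on_cnj)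
    have h_le: "norm (?h t) \<le> G * P * 2 ^ (M + ?n) * jap p ^ (M + ?n) * (1 / jap t ^ ?n)" for t
    proof -
      have "norm (\<phi> (t - p)) \<le> P * (1 / jap (t - p) ^ (M + ?n))"
        using P(2)[of "t - p"] by simp
      also have "\<dots> \<le> P * (2 ^ (M + ?n) * jap p ^ (M + ?n) / jap t ^ (M + ?n))"
        by (intro mult_left_mono inverse_jap_shift P)
      finally have "norm (?h t) \<le> (G * jap t ^ M) * (P * (2 ^ (M + ?n) * jap p ^ (M + ?n) / jap t ^ (M + ?n)))"
        unfolding norm_mult complex_mod_cnj using G by (intro mult_mono) auto
      then show ?thesis
        by (simp add: power_add mult_ac)
    qed
    have h_int: "integrable lborel ?h"
    proof (rule integrable_dominated)
      show "integrable lborel (\<lambda>t::'a. G * P * 2 ^ (M + ?n) * jap p ^ (M + ?n) * (1 / jap t ^ ?n))"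
        by (intro integrable_mult_right integrable_jap) simp
      show "?h \<in> borel_measurable lborel"
        using borel_measurable_continuous_onI[OF h_cont] by simp
    qed (rule h_le)
    have h_bdd: "norm (?h t) \<le> G * P * 2 ^ (M + ?n) * jap p ^ (M + ?n)" for t
    proof -
      have "G * P * 2 ^ (M + ?n) * jap p ^ (M + ?n) * (1 / jap t ^ ?n) \<le> G * P * 2 ^ (M + ?n) * jap p ^ (M + ?n) * 1"
        using G(1) P(1) by (intro mult_left_mono inverse_jap_power_le_1) auto
      with h_le[of t] show ?thesis by linarith
    qed
    have fourier: "(LINT t|lborel. cis (- (q \<bullet> t)) * ?h t) = K (p, q)" for q
    proof -
      have "K (p, q) = (LINT t|lborel. g t * cnj (tf_shift (p, q) \<phi> t))"
        unfolding K_def weyl_kernel_def g_def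
        by (rule weyl_op_pairing[OF \<beta> f tf_shift_schwartz[OF \<phi>], symmetric])
      also have "\<dots> = (LINT t|lborel. cis (- (q \<bullet> t)) * ?h t)"
        by (intro Bochner_Integration.integral_cong) (auto simp: tf_shift_def cis_cnj inner_commute mult_ac)
      finally show ?thesis by simp
    qed
    have K_int: "integrable lborel (\<lambda>q. K (p, q))"
    proof (rule integrable_dominated)
      show "integrable lborel (\<lambda>q. C * jap z ^ M * (1 / jap (p - fst z) ^ ?n) * (1 / jap (q - snd z) ^ ?n))"
        by (intro integrable_mult_right integrable_jap_shift(1)) simp
      have "(\<lambda>q::'a. (p, q)) \<in> borel_measurable borel"
        by (intro borel_measurable_continuous_onI continuous_intros)
      from measurable_compose[OF this Km] show "(\<lambda>q. K (p, q)) \<in> borel_measurable lborel"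
        by simp
      show "norm (K (p, q)) \<le> C * jap z ^ M * (1 / jap (p - fst z) ^ ?n) * (1 / jap (q - snd z) ^ ?n)" for q
        using C[of p q] by (simp only: mult.assoc)
    qed
    show ?thesis
      using fourier_inversion[OF h_cont h_bdd h_int, of t] K_int by (simp only: fourier)
  qed
  have "integrable lborel (\<lambda>w. K w * tf_shift w \<phi> t)"
  proof (rule integrable_pair_bound[where g = "\<lambda>p. C * jap z ^ M * P * (1 / jap (p - fst z) ^ ?n)" and h = "\<lambda>q. 1 / jap (q - snd z) ^ ?n"])
    have "(\<lambda>w. tf_shift w \<phi> t) \<in> borel_measurable borel"
      by (intro borel_measurable_continuous_onI tf_family_continuous tf_family.shift \<phi>)
    then show "(\<lambda>w. K w * tf_shift w \<phi> t) \<in> borel_measurable borel"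
      by measurable
    show "integrable lborel (\<lambda>p. C * jap z ^ M * P * (1 / jap (p - fst z) ^ ?n))" "integrable lborel (\<lambda>q. 1 / jap (q - snd z) ^ ?n)"
      by (intro integrable_mult_right integrable_jap_shift(1); simp)+
    fix p q
    have "norm (\<phi> (t - p)) \<le> P"
      using P(2)[of "t - p"] mult_left_mono[OF inverse_jap_power_le_1[of "t - p" "M + ?n"] P(1)] by simp
    then have "norm (K (p, q)) * norm (\<phi> (t - p)) \<le> (C * jap z ^ M * (1 / jap (p - fst z) ^ ?n * (1 / jap (q - snd z) ^ ?n))) * P"
      using C0 by (intro mult_mono C) auto
    then show "norm (K (p, q) * tf_shift (p, q) \<phi> t) \<le> C * jap z ^ M * P * (1 / jap (p - fst z) ^ ?n) * (1 / jap (q - snd z) ^ ?n)"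
      by (simp add: norm_mult tf_shift_def mult_ac)
  qed
  then have "(LINT w|lborel. K w * tf_shift w \<phi> t) = (LINT p|lborel. LINT q|lborel. K (p, q) * tf_shift (p, q) \<phi> t)"
    using lborel_pair.integral_fst'[of "\<lambda>w. K w * tf_shift w \<phi> t"] by (simp add: lborel_prod)
  also have "\<dots> = (LINT p|lborel. ?c * g t * of_real ((norm (\<phi> (t + (-1) *\<^sub>R p)))\<^sup>2))"
  proof (rule Bochner_Integration.integral_cong[OF refl])
    fix p
    have "(LINT q|lborel. K (p, q) * tf_shift (p, q) \<phi> t) = (LINT q|lborel. (cis (q \<bullet> t) * K (p, q)) * \<phi> (t - p))"
      by (intro Bochner_Integration.integral_cong) (auto simp: tf_shift_def inner_commute mult_ac)
    also have "\<dots> = ?c * (g t * cnj (\<phi> (t - p))) * \<phi> (t - p)"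
      by (simp only: integral_mult_left_zero inversion)
    also have "\<dots> = ?c * g t * (\<phi> (t - p) * cnj (\<phi> (t - p)))"
      by (simp only: mult_ac)
    also have "\<phi> (t - p) * cnj (\<phi> (t - p)) = of_real ((norm (\<phi> (t + (-1) *\<^sub>R p)))\<^sup>2)"
    proof -
      have "t + (-1) *\<^sub>R p = t - p" by simp
      then show ?thesis by (simp only: complex_norm_square)
    qed
    finally show "(LINT q|lborel. K (p, q) * tf_shift (p, q) \<phi> t) = ?c * g t * of_real ((norm (\<phi> (t + (-1) *\<^sub>R p)))\<^sup>2)" .
  qed
  also have "\<dots> = ?c * g t * (LINT p|lborel. of_real ((norm (\<phi> (t + (-1) *\<^sub>R p)))\<^sup>2))"
    by (rule integral_mult_right_zero)
  also have "(LINT p|lborel. complex_of_real ((norm (\<phi> (t + (-1) *\<^sub>R p)))\<^sup>2)) = (LINT x|lborel. complex_of_real ((norm (\<phi> x))\<^sup>2))"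
    using lborel_integral_affine[of "-1" "\<lambda>x. complex_of_real ((norm (\<phi> x))\<^sup>2)" t] schwartz_measurable[OF \<phi>] by simp
  also have "\<dots> = of_real (window_mass \<phi>)"
    by (simp only: window_mass_def integral_complex_of_real)
  finally show ?thesis
    by (simp add: K_def g_def mult_ac)
qed

lemma window_mass_pos:
  fixes \<phi> :: "'a::euclidean_space \<Rightarrow> complex"
  assumes \<phi>: "\<phi> \<in> schwartz" and nz: "\<phi> x0 \<noteq> 0"
  shows "0 < window_mass \<phi>"
proof -
  have cont: "continuous_on UNIV \<phi>"
    by (rule schwartz_continuous[OF \<phi>])
  have [measurable]: "\<phi> \<in> borel_measurable borel"
    by (rule schwartz_measurable[OF \<phi>])
  obtain B where B: "B \<ge> 0" "\<And>x. norm (\<phi> x) \<le> B"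
    using schwartz_bounded[OF \<phi>] by blast
  have int: "integrable lborel (\<lambda>x. (norm (\<phi> x))\<^sup>2)"
  proof (rule integrable_dominated)
    show "integrable lborel (\<lambda>x. B * norm (\<phi> x))"
      by (intro integrable_mult_right integrable_norm schwartz_integrable \<phi>)
    show "norm ((norm (\<phi> x))\<^sup>2) \<le> B * norm (\<phi> x)" for x
      using mult_right_mono[OF B(2)[of x], of "norm (\<phi> x)"] by (simp add: power2_eq_square)
  qed auto
  have "window_mass \<phi> \<noteq> 0"
  proof
    assume "window_mass \<phi> = 0"
    then have "AE x in lborel. (norm (\<phi> x))\<^sup>2 = 0"
      unfolding window_mass_def using int by (subst (asm) integral_nonneg_eq_0_iff_AE) auto
    then have "AE x in lborel. \<phi> x = 0" by simp
    then have "{x. \<phi> x \<noteq> 0} \<in> null_sets lborel"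
      by (subst (asm) AE_iff_null) auto
    then have "negligible {x. \<phi> x \<noteq> 0}"
      using negligible_iff_null_sets null_sets_completionI by blast
    moreover have "open {x. \<phi> x \<noteq> 0}"
      by (intro open_Collect_neq cont continuous_intros)
    ultimately show False
      using open_not_negligible nz by blast
  qed
  moreover have "0 \<le> window_mass \<phi>"
    unfolding window_mass_def by (intro integral_nonneg_AE) auto
  ultimately show ?thesis by simp
qed


subsection \<open>Removal of the cut-off\<close>

lemma cutoff_family_dbounded:
  fixes b :: "'a::euclidean_space \<times> 'a \<Rightarrow> complex"
  assumes b: "dbounded (\<lambda>(_::unit) (_::unit) x. jap x ^ M) (\<lambda>_. b)" and \<theta>: "\<theta> \<in> schwartz"
    and X: "\<And>n. \<bar>X n\<bar> \<le> R"
  shows "dbounded (\<lambda>(_::unit) (_::nat) x. jap x ^ M) (\<lambda>n x. \<theta> (X n *\<^sub>R snd x) * b x)"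
proof -
  have "dbounded (\<lambda>k (_::nat) x. 1 / jap x ^ k) (\<lambda>_. \<theta>)"
    using \<theta> unfolding schwartz_iff_dbounded dbounded_def by simp
  then have "dbounded (\<lambda>(_::unit) (_::nat) (_::'a \<times> 'a). 1) (\<lambda>n x. \<theta> (X n *\<^sub>R snd x + 0))"
  proof (rule dbounded_affine[where A = "\<lambda>n x. X n *\<^sub>R snd x" and D = R])
    show "linear (\<lambda>x. X n *\<^sub>R snd x)" for n
      by (auto simp: linear_iff algebra_simps)
    show "norm (X n *\<^sub>R snd e) \<le> R" if "e \<in> Basis" for n and e :: "'a \<times> 'a"
      using that X[of n] order.trans[OF abs_ge_zero X[of n]] by (auto simp: Basis_prod_def)
    show "\<exists>k1. \<exists>C\<ge>0. \<forall>n x. 1 / jap (X n *\<^sub>R snd x + 0) ^ k1 \<le> C * 1" for k :: unit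
      by (intro exI[of _ 0] exI[of _ 1]) auto
  qed
  then have 1: "dbounded (\<lambda>(_::unit) (_::nat) (_::'a \<times> 'a). 1) (\<lambda>n x. \<theta> (X n *\<^sub>R snd x))"
    by simp
  have 2: "dbounded (\<lambda>(_::unit) (_::nat) x. jap x ^ M) (\<lambda>_. b)"
    using b unfolding dbounded_def by simp
  show ?thesis
    by (rule dbounded_mult[OF 1 2]) (auto intro: exI[of _ 1])
qed

lemma cutoff_symbol_mult:
  fixes b :: "'a::euclidean_space \<times> 'a \<Rightarrow> complex"
  assumes b: "dbounded (\<lambda>(_::unit) (_::unit) x. jap x ^ M) (\<lambda>_. b)" and \<theta>: "\<theta> \<in> schwartz" and \<epsilon>: "\<epsilon> > 0"
  shows "cutoff_symbol M (\<lambda>x. \<theta> (\<epsilon> *\<^sub>R snd x) * b x)"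
  unfolding cutoff_symbol_def
proof
  show "continuous_on UNIV (\<lambda>x. \<theta> (\<epsilon> *\<^sub>R snd x) * b x)"
  proof (rule continuous_on_mult[OF _ smooth_continuous[OF dbounded_smooth[OF b]]])
    show "continuous_on UNIV (\<lambda>x :: 'a \<times> 'a. \<theta> (\<epsilon> *\<^sub>R snd x))"
      by (rule continuous_on_compose2[OF schwartz_continuous[OF \<theta>]]) (auto intro!: continuous_intros)
  qed
  let ?n = "2 * DIM('a)"
  define S where "S = max 1 (1 / \<epsilon>)"
  have S1: "1 \<le> S" and S\<epsilon>: "1 \<le> S * \<epsilon>"
    using \<epsilon> by (simp_all add: S_def max_def field_simps)
  obtain C where C: "C \<ge> 0" "\<And>x. norm (b x) \<le> C * jap x ^ M"
    by (rule dbounded_bound0[OF b]) (rule that)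
  obtain T where T: "T \<ge> 0" "\<And>x. norm (\<theta> x) \<le> T / jap x ^ (M + ?n)"
    using schwartz_bound[OF \<theta>] by blast
  have s: "jap \<xi> \<le> S * jap (\<epsilon> *\<^sub>R \<xi>)" for \<xi> :: 'a
  proof (rule power2_le_imp_le)
    have "1 * (norm \<xi>)\<^sup>2 \<le> (S * \<epsilon>)\<^sup>2 * (norm \<xi>)\<^sup>2"
      by (rule mult_right_mono[OF one_le_power[OF S\<epsilon>]]) simp
    moreover have "1 \<le> S\<^sup>2"
      by (rule one_le_power[OF S1])
    ultimately show "(jap \<xi>)\<^sup>2 \<le> (S * jap (\<epsilon> *\<^sub>R \<xi>))\<^sup>2"
    proof -
      have "(S * jap (\<epsilon> *\<^sub>R \<xi>))\<^sup>2 = S\<^sup>2 + (S * \<epsilon>)\<^sup>2 * (norm \<xi>)\<^sup>2"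
        by (simp add: power_mult_distrib jap_sq distrib_left)
      moreover have "(jap \<xi>)\<^sup>2 = 1 + (norm \<xi>)\<^sup>2"
        by (rule jap_sq)
      ultimately show ?thesis
        using \<open>1 * (norm \<xi>)\<^sup>2 \<le> (S * \<epsilon>)\<^sup>2 * (norm \<xi>)\<^sup>2\<close> \<open>1 \<le> S\<^sup>2\<close> by linarith
    qed
  qed (use S1 in simp)
  have "norm (\<theta> (\<epsilon> *\<^sub>R \<xi>) * b (v, \<xi>)) \<le> (T * S ^ (M + ?n) * C) * jap v ^ M / jap \<xi> ^ ?n" for v \<xi>
  proof -
    have "jap \<xi> ^ (M + ?n) \<le> (S * jap (\<epsilon> *\<^sub>R \<xi>)) ^ (M + ?n)"
      by (rule power_mono[OF s]) simp
    then have "1 / jap (\<epsilon> *\<^sub>R \<xi>) ^ (M + ?n) \<le> S ^ (M + ?n) / jap \<xi> ^ (M + ?n)"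
      unfolding power_mult_distrib by (simp add: divide_simps mult.commute)
    from mult_left_mono[OF this T(1)] have 1: "norm (\<theta> (\<epsilon> *\<^sub>R \<xi>)) \<le> T * (S ^ (M + ?n) / jap \<xi> ^ (M + ?n))"
      using T(2)[of "\<epsilon> *\<^sub>R \<xi>"] by simp
    have 2: "norm (b (v, \<xi>)) \<le> C * (jap v * jap \<xi>) ^ M"
      using C(1) by (intro order.trans[OF C(2)] mult_left_mono power_mono jap_Pair_le) auto
    have "norm (\<theta> (\<epsilon> *\<^sub>R \<xi>)) * norm (b (v, \<xi>)) \<le> (T * (S ^ (M + ?n) / jap \<xi> ^ (M + ?n))) * (C * (jap v * jap \<xi>) ^ M)"
      using T(1) S1 by (intro mult_mono 1 2) auto
    also have "\<dots> = (T * S ^ (M + ?n) * C) * jap v ^ M / jap \<xi> ^ ?n"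
      by (simp add: power_add power_mult_distrib mult_ac)
    finally show ?thesis by (simp add: norm_mult)
  qed
  then show "\<exists>C\<ge>0. \<forall>v \<xi>. norm (\<theta> (\<epsilon> *\<^sub>R snd (v, \<xi>)) * b (v, \<xi>)) \<le> C * jap v ^ M / jap \<xi> ^ ?n"
    using T(1) C(1) by (intro exI[of _ "T * S ^ (M + ?n) * C"] conjI allI) (use S1 in auto)
qed

text \<open>
  The kernels of the truncated symbols converge pointwise and satisfy the decay bound uniformly,
  so that dominated convergence applies twice.
\<close>

lemma cutoff_limit:
  fixes b :: "'a::euclidean_space \<times> 'a \<Rightarrow> complex"
  assumes b: "dbounded (\<lambda>(_::unit) (_::unit) x. jap x ^ M) (\<lambda>_. b)" and \<phi>: "\<phi> \<in> schwartz"
    and \<theta>: "\<theta> \<in> schwartz" "\<theta> 0 = 1"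
  shows "((\<lambda>\<epsilon>. LINT w|lborel. weyl_kernel \<phi> (\<lambda>x. \<theta> (\<epsilon> *\<^sub>R snd x) * b x) z w * tf_shift w \<phi> t)
    \<longlongrightarrow> (LINT w|lborel. weyl_kernel \<phi> b z w * tf_shift w \<phi> t)) (at_right 0)"
  unfolding tendsto_at_iff_sequentially
proof (intro allI impI)
  fix X :: "nat \<Rightarrow> real" assume "\<forall>n. X n \<in> {0<..} - {0}" and X: "X \<longlonglongrightarrow> 0"
  have "Bseq X"
    using X by (intro convergent_imp_Bseq convergentI)
  then obtain R where R: "\<And>n. \<bar>X n\<bar> \<le> R"
    unfolding Bseq_def by auto
  let ?\<beta> = "\<lambda>n x. \<theta> (X n *\<^sub>R snd x) * b x"
  have db: "dbounded (\<lambda>(_::unit) (_::nat) x. jap x ^ M) ?\<beta>"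
    by (rule cutoff_family_dbounded[OF b \<theta>(1) R])
  have bm[measurable]: "b \<in> borel_measurable borel" "?\<beta> n \<in> borel_measurable borel" for n
    using smooth_measurable[OF dbounded_smooth[OF b]] smooth_measurable[OF dbounded_smooth[OF db]] by auto
  obtain B where B: "B \<ge> 0" "\<And>n x. norm (?\<beta> n x) \<le> B * jap x ^ M"
    by (rule dbounded_bound0[OF db]) (rule that)
  have \<theta>_lim: "(\<lambda>n. ?\<beta> n x) \<longlonglongrightarrow> b x" for x
  proof -
    have "(\<lambda>n. X n *\<^sub>R snd x) \<longlonglongrightarrow> 0 *\<^sub>R snd x"
      by (intro tendsto_intros X)
    moreover have "isCont \<theta> (0 *\<^sub>R snd x)"
      using schwartz_continuous[OF \<theta>(1)] by (simp add: continuous_on_eq_continuous_at)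
    ultimately have "(\<lambda>n. \<theta> (X n *\<^sub>R snd x)) \<longlonglongrightarrow> \<theta> (0 *\<^sub>R snd x)"
      by (rule isCont_tendsto_compose[rotated])
    then show ?thesis
      using tendsto_mult_right[of "\<lambda>n. \<theta> (X n *\<^sub>R snd x)" 1 sequentially "b x"] \<theta>(2) by simp
  qed
  have kernel_lim: "(\<lambda>n. weyl_kernel \<phi> (?\<beta> n) z w) \<longlonglongrightarrow> weyl_kernel \<phi> b z w" for w
  proof -
    let ?W = "wigner (tf_shift z \<phi>) (tf_shift w \<phi>)"
    have W: "?W \<in> schwartz"
      by (intro wigner_schwartz tf_shift_schwartz \<phi>)
    have [measurable]: "?W \<in> borel_measurable borel"
      by (rule schwartz_measurable[OF W])
    obtain D where D: "D \<ge> 0" "\<And>x. norm (?W x) \<le> D / jap x ^ (M + 2 * DIM('a \<times> 'a))"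
      using schwartz_bound[OF W] by blast
    show ?thesis
      unfolding weyl_kernel_def
    proof (rule integral_dominated_convergence)
      show "integrable lborel (\<lambda>x::'a \<times> 'a. B * D * (1 / jap x ^ (2 * DIM('a \<times> 'a))))"
        by (intro integrable_mult_right integrable_jap) simp
      show "AE x in lborel. (\<lambda>n. ?\<beta> n x * ?W x) \<longlonglongrightarrow> b x * ?W x"
        by (intro AE_I2 tendsto_mult_right \<theta>_lim)
      show "AE x in lborel. norm (?\<beta> n x * ?W x) \<le> B * D * (1 / jap x ^ (2 * DIM('a \<times> 'a)))" for n
      proof (rule AE_I2)
        fix x :: "'a \<times> 'a"
        have "norm (?\<beta> n x) * norm (?W x) \<le> (B * jap x ^ M) * (D / jap x ^ (M + 2 * DIM('a \<times> 'a)))"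
          using B(1) by (intro mult_mono B D) auto
        then show "norm (?\<beta> n x * ?W x) \<le> B * D * (1 / jap x ^ (2 * DIM('a \<times> 'a)))"
          unfolding norm_mult[of "?\<beta> n x"] by (simp add: power_add)
      qed
    qed measurable
  qed
  obtain C where C: "C \<ge> 0" "\<And>n w. norm (weyl_kernel \<phi> (?\<beta> n) z w) \<le> C * jap z ^ M / jap (z - w) ^ (2 * DIM('a \<times> 'a))"
    by (rule weyl_kernel_decay[OF db \<phi>]) (rule that)
  obtain P where P: "P \<ge> 0" "\<And>x. norm (\<phi> x) \<le> P"
    using schwartz_bounded[OF \<phi>] by blast
  have [measurable]: "weyl_kernel \<phi> b z \<in> borel_measurable borel" "weyl_kernel \<phi> (?\<beta> n) z \<in> borel_measurable borel" for n
    by (intro weyl_kernel_measurable bm \<phi>)+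
  have [measurable]: "(\<lambda>w. tf_shift w \<phi> t) \<in> borel_measurable borel"
    by (intro borel_measurable_continuous_onI tf_family_continuous tf_family.shift \<phi>)
  have "(\<lambda>n. LINT w|lborel. weyl_kernel \<phi> (?\<beta> n) z w * tf_shift w \<phi> t)
      \<longlonglongrightarrow> (LINT w|lborel. weyl_kernel \<phi> b z w * tf_shift w \<phi> t)"
  proof (rule integral_dominated_convergence)
    show "integrable lborel (\<lambda>w. C * jap z ^ M * P * (1 / jap (w - z) ^ (2 * DIM('a \<times> 'a))))"
      by (intro integrable_mult_right integrable_jap_shift(1)) simp
    show "AE w in lborel. (\<lambda>n. weyl_kernel \<phi> (?\<beta> n) z w * tf_shift w \<phi> t) \<longlonglongrightarrow> weyl_kernel \<phi> b z w * tf_shift w \<phi> t"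
      by (intro AE_I2 tendsto_mult_right kernel_lim)
    show "AE w in lborel. norm (weyl_kernel \<phi> (?\<beta> n) z w * tf_shift w \<phi> t)
        \<le> C * jap z ^ M * P * (1 / jap (w - z) ^ (2 * DIM('a \<times> 'a)))" for n
    proof (rule AE_I2)
      fix w
      have "norm (tf_shift w \<phi> t) \<le> P"
        using P(2) by (simp add: tf_shift_def)
      then have "norm (weyl_kernel \<phi> (?\<beta> n) z w) * norm (tf_shift w \<phi> t)
          \<le> (C * jap z ^ M / jap (z - w) ^ (2 * DIM('a \<times> 'a))) * P"
        using C(1) by (intro mult_mono C) auto
      then show "norm (weyl_kernel \<phi> (?\<beta> n) z w * tf_shift w \<phi> t)
          \<le> C * jap z ^ M * P * (1 / jap (w - z) ^ (2 * DIM('a \<times> 'a)))"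
        by (simp add: norm_mult jap_commute[of w z])
    qed
  qed measurable
  then show "((\<lambda>\<epsilon>. LINT w|lborel. weyl_kernel \<phi> (\<lambda>x. \<theta> (\<epsilon> *\<^sub>R snd x) * b x) z w * tf_shift w \<phi> t) \<circ> X)
      \<longlonglongrightarrow> (LINT w|lborel. weyl_kernel \<phi> b z w * tf_shift w \<phi> t)"
    by (simp add: comp_def)
qed

theorem weyl_tf_shift:
  fixes b :: "'a::euclidean_space \<times> 'a \<Rightarrow> complex"
  assumes b: "dbounded (\<lambda>(_::unit) (_::unit) x. jap x ^ M) (\<lambda>_. b)"
    and \<phi>: "\<phi> \<in> schwartz" and nz: "\<phi> \<noteq> (\<lambda>_. 0)"
  obtains \<kappa> where "\<And>z. weyl b (tf_shift z \<phi>) = (\<lambda>t. \<kappa> * (LINT w|lborel. weyl_kernel \<phi> b z w * tf_shift w \<phi> t))"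
proof -
  obtain x0 where x0: "\<phi> x0 \<noteq> 0"
    using nz by blast
  let ?c = "complex_of_real ((gauss_mass TYPE('a))\<^sup>2 * window_mass \<phi>)"
  have c: "?c \<noteq> 0"
    using gauss_mass_pos[where 'a = 'a] window_mass_pos[OF \<phi> x0] by simp
  let ?L = "\<lambda>z t. LINT w|lborel. weyl_kernel \<phi> b z w * tf_shift w \<phi> t"
  have "osc_integral (\<lambda>(y, \<xi>). cis ((t - y) \<bullet> \<xi>) * b ((1 / 2) *\<^sub>R (t + y), \<xi>) * tf_shift z \<phi> y) = ?L z t / ?c" for t z
  proof -
    let ?F = "\<lambda>(y, \<xi>). cis ((t - y) \<bullet> \<xi>) * b ((1 / 2) *\<^sub>R (t + y), \<xi>) * tf_shift z \<phi> y"
    have lim: "((\<lambda>\<epsilon>. LINT x|lborel. \<theta> (\<epsilon> *\<^sub>R snd x) * ?F x) \<longlongrightarrow> ?L z t / ?c) (at_right 0)"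
      if \<theta>: "\<theta> \<in> schwartz" "\<theta> 0 = 1" for \<theta>
    proof -
      have "((\<lambda>\<epsilon>. (LINT w|lborel. weyl_kernel \<phi> (\<lambda>x. \<theta> (\<epsilon> *\<^sub>R snd x) * b x) z w * tf_shift w \<phi> t) / ?c)
          \<longlongrightarrow> ?L z t / ?c) (at_right 0)"
        by (intro tendsto_divide tendsto_const cutoff_limit[OF b \<phi> \<theta>] c)
      moreover have "\<forall>\<^sub>F \<epsilon> in at_right 0. (LINT w|lborel. weyl_kernel \<phi> (\<lambda>x. \<theta> (\<epsilon> *\<^sub>R snd x) * b x) z w * tf_shift w \<phi> t) / ?c
          = (LINT x|lborel. \<theta> (\<epsilon> *\<^sub>R snd x) * ?F x)"
        unfolding eventually_at_right_field
      proof (intro exI[of _ 1] conjI allI impI)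
        fix \<epsilon> :: real assume \<epsilon>: "0 < \<epsilon>"
        let ?\<beta> = "\<lambda>x. \<theta> (\<epsilon> *\<^sub>R snd x) * b x"
        have "dbounded (\<lambda>(_::unit) (_::nat) x. jap x ^ M) (\<lambda>_. ?\<beta>)"
          by (rule cutoff_family_dbounded[OF b \<theta>(1), of "\<lambda>_. \<epsilon>" "\<bar>\<epsilon>\<bar>"]) simp
        then have db: "dbounded (\<lambda>(_::unit) (_::unit) x. jap x ^ M) (\<lambda>_. ?\<beta>)"
          unfolding dbounded_def by simp
        have "(LINT w|lborel. weyl_kernel \<phi> ?\<beta> z w * tf_shift w \<phi> t) / ?c = weyl_op ?\<beta> (tf_shift z \<phi>) t"
          using weyl_op_reproducing[OF cutoff_symbol_mult[OF b \<theta>(1) \<epsilon>] db \<phi>, of z t] c by simp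
        also have "\<dots> = (LINT x|lborel. \<theta> (\<epsilon> *\<^sub>R snd x) * ?F x)"
          unfolding weyl_op_def weyl_integrand_def by (intro Bochner_Integration.integral_cong) (auto simp: mult_ac)
        finally show "(LINT w|lborel. weyl_kernel \<phi> ?\<beta> z w * tf_shift w \<phi> t) / ?c = (LINT x|lborel. \<theta> (\<epsilon> *\<^sub>R snd x) * ?F x)" .
      qed simp
      ultimately show ?thesis
        by (rule Lim_transform_eventually)
    qed
    show ?thesis
      unfolding osc_integral_def
    proof (rule the_equality)
      show "\<forall>\<theta>\<in>schwartz. \<theta> 0 = 1 \<longrightarrow> ((\<lambda>\<epsilon>. LINT x|lborel. \<theta> (\<epsilon> *\<^sub>R snd x) * ?F x) \<longlongrightarrow> ?L z t / ?c) (at_right 0)"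
        using lim by blast
      fix L assume L: "\<forall>\<theta>\<in>schwartz. \<theta> 0 = 1 \<longrightarrow> ((\<lambda>\<epsilon>. LINT x|lborel. \<theta> (\<epsilon> *\<^sub>R snd x) * ?F x) \<longlongrightarrow> L) (at_right 0)"
      \<comment> \<open>A normalised translate of the window is an admissible cut-off.\<close>
      let ?\<theta> = "\<lambda>x. (1 / \<phi> x0) * \<phi> (x + x0)"
      have \<theta>: "?\<theta> \<in> schwartz"
        by (intro schwartz_const_mult schwartz_translation \<phi>)
      have 1: "?\<theta> 0 = 1" using x0 by simp
      show "L = ?L z t / ?c"
        by (rule tendsto_unique[OF _ L[rule_format, OF \<theta> 1] lim[OF \<theta> 1]]) simp
    qed
  qed
  then have "weyl b (tf_shift z \<phi>) = (\<lambda>t. (complex_of_real ((2 * pi) powr (- real DIM('a))) / ?c) * ?L z t)" for z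
    unfolding weyl_def by (simp add: fun_eq_iff)
  then show ?thesis by (rule that)
qed


section \<open>Propagation of the wave front set\<close>

text \<open>
  As \<open>\<rho> \<ge> 0\<close>, all derivatives of a symbol are bounded by one and the same power of the weight.
\<close>

lemma shubin_dbounded:
  assumes a: "a \<in> shubin \<rho> m" and \<rho>: "0 \<le> \<rho>"
  obtains M where "dbounded (\<lambda>(_::unit) (_::unit) x. jap x ^ M) (\<lambda>_ z. cnj (a z))"
proof (rule that, rule dbounded_cnj)
  let ?M = "nat \<lceil>\<bar>m\<bar>\<rceil>"
  have "jap x powr (m - \<rho> * real k) \<le> jap x ^ ?M" for x :: "'a \<times> 'a" and k
  proof -
    have "m - \<rho> * real k \<le> real ?M"
      using mult_nonneg_nonneg[OF \<rho>, of "real k"] by linarith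
    then have "jap x powr (m - \<rho> * real k) \<le> jap x powr real ?M"
      by (intro powr_mono jap_ge_1)
    then show ?thesis by (simp only: powr_realpow[OF jap_pos])
  qed
  note le = this
  show "dbounded (\<lambda>(_::unit) (_::unit) x. jap x ^ ?M) (\<lambda>_. a)"
    unfolding dbounded_def
  proof safe
    show "smooth a" using a by (simp add: shubin_def)
    fix bs :: "('a \<times> 'a) list" assume "set bs \<subseteq> Basis"
    then obtain C where C: "C > 0" "\<And>x \<xi>. norm (partials bs a (x, \<xi>)) \<le> C * jap (x, \<xi>) powr (m - \<rho> * real (length bs))"
      using a unfolding shubin_def by blast
    have "norm (partials bs a x) \<le> C * jap x ^ ?M" for x
    proof -
      have "C * jap x powr (m - \<rho> * real (length bs)) \<le> C * jap x ^ ?M"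
        using C(1) by (intro mult_left_mono le) auto
      then show ?thesis
        using C(2)[of "fst x" "snd x"] by simp
    qed
    then show "\<exists>C\<ge>0. \<forall>i x. norm (partials bs a x) \<le> C * jap x ^ ?M"
      using C(1) by (intro exI[of _ C]) auto
  qed
qed

lemma schwartz_seminorm_cnj:
  assumes "f \<in> schwartz"
  shows "schwartz_seminorm k (\<lambda>x. cnj (f x)) = schwartz_seminorm k f"
  unfolding schwartz_seminorm_def
  by (intro SUP_cong) (auto simp: partials_cnj schwartz_smooth[OF assms])

text \<open>
  Double conjugation makes the sesquilinear action of \<open>u\<close> the conjugate of a linear one, to which
  the results on superpositions apply.
\<close>

lemma tempered_cnj:
  assumes u: "u \<in> tempered"
  shows "(\<lambda>f. cnj (u (\<lambda>x. cnj (f x)))) \<in> tempered"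
  unfolding tempered_def
proof (intro CollectI conjI ballI allI)
  show "cnj (u (\<lambda>x. cnj (f x + g x))) = cnj (u (\<lambda>x. cnj (f x))) + cnj (u (\<lambda>x. cnj (g x)))"
    if "f \<in> schwartz" "g \<in> schwartz" for f g
    using tempered_add[OF u schwartz_cnj[OF that(1)] schwartz_cnj[OF that(2)]] by simp
  show "cnj (u (\<lambda>x. cnj (c * f x))) = c * cnj (u (\<lambda>x. cnj (f x)))" if "f \<in> schwartz" for c f
    using tempered_mult[OF u schwartz_cnj[OF that], of "cnj c"] by simp
  obtain C k where "\<forall>f\<in>schwartz. norm (u f) \<le> C * schwartz_seminorm k f"
    using u unfolding tempered_def by blast
  then show "\<exists>C k. \<forall>f\<in>schwartz. norm (cnj (u (\<lambda>x. cnj (f x)))) \<le> C * schwartz_seminorm k f"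
    by (intro exI[of _ C] exI[of _ k]) (metis complex_mod_cnj schwartz_cnj schwartz_seminorm_cnj)
qed

text \<open>
  Along the curves \<open>(r x, r\<^sup>s \<xi>)\<close> with \<open>(x, \<xi>)\<close> in \<open>U\<close> the function \<open>v\<close> decreases rapidly as \<open>r\<close> tends to
  infinity.  A point \<open>w\<close> whose rescaling by \<open>1 / r\<close> and \<open>1 / r\<^sup>s\<close> does not lie in \<open>U\<close> has a distance
  from \<open>(r x, r\<^sup>s \<xi>)\<close> of at least a positive power of \<open>r\<close> if \<open>(x, \<xi>)\<close> lies in the smaller ball.  Then
  the off-diagonal decay of the kernel compensates the polynomial growth of all other factors.
  For \<open>r \<le> 1\<close> everything stays bounded.
\<close>

lemma anisotropic_kernel_estimate:
  fixes k :: "'a::euclidean_space \<times> 'a \<Rightarrow> 'a \<times> 'a \<Rightarrow> real" and v :: "'a \<times> 'a \<Rightarrow> real"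
  assumes s: "s > 0" and N: "N \<ge> 0" and \<delta>: "\<delta> > 0" and U: "ball z0 (2 * \<delta>) \<subseteq> U"
    and k: "\<And>z w. 0 \<le> k z w" "\<And>L. \<exists>C\<ge>0. \<forall>z w. k z w \<le> C * jap z ^ M / jap (z - w) ^ L"
    and v: "\<And>w. 0 \<le> v w" "A \<ge> 0" "\<And>w. v w \<le> A * jap w ^ l"
    and vU: "\<And>N'. N' \<ge> 0 \<Longrightarrow> \<exists>B. \<forall>x \<xi> r. (x, \<xi>) \<in> U \<longrightarrow> r > 0 \<longrightarrow> r powr N' * v (r *\<^sub>R x, r powr s *\<^sub>R \<xi>) \<le> B"
  shows "\<exists>D\<ge>0. \<forall>x \<xi> r w. (x, \<xi>) \<in> ball z0 \<delta> \<longrightarrow> r > 0 \<longrightarrow>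
    r powr N * (k (r *\<^sub>R x, r powr s *\<^sub>R \<xi>) w * v w) \<le> D / jap ((r *\<^sub>R x, r powr s *\<^sub>R \<xi>) - w) ^ n"
proof -
  define R where "R = norm z0 + \<delta>"
  have R0: "0 \<le> R" using \<delta> by (simp add: R_def)
  define \<sigma> where "\<sigma> = max 1 s"
  define \<kappa> where "\<kappa> = min 1 s"
  have \<kappa>: "\<kappa> > 0" using s by (simp add: \<kappa>_def)
  have xR: "norm x \<le> R" "norm \<xi> \<le> R" if "(x, \<xi>) \<in> ball z0 \<delta>" for x \<xi>
  proof -
    have "norm (x, \<xi>) \<le> R"
      using that norm_triangle_ineq2[of "(x, \<xi>)" z0] by (simp add: R_def dist_norm norm_minus_commute)
    then show "norm x \<le> R" "norm \<xi> \<le> R"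
      using norm_fst_le[of x \<xi>] norm_snd_le[of \<xi> x] by linarith+
  qed
  \<comment> \<open>The decay \<open>r powr (- \<kappa> * L1)\<close> off the diagonal beats \<open>r powr N\<close> and the growth \<open>r powr (\<sigma> * (M + l))\<close>.\<close>
  define L1 where "L1 = nat \<lceil>(N + \<sigma> * real (M + l)) / \<kappa>\<rceil>"
  have L1: "N + \<sigma> * real (M + l) \<le> \<kappa> * real L1"
  proof -
    have "(N + \<sigma> * real (M + l)) / \<kappa> \<le> real L1"
      unfolding L1_def by (rule real_nat_ceiling_ge)
    then show ?thesis using \<kappa> by (simp add: field_simps)
  qed
  obtain C0 where C0: "C0 \<ge> 0" "\<And>z w. k z w \<le> C0 * jap z ^ M / jap (z - w) ^ n"
    using k(2)[of n] by blast
  obtain C1 where C1: "C1 \<ge> 0" "\<And>z w. k z w \<le> C1 * jap z ^ M / jap (z - w) ^ (n + l)"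
    using k(2)[of "n + l"] by blast
  obtain C2 where C2: "C2 \<ge> 0" "\<And>z w. k z w \<le> C2 * jap z ^ M / jap (z - w) ^ (n + L1 + l)"
    using k(2)[of "n + L1 + l"] by blast
  \<comment> \<open>In \<open>U\<close> the decay of \<open>v\<close> also has to absorb the growth of the kernel in its first argument.\<close>
  define N' where "N' = N + \<sigma> * real M"
  have "N' \<ge> 0" using N by (simp add: N'_def \<sigma>_def)
  then obtain B' where B': "\<And>x \<xi> r. (x, \<xi>) \<in> U \<Longrightarrow> r > 0 \<Longrightarrow> r powr N' * v (r *\<^sub>R x, r powr s *\<^sub>R \<xi>) \<le> B'"
    using vU by blast
  define B where "B = max 0 B'"
  have B: "B \<ge> 0" "\<And>x \<xi> r. (x, \<xi>) \<in> U \<Longrightarrow> r > 0 \<Longrightarrow> r powr N' * v (r *\<^sub>R x, r powr s *\<^sub>R \<xi>) \<le> B"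
  proof -
    show "B \<ge> 0" by (simp add: B_def)
    show "r powr N' * v (r *\<^sub>R x, r powr s *\<^sub>R \<xi>) \<le> B" if "(x, \<xi>) \<in> U" "r > 0" for x \<xi> r
      using B'[OF that] unfolding B_def by linarith
  qed
  have vz: "v w \<le> A * 2 ^ l * jap z ^ l * jap (z - w) ^ l" for z w
  proof -
    have "v w \<le> A * (2 ^ l * jap (w - z) ^ l * jap z ^ l)"
      using v(2) by (intro order.trans[OF v(3)] mult_left_mono jap_le_diff_power) auto
    then show ?thesis by (simp add: jap_commute[of w z] mult_ac)
  qed
  define D1 where "D1 = C1 * A * 2 ^ l * (1 + 2 * R) ^ (M + l)"
  define D2 where "D2 = C0 * B * (1 + 2 * R) ^ M"
  define D3 where "D3 = C2 * A * 2 ^ l * (1 + 2 * R) ^ (M + l) / \<delta> ^ L1"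
  have D0: "D1 \<ge> 0" "D2 \<ge> 0" "D3 \<ge> 0"
    using C0(1) C1(1) C2(1) v(2) B(1) R0 \<delta> by (simp_all add: D1_def D2_def D3_def)
  have "r powr N * (k (r *\<^sub>R x, r powr s *\<^sub>R \<xi>) w * v w) \<le> (D1 + D2 + D3) / jap ((r *\<^sub>R x, r powr s *\<^sub>R \<xi>) - w) ^ n"
    if x: "(x, \<xi>) \<in> ball z0 \<delta>" and r: "r > 0" for x \<xi> r w
  proof -
    define z where "z = (r *\<^sub>R x, r powr s *\<^sub>R \<xi>)"
    have nz: "norm z \<le> r * norm x + r powr s * norm \<xi>"
      unfolding z_def using norm_Pair_le[of "r *\<^sub>R x" "r powr s *\<^sub>R \<xi>"] r by simp
    have jz: "jap z ^ j \<le> (1 + 2 * R) ^ j * r powr (\<sigma> * real j)" if "r \<ge> 1" for j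
    proof -
      have p1: "1 \<le> r powr \<sigma>"
        using that by (intro ge_one_powr_ge_zero) (auto simp: \<sigma>_def)
      have "r powr 1 \<le> r powr \<sigma>" "r powr s \<le> r powr \<sigma>"
        using that by (intro powr_mono; simp add: \<sigma>_def)+
      then have "r * norm x + r powr s * norm \<xi> \<le> r powr \<sigma> * R + r powr \<sigma> * R"
        using r xR[OF x] by (intro add_mono mult_mono) auto
      also have "\<dots> = 2 * R * r powr \<sigma>"
        by (simp add: mult.commute)
      finally have "jap z \<le> 1 + 2 * R * r powr \<sigma>"
        using jap_le_norm[of z] nz by linarith
      also have "\<dots> \<le> (1 + 2 * R) * r powr \<sigma>"
        using p1 by (simp add: distrib_right)
      finally have "jap z ^ j \<le> ((1 + 2 * R) * r powr \<sigma>) ^ j"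
        by (rule power_mono) simp
      then show ?thesis
        using r by (simp add: power_mult_distrib powr_power mult.commute)
    qed
    consider "r \<le> 1" | "r \<ge> 1" "((1 / r) *\<^sub>R fst w, (1 / r powr s) *\<^sub>R snd w) \<in> U"
      | "r \<ge> 1" "((1 / r) *\<^sub>R fst w, (1 / r powr s) *\<^sub>R snd w) \<notin> U"
      by linarith
    then have "\<exists>D\<in>{D1, D2, D3}. r powr N * (k z w * v w) \<le> D / jap (z - w) ^ n"
    proof cases
      case 1
      have "r powr s \<le> 1" "r powr N \<le> 1"
        using 1 r s N by (auto intro!: powr_le1)
      then have "r * norm x + r powr s * norm \<xi> \<le> 1 * R + 1 * R"
        using 1 r xR[OF x] by (intro add_mono mult_mono) auto
      then have jz: "jap z \<le> 1 + 2 * R"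
        using jap_le_norm[of z] nz by linarith
      have "k z w * v w \<le> (C1 * jap z ^ M / jap (z - w) ^ (n + l)) * (A * 2 ^ l * jap z ^ l * jap (z - w) ^ l)"
        using C1(1) by (intro mult_mono C1 vz v(1)) auto
      also have "\<dots> = C1 * A * 2 ^ l * jap z ^ (M + l) / jap (z - w) ^ n"
        by (simp add: power_add)
      also have "\<dots> \<le> D1 / jap (z - w) ^ n"
        unfolding D1_def using C1(1) v(2) by (intro divide_right_mono mult_left_mono power_mono jz) auto
      finally have "r powr N * (k z w * v w) \<le> 1 * (D1 / jap (z - w) ^ n)"
        using \<open>r powr N \<le> 1\<close> k(1)[of z w] v(1)[of w] by (intro mult_mono) auto
      then show ?thesis by auto
    next
      case 2
      have "w = (r *\<^sub>R ((1 / r) *\<^sub>R fst w), r powr s *\<^sub>R ((1 / r powr s) *\<^sub>R snd w))"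
        using r by simp
      then have vw: "r powr N' * v w \<le> B"
        using B(2)[OF 2(2) r] by metis
      have "r powr N * (k z w * v w) \<le> r powr N * ((C0 * jap z ^ M / jap (z - w) ^ n) * v w)"
        by (intro mult_left_mono mult_right_mono C0 v(1)) auto
      also have "\<dots> \<le> r powr N * ((C0 * ((1 + 2 * R) ^ M * r powr (\<sigma> * real M)) / jap (z - w) ^ n) * v w)"
        using C0(1) by (intro mult_left_mono mult_right_mono divide_right_mono jz 2(1) v(1)) auto
      also have "\<dots> = (C0 * (1 + 2 * R) ^ M / jap (z - w) ^ n) * (r powr N' * v w)"
        by (simp add: N'_def powr_add)
      also have "\<dots> \<le> (C0 * (1 + 2 * R) ^ M / jap (z - w) ^ n) * B"
        using C0(1) R0 by (intro mult_left_mono vw) auto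
      also have "\<dots> = D2 / jap (z - w) ^ n"
        by (simp add: D2_def)
      finally show ?thesis by blast
    next
      case 3
      let ?y = "(1 / r) *\<^sub>R fst w" and ?\<eta> = "(1 / r powr s) *\<^sub>R snd w"
      let ?d = "(x - ?y, \<xi> - ?\<eta>)"
      have "(?y, ?\<eta>) \<notin> ball z0 (2 * \<delta>)"
        using 3(2) U by blast
      then have "\<delta> \<le> dist (x, \<xi>) (?y, ?\<eta>)"
        using x dist_triangle[of z0 "(?y, ?\<eta>)" "(x, \<xi>)"] by (auto simp: not_less)
      then have d: "\<delta> \<le> norm ?d"
        by (simp add: dist_norm)
      have zw: "z - w = (r *\<^sub>R (x - ?y), r powr s *\<^sub>R (\<xi> - ?\<eta>))"
        using r by (simp add: z_def prod_eq_iff scaleR_diff_right)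
      have "r powr \<kappa> * norm ?d \<le> norm (z - w)"
      proof (rule power2_le_imp_le)
        have "r powr \<kappa> \<le> r powr 1" "r powr \<kappa> \<le> r powr s"
          using 3(1) by (intro powr_mono; simp add: \<kappa>_def)+
        then have "(r powr \<kappa>)\<^sup>2 \<le> r\<^sup>2" "(r powr \<kappa>)\<^sup>2 \<le> (r powr s)\<^sup>2"
          using r by (auto intro!: power_mono)
        then have "(r powr \<kappa>)\<^sup>2 * (norm (x - ?y))\<^sup>2 + (r powr \<kappa>)\<^sup>2 * (norm (\<xi> - ?\<eta>))\<^sup>2
            \<le> r\<^sup>2 * (norm (x - ?y))\<^sup>2 + (r powr s)\<^sup>2 * (norm (\<xi> - ?\<eta>))\<^sup>2"
          by (intro add_mono mult_right_mono) auto
        then show "(r powr \<kappa> * norm ?d)\<^sup>2 \<le> (norm (z - w))\<^sup>2"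
          unfolding zw by (simp add: norm_Pair power_mult_distrib distrib_left)
      qed simp
      moreover have "\<delta> * r powr \<kappa> \<le> r powr \<kappa> * norm ?d"
        using mult_right_mono[OF d, of "r powr \<kappa>"] by (simp add: mult.commute)
      ultimately have "\<delta> * r powr \<kappa> \<le> jap (z - w)"
        using norm_le_jap[of "z - w"] by linarith
      then have "(\<delta> * r powr \<kappa>) ^ L1 \<le> jap (z - w) ^ L1"
        using \<delta> by (intro power_mono) auto
      then have zwL: "\<delta> ^ L1 * r powr (\<kappa> * real L1) \<le> jap (z - w) ^ L1"
        using r by (simp add: power_mult_distrib powr_power mult.commute)
      have "k z w * v w \<le> (C2 * jap z ^ M / jap (z - w) ^ (n + L1 + l)) * (A * 2 ^ l * jap z ^ l * jap (z - w) ^ l)"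
        using C2(1) by (intro mult_mono C2 vz v(1)) auto
      also have "\<dots> = (C2 * A * 2 ^ l / jap (z - w) ^ n) * (jap z ^ (M + l) / jap (z - w) ^ L1)"
        by (simp add: power_add)
      also have "\<dots> \<le> (C2 * A * 2 ^ l / jap (z - w) ^ n) *
          (((1 + 2 * R) ^ (M + l) * r powr (\<sigma> * real (M + l))) / (\<delta> ^ L1 * r powr (\<kappa> * real L1)))"
        using C2(1) v(2) R0 \<delta> r by (intro mult_left_mono frac_le jz 3(1) zwL) auto
      also have "\<dots> = (D3 / jap (z - w) ^ n) * r powr (\<sigma> * real (M + l) - \<kappa> * real L1)"
        using r by (simp add: D3_def powr_diff mult_ac)
      finally have "r powr N * (k z w * v w) \<le> r powr N * ((D3 / jap (z - w) ^ n) * r powr (\<sigma> * real (M + l) - \<kappa> * real L1))"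
        by (intro mult_left_mono) auto
      also have "\<dots> = (D3 / jap (z - w) ^ n) * r powr (N + (\<sigma> * real (M + l) - \<kappa> * real L1))"
        by (simp add: powr_add)
      also have "\<dots> \<le> (D3 / jap (z - w) ^ n) * 1"
      proof (intro mult_left_mono)
        have "r powr (N + (\<sigma> * real (M + l) - \<kappa> * real L1)) \<le> r powr 0"
          using L1 3(1) by (intro powr_mono) auto
        then show "r powr (N + (\<sigma> * real (M + l) - \<kappa> * real L1)) \<le> 1"
          using r by simp
      qed (use D0 in simp)
      finally show ?thesis by auto
    qed
    then obtain D where "D \<in> {D1, D2, D3}" and D: "r powr N * (k z w * v w) \<le> D / jap (z - w) ^ n"
      by blast
    then have "D \<le> D1 + D2 + D3"
      using D0 by auto
    then have "D / jap (z - w) ^ n \<le> (D1 + D2 + D3) / jap (z - w) ^ n"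
      by (intro divide_right_mono) auto
    with D show ?thesis
      unfolding z_def by linarith
  qed
  then show ?thesis
    using D0 by (intro exI[of _ "D1 + D2 + D3"]) auto
qed

lemma weyl_kernel_rapidly_decaying:
  fixes b :: "'a::euclidean_space \<times> 'a \<Rightarrow> complex"
  assumes b: "dbounded (\<lambda>(_::unit) (_::unit) x. jap x ^ M) (\<lambda>_. b)" and \<phi>: "\<phi> \<in> schwartz"
  shows "rapidly_decaying (weyl_kernel \<phi> b z)"
  unfolding rapidly_decaying_def
proof (intro conjI allI)
  show "weyl_kernel \<phi> b z \<in> borel_measurable borel"
    by (intro weyl_kernel_measurable smooth_measurable dbounded_smooth[OF b] \<phi>)
  fix N
  obtain C where C: "C \<ge> 0" "\<And>z w. norm (weyl_kernel \<phi> b z w) \<le> C * jap z ^ M / jap (z - w) ^ N"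
    by (rule weyl_kernel_decay[OF b \<phi>]) (rule that)
  have "norm (weyl_kernel \<phi> b z w) \<le> (C * jap z ^ M * 2 ^ N * jap z ^ N) / jap w ^ N" for w
  proof -
    have "C * jap z ^ M * (1 / jap (w - z) ^ N) \<le> C * jap z ^ M * (2 ^ N * jap z ^ N / jap w ^ N)"
      using C(1) by (intro mult_left_mono inverse_jap_shift) auto
    then show ?thesis
      using C(2)[of z w] by (simp add: jap_commute[of w z] mult_ac)
  qed
  then show "\<exists>C\<ge>0. \<forall>w. norm (weyl_kernel \<phi> b z w) \<le> C / jap w ^ N"
    using C(1) by (intro exI[of _ "C * jap z ^ M * 2 ^ N * jap z ^ N"]) auto
qed

text \<open>
  Up to a constant and complex conjugation, the transform of \<open>a\<^sup>w u\<close> arises from that of \<open>u\<close> by the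
  integral operator whose kernel is the Weyl kernel of the conjugate symbol.
\<close>

lemma stft_weyl_dist_bound:
  fixes \<phi> :: "'a::euclidean_space \<Rightarrow> complex"
  assumes u: "u \<in> tempered" and b: "dbounded (\<lambda>(_::unit) (_::unit) x. jap x ^ M) (\<lambda>_ z. cnj (a z))"
    and \<phi>: "\<phi> \<in> schwartz" "\<phi> \<noteq> (\<lambda>_. 0)"
  obtains K where "K \<ge> 0"
    "\<And>z. integrable lborel (\<lambda>w. norm (weyl_kernel \<phi> (\<lambda>z. cnj (a z)) z w) * norm (stft \<phi> u w))"
    "\<And>z. norm (stft \<phi> (weyl_dist a u) z)
      \<le> K * (LINT w|lborel. norm (weyl_kernel \<phi> (\<lambda>z. cnj (a z)) z w) * norm (stft \<phi> u w))"
proof -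
  let ?b = "\<lambda>z. cnj (a z)"
  define c where "c = (2 * pi) powr (- real DIM('a) / 2)"
  have c: "c > 0" by (simp add: c_def)
  define u' where "u' = (\<lambda>f. cnj (u (\<lambda>x. cnj (f x))))"
  have u': "u' \<in> tempered"
    unfolding u'_def by (rule tempered_cnj[OF u])
  have F: "tf_family (\<lambda>w. tf_shift w \<phi>)"
    by (rule tf_family.shift[OF \<phi>(1)])
  obtain \<kappa> where \<kappa>: "\<And>z. weyl ?b (tf_shift z \<phi>) = (\<lambda>t. \<kappa> * (LINT w|lborel. weyl_kernel \<phi> ?b z w * tf_shift w \<phi> t))"
    by (rule weyl_tf_shift[OF b \<phi>]) (rule that)
  have su: "norm (stft \<phi> u z) = c * norm (u' (tf_shift z \<phi>))" for z
    using c by (cases z) (simp add: stft_def modulation_translation sesq_def u'_def norm_mult c_def)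
  have K: "rapidly_decaying (weyl_kernel \<phi> ?b z)" for z
    by (rule weyl_kernel_rapidly_decaying[OF b \<phi>(1)])
  have sw: "norm (stft \<phi> (weyl_dist a u) z) = c * norm \<kappa> * norm (LINT w|lborel. weyl_kernel \<phi> ?b z w * u' (tf_shift w \<phi>))" for z
  proof -
    have S: "(\<lambda>t. LINT w|lborel. weyl_kernel \<phi> ?b z w * tf_shift w \<phi> t) \<in> schwartz"
      using superposition_schwartz[OF F K, of "\<lambda>w. w" "[]"] by simp
    have "sesq (weyl_dist a u) (tf_shift z \<phi>) = u (\<lambda>x. cnj (weyl ?b (tf_shift z \<phi>) x))"
      unfolding weyl_dist_sesq by (simp add: sesq_def)
    then have "norm (stft \<phi> (weyl_dist a u) z) = c * norm (u' (weyl ?b (tf_shift z \<phi>)))"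
      using c by (cases z) (simp add: stft_def modulation_translation u'_def norm_mult c_def)
    also have "u' (weyl ?b (tf_shift z \<phi>)) = \<kappa> * u' (\<lambda>t. LINT w|lborel. weyl_kernel \<phi> ?b z w * tf_shift w \<phi> t)"
      unfolding \<kappa> by (rule tempered_mult[OF u' S])
    also have "u' (\<lambda>t. LINT w|lborel. weyl_kernel \<phi> ?b z w * tf_shift w \<phi> t) = (LINT w|lborel. weyl_kernel \<phi> ?b z w * u' (tf_shift w \<phi>))"
      by (rule tempered_superposition[OF u' F K])
    finally show ?thesis by (simp add: norm_mult)
  qed
  obtain A l where A: "A \<ge> 0" "\<And>w. norm (u' (tf_shift w \<phi>)) \<le> A * jap w ^ l"
    using tempered_tf_bound[OF u' F] by blast
  have mu: "(\<lambda>w. u' (tf_shift w \<phi>)) \<in> borel_measurable borel"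
    by (intro borel_measurable_continuous_onI tempered_tf_continuous u' F)
  have int: "integrable lborel (\<lambda>w. norm (weyl_kernel \<phi> ?b z w) * norm (u' (tf_shift w \<phi>)))" for z
  proof (rule integrable_dominated)
    show "integrable lborel (\<lambda>w. A * (norm (weyl_kernel \<phi> ?b z w) * jap w ^ l))"
      by (intro integrable_mult_right rapidly_decaying_integrable K)
    show "(\<lambda>w. norm (weyl_kernel \<phi> ?b z w) * norm (u' (tf_shift w \<phi>))) \<in> borel_measurable lborel"
      using mu rapidly_decaying_measurable[OF K[of z]] by measurable
    show "norm (norm (weyl_kernel \<phi> ?b z w) * norm (u' (tf_shift w \<phi>))) \<le> A * (norm (weyl_kernel \<phi> ?b z w) * jap w ^ l)" for w
      using mult_left_mono[OF A(2)[of w], of "norm (weyl_kernel \<phi> ?b z w)"] by (simp add: abs_mult mult_ac)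
  qed
  show ?thesis
  proof (rule that[of "norm \<kappa>"])
    show "integrable lborel (\<lambda>w. norm (weyl_kernel \<phi> ?b z w) * norm (stft \<phi> u w))" for z
      using integrable_mult_right[OF int[of z], of c] by (simp add: su mult_ac)
    show "norm (stft \<phi> (weyl_dist a u) z) \<le> norm \<kappa> * (LINT w|lborel. norm (weyl_kernel \<phi> ?b z w) * norm (stft \<phi> u w))" for z
    proof -
      have "norm (LINT w|lborel. weyl_kernel \<phi> ?b z w * u' (tf_shift w \<phi>))
          \<le> (LINT w|lborel. norm (weyl_kernel \<phi> ?b z w) * norm (u' (tf_shift w \<phi>)))"
        using integral_norm_bound[of lborel "\<lambda>w. weyl_kernel \<phi> ?b z w * u' (tf_shift w \<phi>)"] by (simp add: norm_mult)
      then have "norm (stft \<phi> (weyl_dist a u) z) \<le> norm \<kappa> * (c * (LINT w|lborel. norm (weyl_kernel \<phi> ?b z w) * norm (u' (tf_shift w \<phi>))))"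
        unfolding sw using c by (simp add: mult_left_mono mult_ac)
      also have "c * (LINT w|lborel. norm (weyl_kernel \<phi> ?b z w) * norm (u' (tf_shift w \<phi>)))
          = (LINT w|lborel. norm (weyl_kernel \<phi> ?b z w) * norm (stft \<phi> u w))"
        unfolding integral_mult_right_zero[symmetric] by (simp add: su mult_ac)
      finally show ?thesis .
    qed
  qed simp
qed

lemma stft_growth:
  fixes \<phi> :: "'a::euclidean_space \<Rightarrow> complex"
  assumes u: "u \<in> tempered" and \<phi>: "\<phi> \<in> schwartz"
  obtains A l where "A \<ge> 0" "\<And>w. norm (stft \<phi> u w) \<le> A * jap w ^ l"
proof -
  define c where "c = (2 * pi) powr (- real DIM('a) / 2)"
  have c: "c > 0" by (simp add: c_def)
  obtain A l where A: "A \<ge> 0" "\<And>w. norm (cnj (u (\<lambda>x. cnj (tf_shift w \<phi> x)))) \<le> A * jap w ^ l"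
    using tempered_tf_bound[OF tempered_cnj[OF u] tf_family.shift[OF \<phi>]] by blast
  have "norm (stft \<phi> u w) \<le> c * A * jap w ^ l" for w
  proof -
    have "norm (stft \<phi> u w) = c * norm (u (\<lambda>x. cnj (tf_shift w \<phi> x)))"
      using c by (cases w) (simp add: stft_def modulation_translation sesq_def norm_mult c_def)
    also have "\<dots> \<le> c * (A * jap w ^ l)"
      using c A(2)[of w] by (intro mult_left_mono) auto
    finally show ?thesis by (simp add: mult.assoc)
  qed
  then show ?thesis
    using c A(1) by (intro that[of "c * A" l]) auto
qed

theorem gabor_WF_weyl_dist:
  fixes \<phi> :: "'a::euclidean_space \<Rightarrow> complex"
  assumes s: "s > 0" and \<rho>: "0 \<le> \<rho>" and \<phi>: "\<phi> \<in> schwartz" "\<phi> \<noteq> (\<lambda>_. 0)"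
    and u: "u \<in> tempered" and a: "a \<in> shubin \<rho> m"
  shows "gabor_WF s \<phi> (weyl_dist a u) \<subseteq> gabor_WF s \<phi> u"
proof (rule subsetI, rule ccontr)
  fix z0 assume z0: "z0 \<in> gabor_WF s \<phi> (weyl_dist a u)" and not: "z0 \<notin> gabor_WF s \<phi> u"
  have "z0 \<noteq> 0"
    using z0 by (simp add: gabor_WF_def)
  with not obtain U where U: "open U" "z0 \<in> U"
    and U_bdd: "\<And>N. N \<ge> 0 \<Longrightarrow> bdd_above {r powr N * norm (stft \<phi> u (r *\<^sub>R x, r powr s *\<^sub>R \<xi>)) | x \<xi> r. (x, \<xi>) \<in> U \<and> r > 0}"
    unfolding gabor_WF_def by auto
  obtain \<epsilon> where \<epsilon>: "\<epsilon> > 0" "ball z0 \<epsilon> \<subseteq> U"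
    using U open_contains_ball by blast
  define \<delta> where "\<delta> = \<epsilon> / 2"
  have \<delta>: "\<delta> > 0" "ball z0 (2 * \<delta>) \<subseteq> U"
    using \<epsilon> by (auto simp: \<delta>_def)
  obtain M where b: "dbounded (\<lambda>(_::unit) (_::unit) x. jap x ^ M) (\<lambda>_ z. cnj (a z))"
    using shubin_dbounded[OF a \<rho>] by blast
  define k where "k z w = norm (weyl_kernel \<phi> (\<lambda>z. cnj (a z)) z w)" for z w
  define v where "v w = norm (stft \<phi> u w)" for w
  obtain A l where A: "A \<ge> 0" "\<And>w. v w \<le> A * jap w ^ l"
    using stft_growth[OF u \<phi>(1)] unfolding v_def by blast
  obtain K where K: "K \<ge> 0" "\<And>z. integrable lborel (\<lambda>w. k z w * v w)"
    "\<And>z. norm (stft \<phi> (weyl_dist a u) z) \<le> K * (LINT w|lborel. k z w * v w)"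
    using stft_weyl_dist_bound[OF u b \<phi>] unfolding k_def v_def by blast
  have k_decay: "\<exists>C\<ge>0. \<forall>z w. k z w \<le> C * jap z ^ M / jap (z - w) ^ L" for L
  proof -
    obtain C where "C \<ge> 0" "\<And>z w. norm (weyl_kernel \<phi> (\<lambda>z. cnj (a z)) z w) \<le> C * jap z ^ M / jap (z - w) ^ L"
      by (rule weyl_kernel_decay[OF b \<phi>(1)]) (rule that)
    then show ?thesis unfolding k_def by blast
  qed
  have v_U: "\<exists>B. \<forall>x \<xi> r. (x, \<xi>) \<in> U \<longrightarrow> r > 0 \<longrightarrow> r powr N * v (r *\<^sub>R x, r powr s *\<^sub>R \<xi>) \<le> B" if "N \<ge> 0" for N
    using U_bdd[OF that] unfolding bdd_above_def v_def by blast
  let ?n = "2 * DIM('a \<times> 'a)"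
  have "bdd_above {r powr N * norm (stft \<phi> (weyl_dist a u) (r *\<^sub>R x, r powr s *\<^sub>R \<xi>)) | x \<xi> r. (x, \<xi>) \<in> ball z0 \<delta> \<and> r > 0}"
    if N: "N \<ge> 0" for N
  proof -
    obtain D where D: "D \<ge> 0" "\<And>x \<xi> r w. (x, \<xi>) \<in> ball z0 \<delta> \<Longrightarrow> r > 0 \<Longrightarrow>
        r powr N * (k (r *\<^sub>R x, r powr s *\<^sub>R \<xi>) w * v w) \<le> D / jap ((r *\<^sub>R x, r powr s *\<^sub>R \<xi>) - w) ^ ?n"
      using anisotropic_kernel_estimate[OF s N \<delta>, of k M v A l ?n] k_decay A v_U
      by (auto simp: k_def v_def)
    let ?I = "LINT w|lborel. 1 / jap (w :: 'a \<times> 'a) ^ ?n"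
    have "r powr N * norm (stft \<phi> (weyl_dist a u) (r *\<^sub>R x, r powr s *\<^sub>R \<xi>)) \<le> K * (D * ?I)"
      if x: "(x, \<xi>) \<in> ball z0 \<delta>" and r: "r > 0" for x \<xi> r
    proof -
      let ?z = "(r *\<^sub>R x, r powr s *\<^sub>R \<xi>)"
      have "r powr N * norm (stft \<phi> (weyl_dist a u) ?z) \<le> r powr N * (K * (LINT w|lborel. k ?z w * v w))"
        by (intro mult_left_mono K) auto
      also have "\<dots> = K * (LINT w|lborel. r powr N * (k ?z w * v w))"
        by (simp only: integral_mult_right_zero mult.left_commute)
      also have "\<dots> \<le> K * (LINT w|lborel. D * (1 / jap (w - ?z) ^ ?n))"
      proof (intro mult_left_mono[OF _ K(1)] integral_mono)
        show "integrable lborel (\<lambda>w. r powr N * (k ?z w * v w))"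
          by (intro integrable_mult_right K)
        show "integrable lborel (\<lambda>w. D * (1 / jap (w - ?z) ^ ?n))"
          by (intro integrable_mult_right integrable_jap_shift(1)) simp
        show "r powr N * (k ?z w * v w) \<le> D * (1 / jap (w - ?z) ^ ?n)" for w
          using D(2)[OF x r, of w] by (simp add: jap_commute[of w])
      qed
      also have "\<dots> = K * (D * ?I)"
        by (simp only: integral_mult_right_zero integrable_jap_shift(2)[OF order_refl])
      finally show ?thesis .
    qed
    then show ?thesis
      by (intro bdd_aboveI[of _ "K * (D * ?I)"]) blast
  qed
  moreover have "z0 \<in> ball z0 \<delta>" "open (ball z0 \<delta>)"
    using \<delta> by auto
  ultimately show False
    using z0 unfolding gabor_WF_def by blast
qed


theorem proposition5p1:
  fixes s m \<rho> :: real
    and \<phi> :: "real ^ 'n \<Rightarrow> complex"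
    and u :: "(real ^ 'n \<Rightarrow> complex) \<Rightarrow> complex"
    and a :: "(real ^ 'n) \<times> (real ^ 'n) \<Rightarrow> complex"
  assumes "s > 0" and "0 \<le> \<rho>" and "\<rho> \<le> 1"
    and "\<phi> \<in> schwartz" and "\<phi> \<noteq> (\<lambda>_. 0)"
    and "u \<in> tempered"
    and "a \<in> shubin \<rho> m"
  shows "gabor_WF s \<phi> (weyl_dist a u) \<subseteq> gabor_WF s \<phi> u"
  by (rule gabor_WF_weyl_dist) (fact assms)+

end
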